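(* Let $a=(a^{ij})$ be a constant symmetric real $d\times d$ matrix such that $a^{ij}\lambda^i\lambda^j\ge|\lambda|^2$ for all $\lambda\in\mathbb{R}^d$, let $u\in C_0^\infty(\mathbb{R}^d)$, and set $f=a^{ij}D_{ij}u$. Then for all $i,j=1,\dots,d$ and every unit vector $l\in\mathbb{R}^d$, $$[D_{ij}u]_{C^\alpha(\mathbb{R}^d)}\le N'(\alpha)N_0(\alpha)[f]_{C^\alpha(\mathbb{R}^d)},\qquad \|D_l^2u\|^p_{L_p(\mathbb{R}^d)}\le N_p\|f\|^p_{L_p(\mathbb{R}^d)}.$$
   Context: Fix $\alpha\in(0,1)$, $p\in(1,\infty)$, $d\ge1$. Summation over repeated indices is understood. $D_{ij}=\partial^2/\partial x^i\partial x^j$, $D_l^2=l^il^jD_{ij}$. $[f]_{C^\alpha(\mathbb{R}^d)}=\sup_{x\ne y}|f(x)-f(y)|/|x-y|^\alpha$; $C^{2+\alpha}(\mathbb{R}^d)$ is the space of twice continuously differentiable real $f$ with $\sup_x(|f|+|Df|+|D^2f|)+[D^2f]_{C^\alpha(\mathbb{R}^d)}<\infty$. $B_c((0,T),C_0^\infty(\mathbb{R}))$ is the set of bounded Borel functions $f(t,x)$ on $(0,T)\times\mathbb{R}$ such that $f(t,\cdot)\in C_0^\infty(\mathbb{R})$ for every $t$, for every $n$ the $C^n$-norms of $f(t,\cdot)$ are bounded over $t$, and the supports of all $f(t,\cdot)$ lie in one common ball. Constants $N_0(\alpha),N_p$ (from the one-dimensional heat equation), depending only on $\alpha$ and only on $p$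 respectively: for each $T\in(0,\infty)$ and $f\in B_c((0,T),C_0^\infty(\mathbb{R}))$ the problem $u(t,x)=\int_0^t(D^2u(s,x)+f(s,x))\,ds$, $t\in[0,T]$, $x\in\mathbb{R}$, has a unique solution that is continuous in $[0,T]\times\mathbb{R}$ with $u(t,\cdot)\in C^{2+\alpha}(\mathbb{R})$ for all $t$ and $C^{2+\alpha}(\mathbb{R})$-norms bounded in $t$; $N_0(\alpha)$ and $N_p$ are finite constants such that for all $T$ and all such $f$ it satisfies $\sup_{t\in[0,T]}[D^2u(t,\cdot)]_{C^\alpha(\mathbb{R})}\le N_0(\alpha)\sup_{t\in(0,T)}[f(t,\cdot)]_{C^\alpha(\mathbb{R})}$ and $\|D^2u\|^p_{L_p((0,T)\times\mathbb{R})}\le N_p\|f\|^p_{L_p((0,T)\times\mathbb{R})}$. Constant $N'(\alpha)$: a constant, depending only on $\alpha$, such that whenever $v\in C^{2+\alpha}(\mathbb{R}^d)$ is such that for every unit vector $l\in\mathbb{R}^d$ and every $x\in\mathbb{R}^d$ the function $\mu\mapsto(D_l^2v)(x+\mu l)$ on $\mathbb{R}$ has $C^\alpha(\mathbb{R})$-seminorm at most $1$, one has $[D_{ij}v]_{C^\alpha(\mathbb{R}^d)}\le N'(\alpha)$ for all $i,j=1,\dots,d$. *)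

theory Defs
  imports "HOL-Analysis.Analysis"
begin

text \<open>Suprema and integrals are taken in \<^typ>\<open>ennreal\<close>, so that seminorms and
  \<open>L\<^sub>p\<close>-norms are meaningful (possibly infinite) for every function.\<close>

definition holder_seminorm :: "real \<Rightarrow> ('a::metric_space \<Rightarrow> real) \<Rightarrow> ennreal" where
  "holder_seminorm \<alpha> f =
     (SUP (x, y) \<in> {(x, y). x \<noteq> y}. ennreal (\<bar>f x - f y\<bar> / dist x y powr \<alpha>))"

text \<open>The \<open>p\<close>-th power of the \<open>L\<^sub>p(S)\<close>-norm.\<close>

definition Lp_norm_pow :: "real \<Rightarrow> 'a::euclidean_space set \<Rightarrow> ('a \<Rightarrow> real) \<Rightarrow> ennreal" where
  "Lp_norm_pow p S f = (\<integral>\<^sup>+x\<in>S. ennreal (\<bar>f x\<bar> powr p) \<partial>lborel)"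

text \<open>Partial derivative in the direction of a vector \<open>b\<close>, usually a basis vector. The
  one-dimensional derivative is the special case \<open>b = 1\<close> on \<^typ>\<open>real\<close>.\<close>

definition pd :: "'a::euclidean_space \<Rightarrow> ('a \<Rightarrow> real) \<Rightarrow> 'a \<Rightarrow> real" where
  "pd b f x = deriv (\<lambda>t. f (x + t *\<^sub>R b)) 0"

lemma pd_real: "pd 1 f = deriv f" for f :: "real \<Rightarrow> real"
proof
  fix x
  have "((\<lambda>t. f (x + t)) has_field_derivative D) (at 0) \<longleftrightarrow> (f has_field_derivative D) (at x)" for D
    using DERIV_at_within_shift[of f D x 0 UNIV] by simp
  then show "pd 1 f x = deriv f x"
    by (simp add: pd_def deriv_def)
qed

fun C_k :: "nat \<Rightarrow> ('a::euclidean_space \<Rightarrow> real) \<Rightarrow> bool" where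
  "C_k 0 f \<longleftrightarrow> continuous_on UNIV f"
| "C_k (Suc k) f \<longleftrightarrow> f differentiable_on UNIV \<and> (\<forall>b\<in>Basis. C_k k (pd b f))"

definition C0_infinity :: "('a::euclidean_space \<Rightarrow> real) \<Rightarrow> bool" where
  "C0_infinity f \<longleftrightarrow> (\<forall>k. C_k k f) \<and> compact (closure {x. f x \<noteq> 0})"

text \<open>The norm \<open>sup (|f| + |Df| + |D\<^sup>2f|) + [D\<^sup>2f]\<close> of \<open>C\<^bsup>2+\<alpha>\<^esup>\<close>. The gradient and the
  Hessian are measured in the Euclidean norm of their components; in dimension one this
  is the absolute value.\<close>

definition C2_holder_norm :: "real \<Rightarrow> ('a::euclidean_space \<Rightarrow> real) \<Rightarrow> ennreal" where
  "C2_holder_norm \<alpha> f =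
     (SUP x. ennreal (\<bar>f x\<bar> + L2_set (\<lambda>b. pd b f x) Basis
                     + L2_set (\<lambda>(b, c). pd b (pd c f) x) (Basis \<times> Basis)))
   + (SUP (x, y) \<in> {(x, y). x \<noteq> y}.
        ennreal (L2_set (\<lambda>(b, c). pd b (pd c f) x - pd b (pd c f) y) (Basis \<times> Basis)
                 / dist x y powr \<alpha>))"

definition C2_holder :: "real \<Rightarrow> ('a::euclidean_space \<Rightarrow> real) \<Rightarrow> bool" where
  "C2_holder \<alpha> f \<longleftrightarrow> C_k 2 f \<and> C2_holder_norm \<alpha> f < \<infinity>"

definition D2 :: "'d \<Rightarrow> 'd \<Rightarrow> (real ^ 'd::finite \<Rightarrow> real) \<Rightarrow> real ^ 'd \<Rightarrow> real" where
  "D2 i j f = pd (axis i 1) (pd (axis j 1) f)"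

definition D2_dir :: "real ^ 'd::finite \<Rightarrow> (real ^ 'd \<Rightarrow> real) \<Rightarrow> real ^ 'd \<Rightarrow> real" where
  "D2_dir l f x = (\<Sum>i\<in>UNIV. \<Sum>j\<in>UNIV. l $ i * l $ j * D2 i j f x)"

definition Cn_norm :: "nat \<Rightarrow> (real \<Rightarrow> real) \<Rightarrow> ennreal" where
  "Cn_norm n f = (\<Sum>k\<le>n. SUP x. ennreal \<bar>(deriv ^^ k) f x\<bar>)"

text \<open>\<open>B\<^sub>c((0,T), C\<^sub>0\<^sup>\<infinity>(\<real>))\<close>. The first argument of \<open>f\<close> is time; the values of \<open>f\<close> at times
  outside \<open>(0,T)\<close> are irrelevant.\<close>

definition Bc_C0_infinity :: "real \<Rightarrow> (real \<Rightarrow> real \<Rightarrow> real) \<Rightarrow> bool" where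
  "Bc_C0_infinity T f \<longleftrightarrow>
     (\<lambda>(t, x). f t x) \<in> borel_measurable (restrict_space borel ({0<..<T} \<times> UNIV)) \<and>
     (\<exists>M. \<forall>t\<in>{0<..<T}. \<forall>x. \<bar>f t x\<bar> \<le> M) \<and>
     (\<forall>t\<in>{0<..<T}. C0_infinity (f t)) \<and>
     (\<forall>n. (SUP t\<in>{0<..<T}. Cn_norm n (f t)) < \<infinity>) \<and>
     (\<exists>c R. \<forall>t\<in>{0<..<T}. closure {x. f t x \<noteq> 0} \<subseteq> ball c R)"

text \<open>Solutions of \<open>u(t,x) = \<integral>\<^sub>0\<^sup>t (D\<^sup>2u(s,x) + f(s,x)) ds\<close> on \<open>[0,T] \<times> \<real>\<close>, in the class in which
  this problem is uniquely solvable.\<close>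

definition heat_solution ::
  "real \<Rightarrow> real \<Rightarrow> (real \<Rightarrow> real \<Rightarrow> real) \<Rightarrow> (real \<Rightarrow> real \<Rightarrow> real) \<Rightarrow> bool" where
  "heat_solution \<alpha> T f u \<longleftrightarrow>
     continuous_on ({0..T} \<times> UNIV) (\<lambda>(t, x). u t x) \<and>
     (\<forall>t\<in>{0..T}. C2_holder \<alpha> (u t)) \<and>
     (SUP t\<in>{0..T}. C2_holder_norm \<alpha> (u t)) < \<infinity> \<and>
     (\<forall>t\<in>{0..T}. \<forall>x.
        set_integrable lborel {0<..<t} (\<lambda>s. deriv (deriv (u s)) x + f s x) \<and>
        u t x = (LINT s:{0<..<t}|lborel. deriv (deriv (u s)) x + f s x))"

text \<open>\<open>N\<close> is an admissible constant \<open>N\<^sub>0(\<alpha>)\<close>, respectively \<open>N\<^sub>p\<close>, in the a priori estimates for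
  the one-dimensional heat equation.\<close>

definition heat_holder_const :: "real \<Rightarrow> real \<Rightarrow> bool" where
  "heat_holder_const \<alpha> N \<longleftrightarrow>
     (\<forall>T>0. \<forall>f u. Bc_C0_infinity T f \<longrightarrow> heat_solution \<alpha> T f u \<longrightarrow>
        (SUP t\<in>{0..T}. holder_seminorm \<alpha> (deriv (deriv (u t))))
          \<le> ennreal N * (SUP t\<in>{0<..<T}. holder_seminorm \<alpha> (f t)))"

definition heat_Lp_const :: "real \<Rightarrow> real \<Rightarrow> real \<Rightarrow> bool" where
  "heat_Lp_const \<alpha> p N \<longleftrightarrow>
     (\<forall>T>0. \<forall>f u. Bc_C0_infinity T f \<longrightarrow> heat_solution \<alpha> T f u \<longrightarrow>
        Lp_norm_pow p ({0<..<T} \<times> UNIV) (\<lambda>(t, x). deriv (deriv (u t)) x)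
          \<le> ennreal N * Lp_norm_pow p ({0<..<T} \<times> UNIV) (\<lambda>(t, x). f t x))"

text \<open>\<open>N\<close> is an admissible constant \<open>N'(\<alpha>)\<close> on \<open>\<real>\<^sup>d\<close>; the dimension is passed as a type.\<close>

definition directional_holder_const :: "'d::finite itself \<Rightarrow> real \<Rightarrow> real \<Rightarrow> bool" where
  "directional_holder_const _ \<alpha> N \<longleftrightarrow>
     (\<forall>v :: real ^ 'd \<Rightarrow> real.
        C2_holder \<alpha> v \<longrightarrow>
        (\<forall>l x. norm l = 1 \<longrightarrow> holder_seminorm \<alpha> (\<lambda>\<mu>::real. D2_dir l v (x + \<mu> *\<^sub>R l)) \<le> 1) \<longrightarrow>
        (\<forall>i j. holder_seminorm \<alpha> (D2 i j v) \<le> ennreal N))"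

end

theory Submission
  imports Defs
begin

text \<open>
  Fix a unit vector \<open>l\<close>. By ellipticity the form \<open>a - l l\<^sup>T\<close> is positive semidefinite, hence a sum of
  squares, so \<open>f\<close> is the sum of \<open>D\<^sub>l\<^sup>2 u\<close> and the mean of the second derivatives of \<open>u\<close> along suitable vectors
  \<open>y\<^sub>1, ..., y\<^sub>m\<close> (\<open>elliptic_decomposition\<close>). The second part generates a Brownian motion \<open>\<xi>\<close>. If \<open>v\<close> solves
  \<open>\<partial>\<^sub>t v = a\<^sup>i\<^sup>j D\<^sub>i\<^sub>j v + g\<close> with \<open>v = 0\<close> at time \<open>0\<close>, and if for every path of \<open>\<xi>\<close> the function \<open>w\<close> solves
  \<open>\<partial>\<^sub>t w = D\<^sub>l\<^sup>2 w + g(t, x - \<xi>\<^sub>t)\<close> with the same initial value, then \<open>v(t,x)\<close> is the expectation of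
  \<open>w(t, x + \<xi>\<^sub>t)\<close>. For a fixed path, \<open>w\<close> is governed by the one-dimensional heat equation on every
  line parallel to \<open>l\<close>, and shifting the source by \<open>\<xi>\<^sub>t\<close> changes neither its Hoelder seminorm nor its
  \<open>L\<^sub>p\<close>-norm. Since both norms are convex, \<open>v\<close> inherits the estimates of \<open>w\<close> with the same
  constants. The elliptic statement is the case \<open>v(t,x) = (t/T) u(x)\<close>, \<open>g = u/T - (t/T) f\<close>, as
  \<open>T \<rightarrow> \<infinity>\<close>: the term \<open>u/T\<close> disappears, and the factor \<open>t/T\<close> is \<open>1\<close> at the final time, which settles the
  Hoelder estimate, and common to both sides of the \<open>L\<^sub>p\<close> estimate.

  The argument is carried out with random walks, so that all expectations are finite sums and
  all functions are explicit. With space step \<open>s\<close> and time step \<open>\<tau> = s\<^sup>2/2\<close>, the derivative \<open>D\<^sub>l\<^sup>2\<close> is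
  replaced by a second difference and \<open>\<xi>\<close> by a walk that jumps by one of \<open>\<plusminus> s y\<^sub>j\<close> in each time step.
  The source is chosen so that the mean of the scheme is exactly \<open>(k/K) u\<close> after \<open>k\<close> of \<open>K\<close> steps
  (\<open>scheme_walk_mean\<close>). Along a line, the scheme interpolated linearly in time is an exact solution
  of the heat equation (\<open>interpolant_heat_solution\<close>), whose source differs from
  \<open>-(k/K) f(x - \<xi>\<^sub>t)\<close> by \<open>O(s T + 1/T)\<close> in the relevant seminorm (\<open>scheme_errors\<close>).

  For the Hoelder estimate the one-dimensional bound is used at the final time
  (\<open>holder_estimate_along_line\<close>), and the definition of \<open>N'\<close> passes from directional to full second
  derivatives (\<open>holder_estimate_D2\<close>). For the \<open>L\<^sub>p\<close> estimate the one-dimensional bounds are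
  integrated over all lines parallel to \<open>l\<close> (\<open>interpolant_Lp_estimate\<close>) and averaged over the
  paths (\<open>Lp_estimate_second_derivative\<close>).
\<close>

section \<open>Smooth functions and directional derivatives\<close>

definition smooth :: "('a::euclidean_space \<Rightarrow> real) \<Rightarrow> bool" where
  "smooth f \<longleftrightarrow> (\<forall>k. C_k k f)"

lemma smooth_imp_differentiable: "smooth f \<Longrightarrow> f differentiable (at x)"
  unfolding smooth_def using C_k.simps(2)[of 0 f] by (metis UNIV_I differentiable_on_def)

lemma smooth_pd_Basis: "smooth f \<Longrightarrow> b \<in> Basis \<Longrightarrow> smooth (pd b f)"
  unfolding smooth_def using C_k.simps(2) by blast

text \<open>Smoothness can be shown by exhibiting a class of differentiable functions that is closed under
  partial derivatives; this gives the closure properties of \<open>smooth\<close> below without a separate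
  induction on the order for each of them.\<close>

lemma smooth_coinduct:
  assumes "P f"
    and step: "\<And>g. P g \<Longrightarrow> (\<forall>x. g differentiable (at x)) \<and> (\<forall>b\<in>Basis. P (pd b g))"
  shows "smooth f"
proof -
  have "C_k k g" if "P g" for k g
    using that
  proof (induction k arbitrary: g)
    case 0
    then have "g differentiable_on UNIV"
      using step by (simp add: differentiable_on_def)
    then show ?case by (simp add: differentiable_imp_continuous_on)
  next
    case (Suc k)
    then show ?case using step by (simp add: differentiable_on_def)
  qed
  with assms(1) show ?thesis by (simp add: smooth_def)
qed

lemma smooth_imp_continuous_on: "smooth f \<Longrightarrow> continuous_on S f"
  by (meson continuous_at_imp_continuous_on differentiable_imp_continuous_within
      smooth_imp_differentiable)

lemma smooth_imp_borel_measurable: "smooth f \<Longrightarrow> f \<in> borel_measurable borel"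
  by (intro borel_measurable_continuous_onI smooth_imp_continuous_on)

lemma has_derivative_along_line:
  assumes "(f has_derivative D) (at (x + t *\<^sub>R y))"
  shows "((\<lambda>t. f (x + t *\<^sub>R y)) has_real_derivative D y) (at t)"
proof -
  have "((\<lambda>t. x + t *\<^sub>R y) has_derivative (\<lambda>h. h *\<^sub>R y)) (at t)"
    by (auto intro!: derivative_eq_intros)
  from has_derivative_compose[OF this assms]
  have "((\<lambda>t. f (x + t *\<^sub>R y)) has_derivative (\<lambda>h. D (h *\<^sub>R y))) (at t)" .
  moreover have "D (h *\<^sub>R y) = D y * h" for h
    using assms by (simp add: linear_cmul has_derivative_linear)
  ultimately show ?thesis by (simp add: has_field_derivative_def)
qed

lemma pd_eq_has_derivative: "(f has_derivative D) (at x) \<Longrightarrow> pd y f x = D y"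
  unfolding pd_def using has_derivative_along_line[of f D x 0 y]
  by (simp add: DERIV_imp_deriv)

lemma has_derivative_pd:
  assumes "f differentiable (at x)"
  shows "(f has_derivative (\<lambda>y. pd y f x)) (at x)"
proof -
  from assms obtain D where D: "(f has_derivative D) (at x)"
    by (auto simp: differentiable_def)
  moreover have "D = (\<lambda>y. pd y f x)"
    using pd_eq_has_derivative[OF D] by auto
  ultimately show ?thesis by simp
qed

lemma DERIV_along_line:
  "smooth f \<Longrightarrow> ((\<lambda>t. f (x + t *\<^sub>R y)) has_real_derivative pd y f (x + t *\<^sub>R y)) (at t)"
  by (intro has_derivative_along_line has_derivative_pd smooth_imp_differentiable)

lemma pd_eq_sum_Basis:
  assumes "f differentiable (at x)"
  shows "pd y f x = (\<Sum>b\<in>Basis. (y \<bullet> b) * pd b f x)"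
proof -
  have l: "linear (\<lambda>y. pd y f x)"
    using has_derivative_pd[OF assms] has_derivative_linear by blast
  have "pd y f x = pd (\<Sum>b\<in>Basis. (y \<bullet> b) *\<^sub>R b) f x"
    by (simp add: euclidean_representation)
  also have "\<dots> = (\<Sum>b\<in>Basis. (y \<bullet> b) * pd b f x)"
    by (simp add: linear_sum[OF l] linear_cmul[OF l])
  finally show ?thesis .
qed

text \<open>Linear combinations of translates are the only operations that occur in the scheme, so their
  derivatives and their smoothness are treated once; sums, multiples and shifts are special cases.\<close>

lemma has_derivative_shifted_sum:
  assumes "\<And>m. m \<in> M \<Longrightarrow> smooth (f m)"
  shows "((\<lambda>x. \<Sum>m\<in>M. c m * f m (x + y m)) has_derivative
           (\<lambda>v. \<Sum>m\<in>M. c m * pd v (f m) (x + y m))) (at x)"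
proof (intro has_derivative_sum has_derivative_mult_right)
  fix m assume "m \<in> M"
  have "((\<lambda>x. x + y m) has_derivative (\<lambda>v. v)) (at x)"
    by (auto intro!: derivative_eq_intros)
  from has_derivative_compose[OF this has_derivative_pd[OF smooth_imp_differentiable[OF assms[OF \<open>m \<in> M\<close>]]]]
  show "((\<lambda>x. f m (x + y m)) has_derivative (\<lambda>v. pd v (f m) (x + y m))) (at x)" .
qed

lemma pd_shifted_sum:
  assumes "\<And>m. m \<in> M \<Longrightarrow> smooth (f m)"
  shows "pd v (\<lambda>x. \<Sum>m\<in>M. c m * f m (x + y m)) = (\<lambda>x. \<Sum>m\<in>M. c m * pd v (f m) (x + y m))"
  using pd_eq_has_derivative[OF has_derivative_shifted_sum[of M f c y, OF assms]] by auto

lemma smooth_shifted_sum: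
  assumes "\<And>m. m \<in> M \<Longrightarrow> smooth (f m)"
  shows "smooth (\<lambda>x. \<Sum>m\<in>M. c m * f m (x + y m))"
proof (rule smooth_coinduct[where P = "\<lambda>g. \<exists>f. (\<forall>m\<in>M. smooth (f m)) \<and> g = (\<lambda>x. \<Sum>m\<in>M. c m * f m (x + y m))"])
  show "\<exists>fa. (\<forall>m\<in>M. smooth (fa m)) \<and> (\<lambda>x. \<Sum>m\<in>M. c m * f m (x + y m)) = (\<lambda>x. \<Sum>m\<in>M. c m * fa m (x + y m))"
    using assms by auto
next
  fix g assume "\<exists>f. (\<forall>m\<in>M. smooth (f m)) \<and> g = (\<lambda>x. \<Sum>m\<in>M. c m * f m (x + y m))"
  then obtain f where f: "\<forall>m\<in>M. smooth (f m)" and g: "g = (\<lambda>x. \<Sum>m\<in>M. c m * f m (x + y m))" by blast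
  have "g differentiable (at x)" for x
    unfolding g using has_derivative_shifted_sum[of M f c y x] f by (auto simp: differentiable_def)
  moreover have "\<exists>f. (\<forall>m\<in>M. smooth (f m)) \<and> pd b g = (\<lambda>x. \<Sum>m\<in>M. c m * f m (x + y m))" if "b \<in> Basis" for b
    unfolding g using pd_shifted_sum[of M f b c y] f that smooth_pd_Basis
    by (intro exI[of _ "\<lambda>m. pd b (f m)"]) auto
  ultimately show "(\<forall>x. g differentiable (at x)) \<and> (\<forall>b\<in>Basis. \<exists>f. (\<forall>m\<in>M. smooth (f m)) \<and> pd b g = (\<lambda>x. \<Sum>m\<in>M. c m * f m (x + y m)))"
    by blast
qed

lemma pd_sum: "(\<And>m. m \<in> M \<Longrightarrow> smooth (f m)) \<Longrightarrow> pd v (\<lambda>x. \<Sum>m\<in>M. f m x) = (\<lambda>x. \<Sum>m\<in>M. pd v (f m) x)"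
  using pd_shifted_sum[of M f v "\<lambda>_. 1" "\<lambda>_. 0"] by simp

lemma smooth_sum: "(\<And>m. m \<in> M \<Longrightarrow> smooth (f m)) \<Longrightarrow> smooth (\<lambda>x. \<Sum>m\<in>M. f m x)"
  using smooth_shifted_sum[of M f "\<lambda>_. 1" "\<lambda>_. 0"] by simp

lemma pd_cmult: "smooth f \<Longrightarrow> pd v (\<lambda>x. c * f x) = (\<lambda>x. c * pd v f x)"
  using pd_shifted_sum[of "{()}" "\<lambda>_. f" v "\<lambda>_. c" "\<lambda>_. 0"] by simp

lemma smooth_cmult: "smooth f \<Longrightarrow> smooth (\<lambda>x. c * f x)"
  using smooth_shifted_sum[of "{()}" "\<lambda>_. f" "\<lambda>_. c" "\<lambda>_. 0"] by simp

lemma pd_shift: "pd v (\<lambda>x. f (x + y)) = (\<lambda>x. pd v f (x + y))"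
  by (rule ext) (simp add: pd_def ac_simps)

lemma smooth_shift: "smooth f \<Longrightarrow> smooth (\<lambda>x. f (x + y))"
  using smooth_shifted_sum[of "{()}" "\<lambda>_. f" "\<lambda>_. 1" "\<lambda>_. y"] by simp

lemma pd_add: "smooth f \<Longrightarrow> smooth g \<Longrightarrow> pd v (\<lambda>x. f x + g x) = (\<lambda>x. pd v f x + pd v g x)"
  using pd_sum[of UNIV "\<lambda>b. if b then f else g" v] by (simp add: UNIV_bool add.commute)

lemma smooth_add: "smooth f \<Longrightarrow> smooth g \<Longrightarrow> smooth (\<lambda>x. f x + g x)"
  using smooth_sum[of UNIV "\<lambda>b. if b then f else g"] by (simp add: UNIV_bool add.commute)

lemma pd_diff: "smooth f \<Longrightarrow> smooth g \<Longrightarrow> pd v (\<lambda>x. f x - g x) = (\<lambda>x. pd v f x - pd v g x)"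
  using pd_add[of f "\<lambda>x. -1 * g x" v] smooth_cmult[of g "-1"] pd_cmult[of g v "-1"] by simp

lemma smooth_diff: "smooth f \<Longrightarrow> smooth g \<Longrightarrow> smooth (\<lambda>x. f x - g x)"
  using smooth_add[of f "\<lambda>x. -1 * g x"] smooth_cmult[of g "-1"] by simp

lemma smooth_pd:
  assumes "smooth f"
  shows "smooth (pd v f)"
proof -
  have *: "pd v f = (\<lambda>x. \<Sum>b\<in>Basis. (v \<bullet> b) * pd b f (x + 0))"
    by (rule ext, subst pd_eq_sum_Basis[OF smooth_imp_differentiable[OF assms]]) simp
  show ?thesis
    by (subst *) (rule smooth_shifted_sum[of Basis "\<lambda>b. pd b f"], rule smooth_pd_Basis[OF assms])
qed

lemma deriv_restrict_line:
  "smooth f \<Longrightarrow> deriv (\<lambda>\<mu>. f (x + \<mu> *\<^sub>R l)) = (\<lambda>\<mu>. pd l f (x + \<mu> *\<^sub>R l))"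
  using DERIV_along_line[of f x l] by (auto intro: DERIV_imp_deriv)

lemma smooth_restrict_line:
  assumes "smooth f"
  shows "smooth (\<lambda>\<mu>::real. f (x + \<mu> *\<^sub>R l))"
proof (rule smooth_coinduct[where P = "\<lambda>g. \<exists>f. smooth f \<and> g = (\<lambda>\<mu>. f (x + \<mu> *\<^sub>R l))"])
  fix g assume "\<exists>f. smooth f \<and> g = (\<lambda>\<mu>. f (x + \<mu> *\<^sub>R l))"
  then obtain f where f: "smooth f" and g: "g = (\<lambda>\<mu>. f (x + \<mu> *\<^sub>R l))" by blast
  have "g differentiable (at t)" for t
    using DERIV_along_line[OF f] unfolding g real_differentiable_def by blast
  moreover have "pd 1 g = (\<lambda>\<mu>. pd l f (x + \<mu> *\<^sub>R l))"
    by (simp add: pd_real g deriv_restrict_line[OF f])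
  ultimately show "(\<forall>t. g differentiable (at t)) \<and> (\<forall>b\<in>Basis. \<exists>f. smooth f \<and> pd b g = (\<lambda>\<mu>. f (x + \<mu> *\<^sub>R l)))"
    using smooth_pd[OF f] by auto
qed (use assms in auto)

lemma C0_infinity_iff:
  "C0_infinity f \<longleftrightarrow> smooth f \<and> (\<exists>R. \<forall>x. R < norm x \<longrightarrow> f x = 0)"
proof -
  have "compact (closure {x. f x \<noteq> 0}) \<longleftrightarrow> (\<exists>R. \<forall>x. R < norm x \<longrightarrow> f x = 0)"
    unfolding compact_closure bounded_iff by (auto simp: not_less[symmetric])
  then show ?thesis by (simp add: C0_infinity_def smooth_def)
qed

section \<open>Second differences\<close>

definition diff2 :: "'a::euclidean_space \<Rightarrow> real \<Rightarrow> ('a \<Rightarrow> real) \<Rightarrow> 'a \<Rightarrow> real" where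
  "diff2 y s f x = (f (x + s *\<^sub>R y) + f (x - s *\<^sub>R y) - 2 * f x) / s\<^sup>2"

lemma Taylor_along_line:
  assumes "smooth f"
  shows "\<exists>r. \<bar>r\<bar> \<le> \<bar>t\<bar> \<and> f (x + t *\<^sub>R y) = f x + t * pd y f x + t\<^sup>2 / 2 * pd y (pd y f) (x + r *\<^sub>R y)"
proof -
  define D where "D = (\<lambda>m r. (pd y ^^ m) f (x + r *\<^sub>R y))"
  have sm: "smooth ((pd y ^^ m) f)" for m
    by (induction m) (use assms smooth_pd in auto)
  have "\<forall>m r. DERIV (D m) r :> D (Suc m) r"
    unfolding D_def using DERIV_along_line[OF sm] by simp
  then obtain r where "\<bar>r\<bar> \<le> \<bar>t\<bar>" "D 0 t = (\<Sum>m<2. D m 0 / fact m * t ^ m) + D 2 r / fact 2 * t ^ 2"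
    using Maclaurin_all_le[of D "D 0" t 2] by auto
  then show ?thesis
    by (intro exI[of _ r]) (simp add: D_def eval_nat_numeral)
qed

lemma diff2_mean_value:
  assumes "smooth f" "s \<noteq> 0"
  shows "\<exists>r1 r2. \<bar>r1\<bar> \<le> \<bar>s\<bar> \<and> \<bar>r2\<bar> \<le> \<bar>s\<bar> \<and>
    diff2 y s f x = (pd y (pd y f) (x + r1 *\<^sub>R y) + pd y (pd y f) (x + r2 *\<^sub>R y)) / 2"
proof -
  obtain r1 where 1: "\<bar>r1\<bar> \<le> \<bar>s\<bar>" "f (x + s *\<^sub>R y) = f x + s * pd y f x + s\<^sup>2 / 2 * pd y (pd y f) (x + r1 *\<^sub>R y)"
    using Taylor_along_line[OF assms(1), of s x y] by blast
  obtain r2 where 2: "\<bar>r2\<bar> \<le> \<bar>-s\<bar>" "f (x + (-s) *\<^sub>R y) = f x + (-s) * pd y f x + (-s)\<^sup>2 / 2 * pd y (pd y f) (x + r2 *\<^sub>R y)"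
    using Taylor_along_line[OF assms(1), of "-s" x y] by blast
  have "diff2 y s f x = (pd y (pd y f) (x + r1 *\<^sub>R y) + pd y (pd y f) (x + r2 *\<^sub>R y)) / 2"
    using 1(2) 2(2) assms(2) by (simp add: diff2_def field_simps)
  with 1(1) 2(1) show ?thesis by auto
qed

lemma abs_diff2_le:
  assumes "smooth f" "s \<noteq> 0" and bound: "\<And>x. \<bar>pd y (pd y f) x\<bar> \<le> c"
  shows "\<bar>diff2 y s f x\<bar> \<le> c"
proof -
  obtain r1 r2 where "diff2 y s f x = (pd y (pd y f) (x + r1 *\<^sub>R y) + pd y (pd y f) (x + r2 *\<^sub>R y)) / 2"
    using diff2_mean_value[OF assms(1,2), of y x] by blast
  with bound[of "x + r1 *\<^sub>R y"] bound[of "x + r2 *\<^sub>R y"] show ?thesis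
    unfolding abs_le_iff by (simp add: field_simps)
qed

lemma abs_increment_along_line_le:
  assumes "smooth f" and bound: "\<And>x. \<bar>pd y f x\<bar> \<le> c"
  shows "\<bar>f (x + r *\<^sub>R y) - f x\<bar> \<le> c * \<bar>r\<bar>"
  using field_differentiable_bound[of UNIV "\<lambda>t. f (x + t *\<^sub>R y)" "\<lambda>t. pd y f (x + t *\<^sub>R y)" c r 0]
    DERIV_along_line[OF assms(1), of x y] bound by simp

text \<open>A first-order bound in \<open>s\<close> is enough and costs only three derivatives: by
  \<open>diff2_mean_value\<close> the second difference is a mean of second derivatives at distance at most \<open>s\<close>.\<close>

lemma abs_diff2_error_le:
  assumes "smooth f" "0 < s" and bound: "\<And>x. \<bar>pd y (pd y (pd y f)) x\<bar> \<le> c"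
  shows "\<bar>diff2 y s f x - pd y (pd y f) x\<bar> \<le> c * s"
proof -
  obtain r1 r2 where r: "\<bar>r1\<bar> \<le> \<bar>s\<bar>" "\<bar>r2\<bar> \<le> \<bar>s\<bar>"
    "diff2 y s f x = (pd y (pd y f) (x + r1 *\<^sub>R y) + pd y (pd y f) (x + r2 *\<^sub>R y)) / 2"
    using diff2_mean_value[OF assms(1), of s y x] assms(2) by auto
  have "0 \<le> c" using bound[of x] by linarith
  have *: "\<bar>pd y (pd y f) (x + r *\<^sub>R y) - pd y (pd y f) x\<bar> \<le> c * s" if "\<bar>r\<bar> \<le> \<bar>s\<bar>" for r
  proof -
    have "\<bar>pd y (pd y f) (x + r *\<^sub>R y) - pd y (pd y f) x\<bar> \<le> c * \<bar>r\<bar>"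
      by (intro abs_increment_along_line_le smooth_pd assms bound)
    also have "\<dots> \<le> c * s" using that \<open>0 \<le> c\<close> assms(2) by (intro mult_left_mono) auto
    finally show ?thesis .
  qed
  show ?thesis using *[OF r(1)] *[OF r(2)] unfolding r(3) abs_le_iff by (simp add: field_simps)
qed

lemma smooth_imp_lipschitz:
  assumes "smooth f" and bound: "\<And>b x. b \<in> Basis \<Longrightarrow> \<bar>pd b f x\<bar> \<le> c"
  shows "\<bar>f x - f (x' :: 'a :: euclidean_space)\<bar> \<le> real DIM('a) * c * norm (x - x')"
proof -
  have "\<bar>pd (x - x') f z\<bar> \<le> real DIM('a) * c * norm (x - x')" for z
  proof -
    have "pd (x - x') f z = (\<Sum>b\<in>Basis. ((x - x') \<bullet> b) * pd b f z)"
      by (rule pd_eq_sum_Basis[OF smooth_imp_differentiable[OF assms(1)]])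
    also have "\<bar>\<dots>\<bar> \<le> (\<Sum>b\<in>(Basis::'a set). norm (x - x') * c)"
      by (intro order_trans[OF sum_abs] sum_mono)
        (auto simp: abs_mult intro!: mult_mono bound Basis_le_norm)
    also have "\<dots> = real DIM('a) * c * norm (x - x')" by simp
    finally show ?thesis .
  qed
  from abs_increment_along_line_le[OF assms(1) this, of x' 1] show ?thesis by simp
qed

lemma foldr_pd_smooth: "smooth f \<Longrightarrow> smooth (foldr pd ys f)"
  by (induction ys) (auto intro: smooth_pd)

lemma pd_eq_0_outside_ball:
  assumes "\<And>x. R < norm x \<Longrightarrow> f x = 0" "R < norm x"
  shows "pd y f x = 0"
proof -
  have 1: "open {x::'a. R < norm x}" by (intro open_Collect_less continuous_intros)
  have 2: "((\<lambda>_. 0::real) has_derivative (\<lambda>_. 0)) (at x)" by simp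
  have "(f has_derivative (\<lambda>_. 0)) (at x)"
    by (rule has_derivative_transform_within_open[OF 2 1]) (simp_all add: assms)
  then show ?thesis by (rule pd_eq_has_derivative)
qed

lemma bounded_of_continuous_bounded_support:
  fixes f :: "'a::euclidean_space \<Rightarrow> real"
  assumes "continuous_on UNIV f" "\<And>x. R < norm x \<Longrightarrow> f x = 0"
  shows "\<exists>C. \<forall>x. \<bar>f x\<bar> \<le> C"
proof -
  have "compact (f ` cball 0 R)"
    by (intro compact_continuous_image continuous_on_subset[OF assms(1)]) auto
  then obtain C where C: "\<forall>z\<in>f ` cball 0 R. \<bar>z\<bar> \<le> C"
    using compact_imp_bounded bounded_iff by (metis real_norm_def)
  have "\<bar>f x\<bar> \<le> max C 0" for x
    using C assms(2)[of x] by (cases "norm x \<le> R") (force simp: max_def)+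
  then show ?thesis by blast
qed

section \<open>Families bounded uniformly in the step size\<close>

text \<open>The step size \<open>s\<close> tends to \<open>0\<close> while constants must not depend on it. A family indexed by
  \<open>s \<in> (0,1]\<close> is therefore bounded in \<open>C\<^sub>0\<^sup>\<infinity>\<close> uniformly in \<open>s\<close>. Derivatives are taken along arbitrary
  lists of vectors, so that the class is closed under every directional derivative.\<close>

definition uniform_C0 :: "(real \<Rightarrow> 'a::euclidean_space \<Rightarrow> real) \<Rightarrow> bool" where
  "uniform_C0 \<phi> \<longleftrightarrow>
     (\<forall>s\<in>{0<..1}. smooth (\<phi> s)) \<and>
     (\<exists>R. \<forall>s\<in>{0<..1}. \<forall>x. R < norm x \<longrightarrow> \<phi> s x = 0) \<and>
     (\<forall>ys. \<exists>C. \<forall>s\<in>{0<..1}. \<forall>x. \<bar>foldr pd ys (\<phi> s) x\<bar> \<le> C)"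

lemma uniform_C0_smooth: "uniform_C0 \<phi> \<Longrightarrow> s \<in> {0<..1} \<Longrightarrow> smooth (\<phi> s)"
  by (auto simp: uniform_C0_def)

lemma uniform_C0_supportE:
  assumes "uniform_C0 \<phi>"
  obtains R where "\<And>s x. s \<in> {0<..1} \<Longrightarrow> R < norm x \<Longrightarrow> \<phi> s x = 0"
  using assms unfolding uniform_C0_def by blast

lemma uniform_C0_boundE:
  assumes "uniform_C0 \<phi>"
  obtains C where "\<And>s x. s \<in> {0<..1} \<Longrightarrow> \<bar>foldr pd ys (\<phi> s) x\<bar> \<le> C"
  using assms unfolding uniform_C0_def by blast

lemma uniform_C0_const:
  assumes "C0_infinity u"
  shows "uniform_C0 (\<lambda>_. u)"
proof -
  obtain R where u: "smooth u" and R: "\<And>x. R < norm x \<Longrightarrow> u x = 0"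
    using assms unfolding C0_infinity_iff by blast
  have "\<exists>C. \<forall>x. \<bar>foldr pd ys u x\<bar> \<le> C" for ys
  proof (rule bounded_of_continuous_bounded_support)
    show "continuous_on UNIV (foldr pd ys u)"
      by (intro smooth_imp_continuous_on foldr_pd_smooth u)
    show "foldr pd ys u x = 0" if "R < norm x" for x
      using that by (induction ys arbitrary: x) (auto simp: R intro: pd_eq_0_outside_ball)
  qed
  then show ?thesis using u R unfolding uniform_C0_def by fast
qed

lemma uniform_C0_pd:
  assumes "uniform_C0 \<phi>"
  shows "uniform_C0 (\<lambda>s. pd y (\<phi> s))"
proof -
  obtain R where R: "\<And>s x. s \<in> {0<..1} \<Longrightarrow> R < norm x \<Longrightarrow> \<phi> s x = 0"
    by (rule uniform_C0_supportE[OF assms]) (rule that)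
  have "\<exists>C. \<forall>s\<in>{0<..1}. \<forall>x. \<bar>foldr pd ys (pd y (\<phi> s)) x\<bar> \<le> C" for ys
    using uniform_C0_boundE[OF assms, of "ys @ [y]"] by (metis foldr_append foldr_Cons foldr_Nil comp_apply id_apply)
  moreover have "pd y (\<phi> s) x = 0" if "s \<in> {0<..1}" "R < norm x" for s x
    using R[OF that(1)] that(2) by (rule pd_eq_0_outside_ball)
  ultimately show ?thesis
    using uniform_C0_smooth[OF assms] smooth_pd unfolding uniform_C0_def by blast
qed

lemma foldr_pd_add:
  "smooth f \<Longrightarrow> smooth g \<Longrightarrow> foldr pd ys (\<lambda>x. f x + g x) = (\<lambda>x. foldr pd ys f x + foldr pd ys g x)"
  by (induction ys) (simp_all add: pd_add foldr_pd_smooth)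

lemma foldr_pd_cmult:
  "smooth f \<Longrightarrow> foldr pd ys (\<lambda>x. c * f x) = (\<lambda>x. c * foldr pd ys f x)"
  by (induction ys) (simp_all add: pd_cmult foldr_pd_smooth)

lemma uniform_C0_add:
  assumes "uniform_C0 \<phi>" "uniform_C0 \<psi>"
  shows "uniform_C0 (\<lambda>s x. \<phi> s x + \<psi> s x)"
  unfolding uniform_C0_def
proof (intro conjI allI)
  show "\<forall>s\<in>{0<..1}. smooth (\<lambda>x. \<phi> s x + \<psi> s x)"
    using assms by (auto intro: smooth_add uniform_C0_smooth)
  obtain R where R: "\<And>s x. s \<in> {0<..1} \<Longrightarrow> R < norm x \<Longrightarrow> \<phi> s x = 0"
    by (rule uniform_C0_supportE[OF assms(1)]) (rule that)
  obtain R' where R': "\<And>s x. s \<in> {0<..1} \<Longrightarrow> R' < norm x \<Longrightarrow> \<psi> s x = 0"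
    by (rule uniform_C0_supportE[OF assms(2)]) (rule that)
  show "\<exists>R. \<forall>s\<in>{0<..1}. \<forall>x. R < norm x \<longrightarrow> \<phi> s x + \<psi> s x = 0"
    using R R' by (intro exI[of _ "max R R'"]) auto
next
  fix ys
  obtain C where C: "\<And>s x. s \<in> {0<..1} \<Longrightarrow> \<bar>foldr pd ys (\<phi> s) x\<bar> \<le> C"
    by (rule uniform_C0_boundE[OF assms(1)]) (rule that)
  obtain C' where C': "\<And>s x. s \<in> {0<..1} \<Longrightarrow> \<bar>foldr pd ys (\<psi> s) x\<bar> \<le> C'"
    by (rule uniform_C0_boundE[OF assms(2)]) (rule that)
  have "\<bar>foldr pd ys (\<lambda>x. \<phi> s x + \<psi> s x) x\<bar> \<le> C + C'" if "s \<in> {0<..1}" for s x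
    using C[OF that, of x] C'[OF that, of x] uniform_C0_smooth[OF assms(1) that] uniform_C0_smooth[OF assms(2) that]
    by (simp add: foldr_pd_add)
  then show "\<exists>C. \<forall>s\<in>{0<..1}. \<forall>x. \<bar>foldr pd ys (\<lambda>x. \<phi> s x + \<psi> s x) x\<bar> \<le> C" by blast
qed

lemma uniform_C0_cmult:
  assumes "uniform_C0 \<phi>" and c: "\<And>s. s \<in> {0<..1} \<Longrightarrow> \<bar>c s\<bar> \<le> B"
  shows "uniform_C0 (\<lambda>s x. c s * \<phi> s x)"
  unfolding uniform_C0_def
proof (intro conjI allI)
  show "\<forall>s\<in>{0<..1}. smooth (\<lambda>x. c s * \<phi> s x)"
    using assms by (auto intro: smooth_cmult uniform_C0_smooth)
  show "\<exists>R. \<forall>s\<in>{0<..1}. \<forall>x. R < norm x \<longrightarrow> c s * \<phi> s x = 0"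
    by (rule uniform_C0_supportE[OF assms(1)]) (metis mult_zero_right)
next
  fix ys
  obtain C where C: "\<And>s x. s \<in> {0<..1} \<Longrightarrow> \<bar>foldr pd ys (\<phi> s) x\<bar> \<le> C"
    by (rule uniform_C0_boundE[OF assms(1)]) (rule that)
  have "\<bar>foldr pd ys (\<lambda>x. c s * \<phi> s x) x\<bar> \<le> B * C" if "s \<in> {0<..1}" for s x
  proof -
    have "0 \<le> B" using c[OF that] by linarith
    then show ?thesis
      using C[OF that, of x] c[OF that] uniform_C0_smooth[OF assms(1) that]
      by (auto simp: foldr_pd_cmult abs_mult intro!: mult_mono)
  qed
  then show "\<exists>C. \<forall>s\<in>{0<..1}. \<forall>x. \<bar>foldr pd ys (\<lambda>x. c s * \<phi> s x) x\<bar> \<le> C" by blast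
qed

lemma uniform_C0_sum:
  assumes "finite M" "\<And>m. m \<in> M \<Longrightarrow> uniform_C0 (\<phi> m)"
  shows "uniform_C0 (\<lambda>s x. \<Sum>m\<in>M. \<phi> m s x)"
  using assms
proof (induction M rule: finite_induct)
  case empty
  have "C0_infinity (\<lambda>_. 0)"
    using smooth_sum[of "{}"] by (auto simp: C0_infinity_iff)
  then show ?case using uniform_C0_const by simp
qed (simp add: uniform_C0_add)

lemma smooth_shift_minus: "smooth f \<Longrightarrow> smooth (\<lambda>x. f (x - y))"
  using smooth_shift[of f "-y"] by simp

lemma diff2_eq: "diff2 y s f = (\<lambda>x. (1 / s\<^sup>2) * (f (x + s *\<^sub>R y) + f (x + - (s *\<^sub>R y)) - 2 * f x))"
  by (rule ext) (simp add: diff2_def)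

lemma smooth_diff2: "smooth f \<Longrightarrow> smooth (diff2 y s f)"
  unfolding diff2_eq by (intro smooth_cmult smooth_diff smooth_add smooth_shift)

lemma pd_diff2: "smooth f \<Longrightarrow> pd v (diff2 y s f) = diff2 y s (pd v f)"
  unfolding diff2_eq
  by (simp only: pd_cmult pd_diff pd_add pd_shift smooth_cmult smooth_diff smooth_add smooth_shift)

lemma foldr_pd_diff2: "smooth f \<Longrightarrow> foldr pd ys (diff2 y s f) = diff2 y s (foldr pd ys f)"
  by (induction ys) (simp_all add: pd_diff2 foldr_pd_smooth)

lemma diff2_eq_0_outside_ball:
  assumes "\<And>x. R < norm x \<Longrightarrow> f x = 0" "0 < s" "s \<le> 1" "R + norm y < norm x"
  shows "diff2 y s f x = 0"
proof -
  have "norm (s *\<^sub>R y) \<le> norm y" using assms by (simp add: mult_left_le_one_le)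
  then have "R < norm (x + s *\<^sub>R y)" "R < norm (x - s *\<^sub>R y)"
    using norm_diff_ineq[of x "s *\<^sub>R y"] norm_triangle_ineq2[of x "s *\<^sub>R y"] assms(4) by auto
  moreover have "R < norm x" using assms(4) norm_ge_zero[of y] by linarith
  ultimately show ?thesis using assms(1) by (simp add: diff2_def)
qed

text \<open>The division by \<open>s\<^sup>2\<close> is harmless because a second difference is bounded by the second derivative.\<close>

lemma uniform_C0_diff2:
  assumes "uniform_C0 \<phi>"
  shows "uniform_C0 (\<lambda>s. diff2 y s (\<phi> s))"
  unfolding uniform_C0_def
proof (intro conjI allI)
  show "\<forall>s\<in>{0<..1}. smooth (diff2 y s (\<phi> s))"
    using assms by (auto intro: smooth_diff2 uniform_C0_smooth)
  obtain R where R: "\<And>s x. s \<in> {0<..1} \<Longrightarrow> R < norm x \<Longrightarrow> \<phi> s x = 0"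
    by (rule uniform_C0_supportE[OF assms]) (rule that)
  show "\<exists>R. \<forall>s\<in>{0<..1}. \<forall>x. R < norm x \<longrightarrow> diff2 y s (\<phi> s) x = 0"
    using diff2_eq_0_outside_ball[of R "\<phi> _"] R by (intro exI[of _ "R + norm y"]) auto
next
  fix ys
  obtain C where C: "\<And>s x. s \<in> {0<..1} \<Longrightarrow> \<bar>foldr pd (y # y # ys) (\<phi> s) x\<bar> \<le> C"
    by (rule uniform_C0_boundE[OF assms]) (rule that)
  have "\<bar>foldr pd ys (diff2 y s (\<phi> s)) x\<bar> \<le> C" if "s \<in> {0<..1}" for s x
    using uniform_C0_smooth[OF assms that] that C[OF that]
    by (auto simp: foldr_pd_diff2 foldr_pd_smooth intro!: abs_diff2_le)
  then show "\<exists>C. \<forall>s\<in>{0<..1}. \<forall>x. \<bar>foldr pd ys (diff2 y s (\<phi> s)) x\<bar> \<le> C" by blast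
qed

text \<open>A sup bound, a Lipschitz bound and a common support suffice to bound both the Hoelder seminorm and
  the \<open>L\<^sub>p\<close>-norm. Discretisation errors are only shown to be in this weaker class: bounds for their
  higher derivatives would require interchanging the order of partial derivatives.\<close>

definition uniform_Lip0 :: "(real \<Rightarrow> 'a::euclidean_space \<Rightarrow> real) \<Rightarrow> bool" where
  "uniform_Lip0 \<phi> \<longleftrightarrow> (\<exists>R C. \<forall>s\<in>{0<..1}.
     (\<forall>x. R < norm x \<longrightarrow> \<phi> s x = 0) \<and> (\<forall>x. \<bar>\<phi> s x\<bar> \<le> C) \<and>
     (\<forall>x x'. \<bar>\<phi> s x - \<phi> s x'\<bar> \<le> C * norm (x - x')))"

lemma uniform_Lip0I:
  assumes "\<And>s x. s \<in> {0<..1} \<Longrightarrow> R < norm x \<Longrightarrow> \<phi> s x = 0"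
    and "\<And>s x. s \<in> {0<..1} \<Longrightarrow> \<bar>\<phi> s x\<bar> \<le> C"
    and "\<And>s x x'. s \<in> {0<..1} \<Longrightarrow> \<bar>\<phi> s x - \<phi> s x'\<bar> \<le> C' * norm (x - x')"
  shows "uniform_Lip0 \<phi>"
  unfolding uniform_Lip0_def
proof (intro exI ballI conjI allI impI)
  fix s :: real and x x' :: 'a assume s: "s \<in> {0<..1}"
  show "R < norm x \<Longrightarrow> \<phi> s x = 0" using assms(1) s by blast
  show "\<bar>\<phi> s x\<bar> \<le> max C C'" using assms(2)[OF s, of x] by linarith
  have "C' * norm (x - x') \<le> max C C' * norm (x - x')" by (intro mult_right_mono) auto
  with assms(3)[OF s, of x x'] show "\<bar>\<phi> s x - \<phi> s x'\<bar> \<le> max C C' * norm (x - x')" by linarith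
qed

lemma uniform_C0_lipschitz:
  assumes "uniform_C0 (\<phi> :: real \<Rightarrow> 'a::euclidean_space \<Rightarrow> real)"
  shows "\<exists>C. \<forall>s\<in>{0<..1}. \<forall>x x'. \<bar>\<phi> s x - \<phi> s x'\<bar> \<le> C * norm (x - x')"
proof -
  have "\<forall>b::'a. \<exists>C. \<forall>s\<in>{0<..1}. \<forall>x. \<bar>foldr pd [b] (\<phi> s) x\<bar> \<le> C"
    using assms unfolding uniform_C0_def by blast
  then obtain C where C: "\<And>b s x. s \<in> {0<..1} \<Longrightarrow> \<bar>pd b (\<phi> s) x\<bar> \<le> C b"
    by (metis foldr.simps comp_apply id_apply)
  define c where "c = Max (C ` Basis)"
  have "\<bar>pd b (\<phi> s) x\<bar> \<le> c" if "s \<in> {0<..1}" "b \<in> Basis" for b s x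
    using order_trans[OF C[OF that(1), of b x] Max_ge[of "C ` Basis" "C b"]] that(2) unfolding c_def by simp
  then have "\<bar>\<phi> s x - \<phi> s x'\<bar> \<le> real DIM('a) * c * norm (x - x')" if "s \<in> {0<..1}" for s x x'
    using smooth_imp_lipschitz[OF uniform_C0_smooth[OF assms that], of c] that by blast
  then show ?thesis by blast
qed

lemma uniform_C0_imp_Lip0:
  assumes "uniform_C0 \<phi>"
  shows "uniform_Lip0 \<phi>"
proof -
  obtain R where R: "\<And>s x. s \<in> {0<..1} \<Longrightarrow> R < norm x \<Longrightarrow> \<phi> s x = 0"
    by (rule uniform_C0_supportE[OF assms]) (rule that)
  obtain C where C: "\<And>s x. s \<in> {0<..1} \<Longrightarrow> \<bar>foldr pd [] (\<phi> s) x\<bar> \<le> C"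
    by (rule uniform_C0_boundE[OF assms]) (rule that)
  obtain C' where C': "\<And>s x x'. s \<in> {0<..1} \<Longrightarrow> \<bar>\<phi> s x - \<phi> s x'\<bar> \<le> C' * norm (x - x')"
    using uniform_C0_lipschitz[OF assms] by blast
  show ?thesis
    by (rule uniform_Lip0I[OF R _ C']) (use C in auto)
qed

lemma uniform_Lip0_add:
  assumes "uniform_Lip0 \<phi>" "uniform_Lip0 \<psi>"
  shows "uniform_Lip0 (\<lambda>s x. \<phi> s x + \<psi> s x)"
proof -
  obtain R C where 1: "\<And>s x. s \<in> {0<..1} \<Longrightarrow> R < norm x \<Longrightarrow> \<phi> s x = 0"
    "\<And>s x. s \<in> {0<..1} \<Longrightarrow> \<bar>\<phi> s x\<bar> \<le> C"
    "\<And>s x x'. s \<in> {0<..1} \<Longrightarrow> \<bar>\<phi> s x - \<phi> s x'\<bar> \<le> C * norm (x - x')"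
    using assms(1) unfolding uniform_Lip0_def by blast
  obtain R' C' where 2: "\<And>s x. s \<in> {0<..1} \<Longrightarrow> R' < norm x \<Longrightarrow> \<psi> s x = 0"
    "\<And>s x. s \<in> {0<..1} \<Longrightarrow> \<bar>\<psi> s x\<bar> \<le> C'"
    "\<And>s x x'. s \<in> {0<..1} \<Longrightarrow> \<bar>\<psi> s x - \<psi> s x'\<bar> \<le> C' * norm (x - x')"
    using assms(2) unfolding uniform_Lip0_def by blast
  show ?thesis
  proof (rule uniform_Lip0I[of "max R R'" _ "C + C'" "C + C'"])
    fix s :: real and x x' :: 'a assume s: "s \<in> {0<..1}"
    show "max R R' < norm x \<Longrightarrow> \<phi> s x + \<psi> s x = 0" using 1(1)[OF s] 2(1)[OF s] by simp
    show "\<bar>\<phi> s x + \<psi> s x\<bar> \<le> C + C'" using 1(2)[OF s, of x] 2(2)[OF s, of x] by linarith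
    show "\<bar>\<phi> s x + \<psi> s x - (\<phi> s x' + \<psi> s x')\<bar> \<le> (C + C') * norm (x - x')"
      using 1(3)[OF s, of x x'] 2(3)[OF s, of x x'] by (simp add: distrib_right)
  qed
qed

lemma uniform_Lip0_cmult:
  assumes "uniform_Lip0 \<phi>"
  shows "uniform_Lip0 (\<lambda>s x. c * \<phi> s x)"
proof -
  obtain R C where 1: "\<And>s x. s \<in> {0<..1} \<Longrightarrow> R < norm x \<Longrightarrow> \<phi> s x = 0"
    "\<And>s x. s \<in> {0<..1} \<Longrightarrow> \<bar>\<phi> s x\<bar> \<le> C"
    "\<And>s x x'. s \<in> {0<..1} \<Longrightarrow> \<bar>\<phi> s x - \<phi> s x'\<bar> \<le> C * norm (x - x')"
    using assms(1) unfolding uniform_Lip0_def by blast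
  show ?thesis
  proof (rule uniform_Lip0I[of R _ "\<bar>c\<bar> * C" "\<bar>c\<bar> * C"])
    fix s :: real and x x' :: 'a assume s: "s \<in> {0<..1}"
    show "R < norm x \<Longrightarrow> c * \<phi> s x = 0" using 1(1)[OF s] by simp
    show "\<bar>c * \<phi> s x\<bar> \<le> \<bar>c\<bar> * C" using 1(2)[OF s, of x] by (simp add: abs_mult mult_left_mono)
    show "\<bar>c * \<phi> s x - c * \<phi> s x'\<bar> \<le> \<bar>c\<bar> * C * norm (x - x')"
      using mult_left_mono[OF 1(3)[OF s, of x x'], of "\<bar>c\<bar>"]
      by (simp add: abs_mult[symmetric] right_diff_distrib mult.assoc)
  qed
qed

lemma uniform_Lip0_sum:
  assumes "finite M" "\<And>m. m \<in> M \<Longrightarrow> uniform_Lip0 (\<phi> m)"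
  shows "uniform_Lip0 (\<lambda>s x. \<Sum>m\<in>M. \<phi> m s x)"
  using assms
proof (induction M rule: finite_induct)
  case empty
  show ?case by (rule uniform_Lip0I[of 0 _ 0 0]) auto
qed (simp add: uniform_Lip0_add)

text \<open>The Lipschitz bound is obtained by applying the sup bound to the increment
  \<open>z \<mapsto> \<phi> s (z + (x - x')) - \<phi> s z\<close>, whose third derivative is at most a multiple of \<open>|x - x'|\<close>.\<close>

lemma uniform_Lip0_diff2_error:
  assumes "uniform_C0 \<phi>"
  shows "uniform_Lip0 (\<lambda>s x. (diff2 y s (\<phi> s) x - pd y (pd y (\<phi> s)) x) / s)"
proof -
  obtain R where R: "\<And>s x. s \<in> {0<..1} \<Longrightarrow> R < norm x \<Longrightarrow> \<phi> s x = 0"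
    by (rule uniform_C0_supportE[OF assms]) (rule that)
  obtain C where C: "\<And>s x. s \<in> {0<..1} \<Longrightarrow> \<bar>foldr pd [y, y, y] (\<phi> s) x\<bar> \<le> C"
    by (rule uniform_C0_boundE[OF assms]) (rule that)
  obtain C' where C': "\<And>s x x'. s \<in> {0<..1} \<Longrightarrow>
      \<bar>pd y (pd y (pd y (\<phi> s))) x - pd y (pd y (pd y (\<phi> s))) x'\<bar> \<le> C' * norm (x - x')"
    using uniform_C0_lipschitz[OF uniform_C0_pd[OF uniform_C0_pd[OF uniform_C0_pd[OF assms]]]] by blast
  show ?thesis
  proof (rule uniform_Lip0I[of "R + norm y" _ C C'])
    fix s :: real and x x' :: 'a assume s: "s \<in> {0<..1}"
    then have "0 < s" by simp
    note sm = uniform_C0_smooth[OF assms s]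
    show "(diff2 y s (\<phi> s) x - pd y (pd y (\<phi> s)) x) / s = 0" if x: "R + norm y < norm x"
    proof -
      have "diff2 y s (\<phi> s) x = 0"
        using s x R[OF s] by (intro diff2_eq_0_outside_ball[of R]) auto
      moreover have "R < norm x" using x norm_ge_zero[of y] by linarith
      then have "pd y (pd y (\<phi> s)) x = 0"
        using R[OF s] by (intro pd_eq_0_outside_ball[of R "pd y (\<phi> s)"]) (auto intro: pd_eq_0_outside_ball)
      ultimately show ?thesis by simp
    qed
    have "\<bar>diff2 y s (\<phi> s) x - pd y (pd y (\<phi> s)) x\<bar> \<le> C * s"
      using C[OF s] by (intro abs_diff2_error_le sm \<open>0 < s\<close>) simp
    then show "\<bar>(diff2 y s (\<phi> s) x - pd y (pd y (\<phi> s)) x) / s\<bar> \<le> C"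
      using \<open>0 < s\<close> by (simp add: divide_simps)
    define h where "h = (\<lambda>z. \<phi> s (z + (x - x')) - \<phi> s z)"
    have h: "smooth h" unfolding h_def by (intro smooth_diff smooth_shift sm)
    have pd_h: "pd y h = (\<lambda>z. pd y (\<phi> s) (z + (x - x')) - pd y (\<phi> s) z)"
      "pd y (pd y h) = (\<lambda>z. pd y (pd y (\<phi> s)) (z + (x - x')) - pd y (pd y (\<phi> s)) z)"
      "pd y (pd y (pd y h)) = (\<lambda>z. pd y (pd y (pd y (\<phi> s))) (z + (x - x')) - pd y (pd y (pd y (\<phi> s))) z)"
      unfolding h_def by (simp_all add: pd_diff pd_shift smooth_diff smooth_shift smooth_pd sm)
    have "\<bar>pd y (pd y (pd y h)) z\<bar> \<le> C' * norm (x - x')" for z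
      unfolding pd_h(3) using C'[OF s, of "z + (x - x')" z] by simp
    from abs_diff2_error_le[OF h \<open>0 < s\<close> this, of x']
    have "\<bar>diff2 y s h x' - pd y (pd y h) x'\<bar> \<le> C' * norm (x - x') * s" .
    moreover have "diff2 y s h x' = diff2 y s (\<phi> s) x - diff2 y s (\<phi> s) x'"
      by (simp add: h_def diff2_def diff_divide_distrib[symmetric] algebra_simps)
    ultimately have "\<bar>(diff2 y s (\<phi> s) x - pd y (pd y (\<phi> s)) x) - (diff2 y s (\<phi> s) x' - pd y (pd y (\<phi> s)) x')\<bar>
        \<le> C' * norm (x - x') * s"
      unfolding pd_h(2) by (simp add: algebra_simps)
    then show "\<bar>(diff2 y s (\<phi> s) x - pd y (pd y (\<phi> s)) x) / s - (diff2 y s (\<phi> s) x' - pd y (pd y (\<phi> s)) x') / s\<bar>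
        \<le> C' * norm (x - x')"
      using \<open>0 < s\<close> by (simp add: diff_divide_distrib[symmetric] divide_simps)
  qed
qed

section \<open>Translation invariant seminorms\<close>

text \<open>\<open>B c \<phi>\<close> stands for "the seminorm of \<open>\<phi>\<close> is at most \<open>c\<close>". The error analysis of the scheme uses
  nothing but these properties and is thus done once for the Hoelder seminorm and the
  \<open>L\<^sub>p\<close>-norm.\<close>

locale translation_invariant_seminorm =
  fixes B :: "real \<Rightarrow> ('a::euclidean_space \<Rightarrow> real) \<Rightarrow> bool"
  assumes add: "B c \<phi> \<Longrightarrow> B d \<psi> \<Longrightarrow> B (c + d) (\<lambda>x. \<phi> x + \<psi> x)"
    and cmult: "B c \<phi> \<Longrightarrow> B (\<bar>r\<bar> * c) (\<lambda>x. r * \<phi> x)"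
    and shift: "B c \<phi> \<Longrightarrow> B c (\<lambda>x. \<phi> (x + y))"
    and mono: "B c \<phi> \<Longrightarrow> c \<le> d \<Longrightarrow> B d \<phi>"
    and nonneg: "B c \<phi> \<Longrightarrow> 0 \<le> c"
    and uniform: "uniform_Lip0 \<Phi> \<Longrightarrow> \<exists>C. \<forall>s\<in>{0<..1}. B C (\<Phi> s)"

definition holder_le :: "real \<Rightarrow> real \<Rightarrow> ('a::metric_space \<Rightarrow> real) \<Rightarrow> bool" where
  "holder_le \<alpha> c f \<longleftrightarrow> 0 \<le> c \<and> (\<forall>x y. \<bar>f x - f y\<bar> \<le> c * dist x y powr \<alpha>)"

lemma holder_seminorm_le_iff:
  assumes "0 \<le> c"
  shows "holder_seminorm \<alpha> f \<le> ennreal c \<longleftrightarrow> holder_le \<alpha> c f"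
proof -
  have "ennreal (\<bar>f x - f y\<bar> / dist x y powr \<alpha>) \<le> ennreal c \<longleftrightarrow> \<bar>f x - f y\<bar> \<le> c * dist x y powr \<alpha>"
    if "x \<noteq> y" for x y
    using that assms by (simp add: ennreal_le_iff divide_le_eq)
  then show ?thesis
    unfolding holder_seminorm_def holder_le_def SUP_le_iff
    using assms by (auto, metis abs_zero diff_self dist_self mult_nonneg_nonneg powr_ge_zero)
qed

lemma min_linear_le_powr:
  fixes \<alpha> r :: real
  assumes "0 < \<alpha>" "\<alpha> < 1" "0 \<le> r" "0 \<le> C" "t \<le> C * r" "t \<le> 2 * C"
  shows "t \<le> 2 * C * r powr \<alpha>"
proof (cases "r \<le> 1")
  case True
  have "r \<le> r powr \<alpha>"
    using powr_mono'[of \<alpha> 1 r] assms True by (cases "r = 0") auto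
  then have "C * r \<le> 2 * C * r powr \<alpha>"
    using assms by (intro mult_mono) auto
  with assms show ?thesis by linarith
next
  case False
  then have "1 \<le> r powr \<alpha>" using assms by (simp add: ge_one_powr_ge_zero)
  then have "2 * C * 1 \<le> 2 * C * r powr \<alpha>"
    using assms by (intro mult_left_mono) auto
  with assms show ?thesis by linarith
qed

lemma translation_invariant_seminorm_holder:
  assumes "0 < \<alpha>" "\<alpha> < 1"
  shows "translation_invariant_seminorm (holder_le \<alpha> :: real \<Rightarrow> ('a::euclidean_space \<Rightarrow> real) \<Rightarrow> bool)"
proof
  fix c d r :: real and \<phi> \<psi> :: "'a \<Rightarrow> real" and y :: 'a
  show "holder_le \<alpha> (c + d) (\<lambda>x. \<phi> x + \<psi> x)" if "holder_le \<alpha> c \<phi>" "holder_le \<alpha> d \<psi>"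
    unfolding holder_le_def
  proof (intro conjI allI)
    show "0 \<le> c + d" using that by (auto simp: holder_le_def)
    fix x y
    have "\<bar>\<phi> x - \<phi> y\<bar> \<le> c * dist x y powr \<alpha>" "\<bar>\<psi> x - \<psi> y\<bar> \<le> d * dist x y powr \<alpha>"
      using that by (auto simp: holder_le_def)
    then show "\<bar>\<phi> x + \<psi> x - (\<phi> y + \<psi> y)\<bar> \<le> (c + d) * dist x y powr \<alpha>"
      by (simp add: distrib_right)
  qed
  show "holder_le \<alpha> (\<bar>r\<bar> * c) (\<lambda>x. r * \<phi> x)" if "holder_le \<alpha> c \<phi>"
    using that by (auto simp: holder_le_def abs_mult mult.assoc right_diff_distrib[symmetric] intro!: mult_left_mono)
  show "holder_le \<alpha> c (\<lambda>x. \<phi> (x + y))" if "holder_le \<alpha> c \<phi>"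
    unfolding holder_le_def using that
    by (metis (no_types, lifting) holder_le_def add.commute dist_add_cancel)
  show "holder_le \<alpha> d \<phi>" if "holder_le \<alpha> c \<phi>" "c \<le> d"
    unfolding holder_le_def
  proof (intro conjI allI)
    show "0 \<le> d" using that by (auto simp: holder_le_def)
    fix x y :: 'a
    have "c * dist x y powr \<alpha> \<le> d * dist x y powr \<alpha>"
      using that by (intro mult_right_mono) auto
    with that show "\<bar>\<phi> x - \<phi> y\<bar> \<le> d * dist x y powr \<alpha>"
      unfolding holder_le_def by (meson order_trans)
  qed
  show "0 \<le> c" if "holder_le \<alpha> c \<phi>"
    using that by (simp add: holder_le_def)
next
  fix \<Phi> :: "real \<Rightarrow> 'a \<Rightarrow> real"
  assume "uniform_Lip0 \<Phi>"
  then obtain C where C: "\<And>s x. s \<in> {0<..1} \<Longrightarrow> \<bar>\<Phi> s x\<bar> \<le> C"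
      "\<And>s x x'. s \<in> {0<..1} \<Longrightarrow> \<bar>\<Phi> s x - \<Phi> s x'\<bar> \<le> C * norm (x - x')"
    unfolding uniform_Lip0_def by blast
  have "holder_le \<alpha> (2 * C) (\<Phi> s)" if s: "s \<in> {0<..1}" for s
  proof -
    have "0 \<le> C" using C(1)[OF s, of 0] by linarith
    moreover have "\<bar>\<Phi> s x - \<Phi> s y\<bar> \<le> 2 * C * dist x y powr \<alpha>" for x y
      using C(1)[OF s, of x] C(1)[OF s, of y] C(2)[OF s, of x y] assms \<open>0 \<le> C\<close>
      by (intro min_linear_le_powr) (auto simp: dist_norm)
    ultimately show ?thesis by (simp add: holder_le_def)
  qed
  then show "\<exists>C. \<forall>s\<in>{0<..1}. holder_le \<alpha> C (\<Phi> s)" by blast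
qed

lemma convex_on_abs_powr:
  assumes "1 \<le> p"
  shows "convex_on UNIV (\<lambda>x. \<bar>x\<bar> powr p)"
proof -
  have nn: "(u * x + v * y) powr p \<le> u * x powr p + v * y powr p"
    if "0 \<le> x" "0 \<le> y" "0 \<le> u" "0 \<le> v" "u + v = 1" for x y u v :: real
  proof -
    have le: "t powr p \<le> t" if "0 \<le> t" "t \<le> 1" for t :: real
      using powr_mono'[of 1 p t] that assms by (cases "t = 0") auto
    consider "x = 0" | "y = 0" | "0 < x" "0 < y" using \<open>0 \<le> x\<close> \<open>0 \<le> y\<close> by linarith
    then show ?thesis
    proof cases
      case 1
      then show ?thesis using that assms le[of v] by (simp add: powr_mult mult_right_mono)
    next
      case 2
      then show ?thesis using that assms le[of u] by (simp add: powr_mult mult_right_mono)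
    next
      case 3
      then show ?thesis
        using powr_convex[OF assms] that unfolding convex_on_def by auto
    qed
  qed
  show ?thesis
  proof (rule convex_onI)
    fix t x y :: real assume t: "0 < t" "t < 1"
    have "\<bar>(1 - t) *\<^sub>R x + t *\<^sub>R y\<bar> \<le> (1 - t) * \<bar>x\<bar> + t * \<bar>y\<bar>"
      using t by (auto intro!: order_trans[OF abs_triangle_ineq] simp: abs_mult)
    then have "\<bar>(1 - t) *\<^sub>R x + t *\<^sub>R y\<bar> powr p \<le> ((1 - t) * \<bar>x\<bar> + t * \<bar>y\<bar>) powr p"
      using assms by (intro powr_mono2) auto
    also have "\<dots> \<le> (1 - t) * \<bar>x\<bar> powr p + t * \<bar>y\<bar> powr p"
      using t by (intro nn) auto
    finally show "\<bar>(1 - t) *\<^sub>R x + t *\<^sub>R y\<bar> powr p \<le> (1 - t) * \<bar>x\<bar> powr p + t * \<bar>y\<bar> powr p" .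
  qed auto
qed

text \<open>Convexity at \<open>a + b = (1-t) (a/(1-t)) + t (b/t)\<close>. For small \<open>t\<close> the first coefficient is close to \<open>1\<close>,
  so a small error \<open>b\<close> costs almost nothing in the constant in front of \<open>a\<close>.\<close>

lemma abs_add_powr_le:
  fixes a b p t :: real
  assumes "1 \<le> p" "0 < t" "t < 1"
  shows "\<bar>a + b\<bar> powr p \<le> (1 - t) powr (1 - p) * \<bar>a\<bar> powr p + t powr (1 - p) * \<bar>b\<bar> powr p"
proof -
  have *: "r * \<bar>c / r\<bar> powr p = r powr (1 - p) * \<bar>c\<bar> powr p" if "0 < r" for r c :: real
    using that by (simp add: powr_divide powr_diff abs_divide)
  have "\<bar>(1 - t) *\<^sub>R (a / (1 - t)) + t *\<^sub>R (b / t)\<bar> powr p \<le> (1 - t) * \<bar>a / (1 - t)\<bar> powr p + t * \<bar>b / t\<bar> powr p"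
    using convex_onD[OF convex_on_abs_powr[OF assms(1)], of t "a / (1 - t)" "b / t"] assms by simp
  then show ?thesis using assms *[of t b] *[of "1 - t" a] by simp
qed

lemma Lp_norm_pow_add_le:
  fixes \<phi> \<psi> :: "'a::euclidean_space \<Rightarrow> real"
  assumes "1 \<le> p" "0 < t" "t < 1" "\<phi> \<in> borel_measurable borel" "\<psi> \<in> borel_measurable borel"
  shows "Lp_norm_pow p UNIV (\<lambda>x. \<phi> x + \<psi> x) \<le>
    ennreal ((1 - t) powr (1 - p)) * Lp_norm_pow p UNIV \<phi> + ennreal (t powr (1 - p)) * Lp_norm_pow p UNIV \<psi>"
proof -
  have "Lp_norm_pow p UNIV (\<lambda>x. \<phi> x + \<psi> x) \<le>
    (\<integral>\<^sup>+x. ennreal ((1 - t) powr (1 - p)) * ennreal (\<bar>\<phi> x\<bar> powr p) + ennreal (t powr (1 - p)) * ennreal (\<bar>\<psi> x\<bar> powr p) \<partial>lborel)"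
    unfolding Lp_norm_pow_def using abs_add_powr_le[OF assms(1-3)]
    by (intro nn_integral_mono) (auto simp flip: ennreal_mult ennreal_plus intro!: ennreal_leI)
  also have "\<dots> = ennreal ((1 - t) powr (1 - p)) * Lp_norm_pow p UNIV \<phi> + ennreal (t powr (1 - p)) * Lp_norm_pow p UNIV \<psi>"
    unfolding Lp_norm_pow_def using assms(4,5)
    by (simp add: nn_integral_add nn_integral_cmult)
  finally show ?thesis .
qed

lemma Lp_norm_pow_cmult:
  fixes \<phi> :: "'a::euclidean_space \<Rightarrow> real"
  assumes "\<phi> \<in> borel_measurable borel"
  shows "Lp_norm_pow p UNIV (\<lambda>x. r * \<phi> x) = ennreal (\<bar>r\<bar> powr p) * Lp_norm_pow p UNIV \<phi>"
  unfolding Lp_norm_pow_def using assms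
  by (simp add: abs_mult powr_mult ennreal_mult nn_integral_cmult)

lemma nn_integral_lborel_shift:
  fixes f :: "'a::euclidean_space \<Rightarrow> ennreal"
  assumes "f \<in> borel_measurable borel"
  shows "(\<integral>\<^sup>+x. f (x + y) \<partial>lborel) = (\<integral>\<^sup>+x. f x \<partial>lborel)"
  by (subst lborel_distr_plus[of y, symmetric], subst nn_integral_distr) (use assms in \<open>auto simp: add.commute\<close>)

lemma Lp_norm_pow_shift:
  fixes \<phi> :: "'a::euclidean_space \<Rightarrow> real"
  assumes "\<phi> \<in> borel_measurable borel"
  shows "Lp_norm_pow p UNIV (\<lambda>x. \<phi> (x + y)) = Lp_norm_pow p UNIV \<phi>"
  unfolding Lp_norm_pow_def using assms
    nn_integral_lborel_shift[of "\<lambda>x. ennreal (\<bar>\<phi> x\<bar> powr p)" y]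
  by simp

text \<open>Equivalent to \<open>\<parallel>\<phi>\<parallel>\<^sub>p \<le> c\<close>. The bound is required for all \<open>e > c\<close> instead of \<open>c\<close> itself so that the
  proof of the triangle inequality may assume positive bounds and divide by them.\<close>

definition Lp_le :: "real \<Rightarrow> real \<Rightarrow> ('a::euclidean_space \<Rightarrow> real) \<Rightarrow> bool" where
  "Lp_le p c \<phi> \<longleftrightarrow> 0 \<le> c \<and> \<phi> \<in> borel_measurable borel \<and>
     (\<forall>e>c. Lp_norm_pow p UNIV \<phi> \<le> ennreal (e powr p))"

lemma translation_invariant_seminorm_Lp:
  assumes "1 < p"
  shows "translation_invariant_seminorm (Lp_le p :: real \<Rightarrow> ('a::euclidean_space \<Rightarrow> real) \<Rightarrow> bool)"
proof
  fix c d r :: real and \<phi> \<psi> :: "'a \<Rightarrow> real" and y :: 'a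
  show "Lp_le p (c + d) (\<lambda>x. \<phi> x + \<psi> x)" if B: "Lp_le p c \<phi>" "Lp_le p d \<psi>"
  proof -
    have [measurable]: "\<phi> \<in> borel_measurable borel" "\<psi> \<in> borel_measurable borel"
      using B by (auto simp: Lp_le_def)
    have "Lp_norm_pow p UNIV (\<lambda>x. \<phi> x + \<psi> x) \<le> ennreal (e powr p)" if "c + d < e" for e
    proof -
      \<comment> \<open>the excess of \<open>e\<close> over \<open>c + d\<close> is split evenly, which makes both bounds positive\<close>
      define c' d' where "c' = c + (e - (c + d)) / 2" and "d' = d + (e - (c + d)) / 2"
      have cd: "0 < c'" "0 < d'" "c < c'" "d < d'" and e: "e = c' + d'"
        using B that by (auto simp: Lp_le_def c'_def d'_def field_simps)
      \<comment> \<open>the weight for which the two terms add up to \<open>e powr p\<close>\<close>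
      define t where "t = d' / e"
      have t: "0 < t" "t < 1" "1 - t = c' / e" using cd by (auto simp: t_def e field_simps)
      have "Lp_norm_pow p UNIV (\<lambda>x. \<phi> x + \<psi> x) \<le>
        ennreal ((1 - t) powr (1 - p)) * Lp_norm_pow p UNIV \<phi> + ennreal (t powr (1 - p)) * Lp_norm_pow p UNIV \<psi>"
        using assms t by (intro Lp_norm_pow_add_le) auto
      also have "\<dots> \<le> ennreal ((1 - t) powr (1 - p)) * ennreal (c' powr p) + ennreal (t powr (1 - p)) * ennreal (d' powr p)"
        using B cd by (intro add_mono mult_left_mono) (auto simp: Lp_le_def)
      also have "\<dots> = ennreal ((1 - t) powr (1 - p) * c' powr p + t powr (1 - p) * d' powr p)"
        by (simp add: ennreal_mult ennreal_plus)
      also have "(1 - t) powr (1 - p) * c' powr p + t powr (1 - p) * d' powr p = e powr (p - 1) * (c' + d')"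
      proof -
        have "(r / e) powr (1 - p) * r powr p = r * e powr (p - 1)" if "0 < r" for r
          using that cd e by (simp add: powr_divide powr_diff)
        then show ?thesis
          using cd unfolding t(3) unfolding t_def by (simp add: algebra_simps)
      qed
      also have "\<dots> = e powr p"
        using cd e by (simp add: powr_diff)
      finally show ?thesis .
    qed
    then show ?thesis using B by (auto simp: Lp_le_def)
  qed
  show "Lp_le p (\<bar>r\<bar> * c) (\<lambda>x. r * \<phi> x)" if B: "Lp_le p c \<phi>"
  proof -
    have [measurable]: "\<phi> \<in> borel_measurable borel"
      using B by (auto simp: Lp_le_def)
    have "Lp_norm_pow p UNIV (\<lambda>x. r * \<phi> x) \<le> ennreal (e powr p)" if "\<bar>r\<bar> * c < e" for e
    proof (cases "r = 0")
      case True
      then show ?thesis by (simp add: Lp_norm_pow_def)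
    next
      case False
      have "ennreal (\<bar>r\<bar> powr p) * Lp_norm_pow p UNIV \<phi> \<le> ennreal (\<bar>r\<bar> powr p) * ennreal ((e / \<bar>r\<bar>) powr p)"
        using B False that by (intro mult_left_mono) (auto simp: Lp_le_def field_simps)
      also have "\<dots> = ennreal ((\<bar>r\<bar> * (e / \<bar>r\<bar>)) powr p)"
        by (simp only: powr_mult abs_ge_zero) (simp flip: ennreal_mult)
      also have "\<bar>r\<bar> * (e / \<bar>r\<bar>) = e" using False by simp
      finally show ?thesis by (simp add: Lp_norm_pow_cmult)
    qed
    then show ?thesis using B by (auto simp: Lp_le_def)
  qed
  show "Lp_le p c (\<lambda>x. \<phi> (x + y))" if B: "Lp_le p c \<phi>"
    using B by (auto simp: Lp_le_def Lp_norm_pow_shift)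
  show "Lp_le p d \<phi>" if "Lp_le p c \<phi>" "c \<le> d"
    using that by (auto simp: Lp_le_def)
  show "0 \<le> c" if "Lp_le p c \<phi>"
    using that by (simp add: Lp_le_def)
next
  fix \<Phi> :: "real \<Rightarrow> 'a \<Rightarrow> real"
  assume "uniform_Lip0 \<Phi>"
  then obtain R C where C: "\<And>s x. s \<in> {0<..1} \<Longrightarrow> R < norm x \<Longrightarrow> \<Phi> s x = 0"
      "\<And>s x. s \<in> {0<..1} \<Longrightarrow> \<bar>\<Phi> s x\<bar> \<le> C"
      "\<And>s x x'. s \<in> {0<..1} \<Longrightarrow> \<bar>\<Phi> s x - \<Phi> s x'\<bar> \<le> C * norm (x - x')"
    unfolding uniform_Lip0_def by blast
  define v where "v = measure lborel (cball (0::'a) R)"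
  \<comment> \<open>the \<open>L\<^sub>p\<close>-norm of the constant \<open>C\<close> on the common support\<close>
  define D where "D = (C powr p * v) powr (1 / p)"
  have D: "D powr p = C powr p * v" "0 \<le> D"
    using assms by (auto simp: D_def v_def powr_powr)
  have "Lp_le p D (\<Phi> s)" if s: "s \<in> {0<..1}" for s
  proof -
    have "0 \<le> C" using C(2)[OF s, of 0] by linarith
    have "C-lipschitz_on UNIV (\<Phi> s)"
      using C(3)[OF s] \<open>0 \<le> C\<close> by (intro lipschitz_onI) (auto simp: dist_norm)
    then have m: "\<Phi> s \<in> borel_measurable borel"
      by (intro borel_measurable_continuous_onI lipschitz_on_continuous_on)
    have "Lp_norm_pow p UNIV (\<Phi> s) \<le> (\<integral>\<^sup>+x. ennreal (C powr p) * indicator (cball (0::'a) R) x \<partial>lborel)"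
      unfolding Lp_norm_pow_def
    proof (intro nn_integral_mono)
      fix x :: 'a
      show "ennreal (\<bar>\<Phi> s x\<bar> powr p) * indicator UNIV x \<le> ennreal (C powr p) * indicator (cball (0::'a) R) x"
        using C(1,2)[OF s, of x] assms
        by (cases "norm x \<le> R") (auto intro!: ennreal_leI powr_mono2)
    qed
    also have "\<dots> = ennreal (C powr p) * emeasure lborel (cball (0::'a) R)"
      by (subst nn_integral_cmult_indicator) auto
    also have "\<dots> = ennreal (D powr p)"
      unfolding D v_def using emeasure_eq_ennreal_measure[of lborel "cball (0::'a) R"] emeasure_lborel_cball_finite[of "0::'a" R]
      by (simp add: ennreal_mult top.not_eq_extremum)
    finally have "Lp_norm_pow p UNIV (\<Phi> s) \<le> ennreal (D powr p)" .
    moreover have "D powr p \<le> e powr p" if "D < e" for e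
      using that D(2) assms by (intro powr_mono2) auto
    ultimately show ?thesis
      using m D(2) by (auto simp: Lp_le_def intro: order_trans ennreal_leI)
  qed
  then show "\<exists>C. \<forall>s\<in>{0<..1}. Lp_le p C (\<Phi> s)" by blast
qed

section \<open>The discrete scheme\<close>

text \<open>One time step of length \<open>s\<^sup>2/2\<close> of the simple random walk along \<open>l\<close>, respectively of the walk that
  picks one of the vectors \<open>y\<^sub>j\<close> and a sign, all with equal probability, and jumps by \<open>\<plusminus> s y\<^sub>j\<close>.\<close>

definition line_mean :: "'a::euclidean_space \<Rightarrow> real \<Rightarrow> ('a \<Rightarrow> real) \<Rightarrow> 'a \<Rightarrow> real" where
  "line_mean l s f x = (f (x + s *\<^sub>R l) + f (x - s *\<^sub>R l)) / 2"

definition jump :: "('j \<Rightarrow> 'a::euclidean_space) \<Rightarrow> real \<Rightarrow> 'j \<times> bool \<Rightarrow> 'a" where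
  "jump y s i = (if snd i then s else - s) *\<^sub>R y (fst i)"

definition jump_mean :: "('j::finite \<Rightarrow> 'a::euclidean_space) \<Rightarrow> real \<Rightarrow> ('a \<Rightarrow> real) \<Rightarrow> 'a \<Rightarrow> real" where
  "jump_mean y s f x = (\<Sum>i\<in>UNIV. f (x + jump y s i)) / real CARD('j \<times> bool)"

lemma line_mean_eq_diff2: "s \<noteq> 0 \<Longrightarrow> line_mean l s f x = f x + s\<^sup>2 / 2 * diff2 l s f x"
  by (simp add: line_mean_def diff2_def field_simps)

lemma jump_mean_eq_diff2:
  fixes y :: "'j::finite \<Rightarrow> 'a::euclidean_space"
  assumes "s \<noteq> 0"
  shows "jump_mean y s f x = f x + s\<^sup>2 / 2 * ((\<Sum>j\<in>UNIV. diff2 (y j) s f x) / real CARD('j))"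
proof -
  have "(\<Sum>i\<in>UNIV. f (x + jump y s i)) = (\<Sum>j\<in>UNIV. \<Sum>b\<in>UNIV. f (x + jump y s (j, b)))"
    by (simp add: sum.cartesian_product)
  also have "\<dots> = (\<Sum>j\<in>UNIV. s\<^sup>2 * diff2 (y j) s f x + 2 * f x)"
    using assms by (intro sum.cong) (auto simp: UNIV_bool jump_def diff2_def)
  also have "\<dots> = s\<^sup>2 * (\<Sum>j\<in>UNIV. diff2 (y j) s f x) + real CARD('j) * (2 * f x)"
    by (simp add: sum.distrib sum_distrib_left)
  finally show ?thesis
    by (simp add: jump_mean_def card_cartesian_product field_simps)
qed

text \<open>The generator of the two walks together and the corresponding difference quotient over one time
  step. The division by \<open>CARD('j)\<close> reflects that only one of the \<open>y\<^sub>j\<close> is used in each step.\<close>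

definition second_order_op :: "'a::euclidean_space \<Rightarrow> ('j::finite \<Rightarrow> 'a) \<Rightarrow> ('a \<Rightarrow> real) \<Rightarrow> 'a \<Rightarrow> real" where
  "second_order_op l y u x = pd l (pd l u) x + (\<Sum>j\<in>UNIV. pd (y j) (pd (y j) u) x) / real CARD('j)"

definition discrete_op :: "'a::euclidean_space \<Rightarrow> ('j::finite \<Rightarrow> 'a) \<Rightarrow> ('a \<Rightarrow> real) \<Rightarrow> real \<Rightarrow> 'a \<Rightarrow> real" where
  "discrete_op l y u s x = (jump_mean y s (line_mean l s u) x - u x) / (s\<^sup>2 / 2)"

lemma uniform_C0_cong:
  assumes "\<And>s. s \<in> {0<..1} \<Longrightarrow> \<phi> s = \<psi> s"
  shows "uniform_C0 \<phi> \<longleftrightarrow> uniform_C0 \<psi>"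
  unfolding uniform_C0_def
  by (intro arg_cong2[where f = "(\<and>)"] arg_cong[where f = Ex] arg_cong[where f = All] ext ball_cong refl)
    (simp_all add: assms)

lemma uniform_Lip0_cong:
  assumes "\<And>s x. s \<in> {0<..1} \<Longrightarrow> \<phi> s x = \<psi> s x"
  shows "uniform_Lip0 \<phi> \<longleftrightarrow> uniform_Lip0 \<psi>"
  unfolding uniform_Lip0_def
  by (intro arg_cong[where f = Ex] ext ball_cong refl) (simp_all add: assms)

lemma uniform_C0_line_mean:
  assumes "uniform_C0 \<phi>"
  shows "uniform_C0 (\<lambda>s. line_mean l s (\<phi> s))"
proof -
  have "uniform_C0 (\<lambda>s x. \<phi> s x + s\<^sup>2 / 2 * diff2 l s (\<phi> s) x)"
    by (intro uniform_C0_add uniform_C0_cmult[where B = 1] uniform_C0_diff2 assms)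
      (auto simp: power_le_one order_trans[OF power_le_one])
  then show ?thesis
    by (subst uniform_C0_cong[of _ "\<lambda>s x. \<phi> s x + s\<^sup>2 / 2 * diff2 l s (\<phi> s) x"])
      (auto simp: line_mean_eq_diff2)
qed

lemma discrete_op_eq:
  fixes y :: "'j::finite \<Rightarrow> 'a::euclidean_space"
  assumes "s \<noteq> 0"
  shows "discrete_op l y u s x = diff2 l s u x
    + (\<Sum>j\<in>UNIV. 1 / real CARD('j) * diff2 (y j) s (line_mean l s u) x)"
  using assms
  by (simp add: discrete_op_def jump_mean_eq_diff2 line_mean_eq_diff2[of s l u] field_simps flip: sum_divide_distrib)

lemma uniform_C0_discrete_op:
  fixes y :: "'j::finite \<Rightarrow> 'a::euclidean_space"
  assumes "C0_infinity u"
  shows "uniform_C0 (discrete_op l y u)"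
proof -
  have "uniform_C0 (\<lambda>s x. diff2 l s u x + (\<Sum>j\<in>UNIV. 1 / real CARD('j) * diff2 (y j) s (line_mean l s u) x))"
    by (intro uniform_C0_add uniform_C0_sum uniform_C0_cmult[where B = "1 / real CARD('j)"] uniform_C0_diff2
        uniform_C0_line_mean uniform_C0_const assms) auto
  then show ?thesis
    by (subst uniform_C0_cong[of _ "\<lambda>s x. diff2 l s u x + (\<Sum>j\<in>UNIV. 1 / real CARD('j) * diff2 (y j) s (line_mean l s u) x)"])
      (auto simp: discrete_op_eq)
qed

text \<open>The two walks are composed, so the second differences along \<open>y\<^sub>j\<close> act on \<open>line_mean l s u\<close>, which
  differs from \<open>u\<close> by \<open>s\<^sup>2/2\<close> times a second difference; this is the second summand in \<open>G\<close>.\<close>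

lemma discrete_op_converges:
  fixes y :: "'j::finite \<Rightarrow> 'a::euclidean_space"
  assumes "C0_infinity u"
  shows "uniform_Lip0 (\<lambda>s x. (discrete_op l y u s x - second_order_op l y u x) / s)"
proof -
  note u = uniform_C0_const[OF assms]
  let ?m = "real CARD('j)"
  \<comment> \<open>consistency error of the second difference, divided by \<open>s\<close>\<close>
  define E where "E = (\<lambda>(z::'a) \<phi> s x. (diff2 z s (\<phi> s) x - pd z (pd z (\<phi> s)) x) / (s::real))"
  define A where "A = (\<lambda>s. line_mean l s u)"
  define G where "G = (\<lambda>s x. E l (\<lambda>_. u) s x
      + (\<Sum>j\<in>UNIV. 1 / ?m * (E (y j) A s x + s / 2 * pd (y j) (pd (y j) (diff2 l s u)) x)))"
  have A: "uniform_C0 A"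
    unfolding A_def by (intro uniform_C0_line_mean u)
  have "uniform_Lip0 G"
    unfolding G_def E_def
    by (intro uniform_Lip0_add uniform_Lip0_sum uniform_Lip0_cmult uniform_Lip0_diff2_error u A
        uniform_C0_imp_Lip0 uniform_C0_pd uniform_C0_diff2 uniform_C0_cmult[where B = 1]) auto
  moreover have "(discrete_op l y u s x - second_order_op l y u x) / s = G s x" if s: "s \<in> {0<..1}" for s x
  proof -
    have smu: "smooth u" using assms by (simp add: C0_infinity_iff)
    have "A s = (\<lambda>x. u x + s\<^sup>2 / 2 * diff2 l s u x)"
      using s by (auto simp: A_def line_mean_eq_diff2)
    then have pdA: "pd z (pd z (A s)) = (\<lambda>x. pd z (pd z u) x + s\<^sup>2 / 2 * pd z (pd z (diff2 l s u)) x)" for z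
      by (simp only: pd_add pd_cmult smooth_pd smooth_diff2 smooth_cmult smu)
    have *: "E (y j) A s x + s / 2 * pd (y j) (pd (y j) (diff2 l s u)) x
        = (diff2 (y j) s (A s) x - pd (y j) (pd (y j) u) x) / s" for j
      unfolding E_def pdA using s by (simp add: field_simps power2_eq_square)
    have "(\<Sum>j\<in>UNIV. 1 / ?m * ((diff2 (y j) s (A s) x - pd (y j) (pd (y j) u) x) / s))
       = ((\<Sum>j\<in>UNIV. 1 / ?m * diff2 (y j) s (A s) x) - (\<Sum>j\<in>UNIV. pd (y j) (pd (y j) u) x) / ?m) / s"
      by (simp add: sum_subtractf sum_divide_distrib diff_divide_distrib mult.commute)
    then show ?thesis
      using s by (simp only: G_def *)
        (simp add: discrete_op_eq second_order_op_def E_def A_def diff_divide_distrib add_divide_distrib)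
  qed
  ultimately show ?thesis by (subst uniform_Lip0_cong[of _ G])
qed

text \<open>Explicit Euler steps of length \<open>s\<^sup>2/2\<close> for \<open>\<partial>\<^sub>t w = D\<^sub>l\<^sup>2 w + F\<^sub>k(x - P\<^sub>k\<^sub>+\<^sub>1)\<close>, with a second difference in
  place of \<open>D\<^sub>l\<^sup>2\<close>, where \<open>P\<close> is the path of the walk.\<close>

fun scheme :: "'a::euclidean_space \<Rightarrow> real \<Rightarrow> (nat \<Rightarrow> 'a \<Rightarrow> real) \<Rightarrow> (nat \<Rightarrow> 'a) \<Rightarrow> nat \<Rightarrow> 'a \<Rightarrow> real" where
  "scheme l s F P 0 = (\<lambda>x. 0)"
| "scheme l s F P (Suc k) = (\<lambda>x. line_mean l s (scheme l s F P k) x + s\<^sup>2 / 2 * F k (x - P (Suc k)))"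

lemma line_mean_eq_comb: "line_mean l s f = (\<lambda>x. 1/2 * f (x + s *\<^sub>R l) + 1/2 * f (x + (- (s *\<^sub>R l))))"
  by (rule ext) (simp add: line_mean_def)

lemma smooth_line_mean: "smooth f \<Longrightarrow> smooth (line_mean l s f)"
  unfolding line_mean_eq_comb by (intro smooth_add smooth_cmult smooth_shift)

lemma smooth_scheme: "(\<And>k. smooth (F k)) \<Longrightarrow> smooth (scheme l s F P k)"
proof (induction k)
  case 0
  show ?case using smooth_sum[of "{}"] by simp
next
  case (Suc k)
  show ?case
    unfolding scheme.simps
    by (intro smooth_add smooth_cmult smooth_line_mean smooth_shift_minus Suc.IH Suc.prems)
qed

text \<open>Such operators commute with the scheme. Errors of \<open>w\<^sub>k\<close> are thereby reduced to errors of the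
  source, which belongs to a fixed family, whereas \<open>w\<^sub>k\<close> depends on the whole path.\<close>

definition convolution_op :: "(('a::euclidean_space \<Rightarrow> real) \<Rightarrow> 'a \<Rightarrow> real) \<Rightarrow> bool" where
  "convolution_op L \<longleftrightarrow>
     (\<forall>f g c d. smooth f \<longrightarrow> smooth g \<longrightarrow> L (\<lambda>x. c * f x + d * g x) = (\<lambda>x. c * L f x + d * L g x)) \<and>
     (\<forall>f y. smooth f \<longrightarrow> L (\<lambda>x. f (x + y)) = (\<lambda>x. L f (x + y)))"

lemma convolution_op_linear:
  "convolution_op L \<Longrightarrow> smooth f \<Longrightarrow> smooth g \<Longrightarrow> L (\<lambda>x. c * f x + d * g x) = (\<lambda>x. c * L f x + d * L g x)"
  by (simp add: convolution_op_def)

lemma convolution_op_shift: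
  "convolution_op L \<Longrightarrow> smooth f \<Longrightarrow> L (\<lambda>x. f (x + y)) = (\<lambda>x. L f (x + y))"
  by (simp add: convolution_op_def)

lemma convolution_op_pd: "convolution_op (pd v)"
  unfolding convolution_op_def by (simp add: pd_shift pd_add pd_cmult smooth_cmult)

lemma convolution_op_diff2: "convolution_op (diff2 v s)"
  unfolding convolution_op_def
proof (intro conjI allI impI ext)
  fix f g :: "'a \<Rightarrow> real" and c d x
  show "diff2 v s (\<lambda>x. c * f x + d * g x) x = c * diff2 v s f x + d * diff2 v s g x"
    by (simp add: diff2_def add_divide_distrib diff_divide_distrib algebra_simps)
qed (simp add: diff2_def algebra_simps)

lemma convolution_op_compose:
  assumes L: "convolution_op L" and M: "convolution_op M" and sm: "\<And>f. smooth f \<Longrightarrow> smooth (M f)"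
  shows "convolution_op (\<lambda>f. L (M f))"
  unfolding convolution_op_def
  using convolution_op_linear[OF L sm sm] convolution_op_linear[OF M]
    convolution_op_shift[OF L sm] convolution_op_shift[OF M]
  by simp

lemma convolution_op_diff:
  assumes L: "convolution_op L" and M: "convolution_op M"
  shows "convolution_op (\<lambda>f x. L f x - M f x)"
  unfolding convolution_op_def
proof (intro conjI allI impI ext)
  fix f g :: "'a \<Rightarrow> real" and c d x assume "smooth f" "smooth g"
  then show "L (\<lambda>x. c * f x + d * g x) x - M (\<lambda>x. c * f x + d * g x) x
      = c * (L f x - M f x) + d * (L g x - M g x)"
    by (simp add: convolution_op_linear[OF L] convolution_op_linear[OF M] algebra_simps)
next
  fix f :: "'a \<Rightarrow> real" and y x assume "smooth f"
  then show "L (\<lambda>x. f (x + y)) x - M (\<lambda>x. f (x + y)) x = L f (x + y) - M f (x + y)"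
    by (simp only: convolution_op_shift[OF L] convolution_op_shift[OF M])
qed

lemma scheme_convolution_op:
  assumes L: "convolution_op L" and F: "\<And>k. smooth (F k)"
  shows "L (scheme l s F P k) = scheme l s (\<lambda>k. L (F k)) P k"
proof (induction k)
  case 0
  have "smooth (\<lambda>_::'a. 0)" using smooth_sum[of "{}"] by simp
  then show ?case using convolution_op_linear[OF L, of "\<lambda>_. 0" "\<lambda>_. 0" 0 0] by simp
next
  case (Suc k)
  let ?w = "scheme l s F P k"
  have w: "smooth ?w" by (intro smooth_scheme F)
  have 1: "L (line_mean l s ?w) = line_mean l s (L ?w)"
    unfolding line_mean_eq_comb
    by (simp only: convolution_op_linear[OF L smooth_shift smooth_shift, OF w w] convolution_op_shift[OF L w])
  have 2: "L (\<lambda>x. F k (x - P (Suc k))) = (\<lambda>x. L (F k) (x - P (Suc k)))"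
    using convolution_op_shift[OF L F, of k "- P (Suc k)"] by simp
  have "L (scheme l s F P (Suc k)) = L (\<lambda>x. 1 * line_mean l s ?w x + s\<^sup>2 / 2 * F k (x - P (Suc k)))"
    by simp
  also have "\<dots> = (\<lambda>x. 1 * L (line_mean l s ?w) x + s\<^sup>2 / 2 * L (\<lambda>x. F k (x - P (Suc k))) x)"
    by (intro convolution_op_linear L smooth_line_mean smooth_shift_minus w F)
  finally show ?case by (simp add: 1 2 Suc.IH)
qed

text \<open>The source for \<open>v = (k/K) u\<close>: the first term is the time derivative \<open>u/T\<close>, where
  \<open>T = K s\<^sup>2/2\<close> is the final time, and \<open>g\<close> will be the discrete elliptic operator applied to \<open>u\<close>.\<close>

definition ramp_source :: "('a \<Rightarrow> real) \<Rightarrow> ('a \<Rightarrow> real) \<Rightarrow> real \<Rightarrow> nat \<Rightarrow> nat \<Rightarrow> 'a \<Rightarrow> real" where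
  "ramp_source u g s K k x = u x / (real K * (s\<^sup>2 / 2)) - real k / real K * g x"

lemma ramp_source_eq:
  "ramp_source u g s K k = (\<lambda>x. (1 / (real K * (s\<^sup>2 / 2))) * u x + (- (real k / real K)) * g x)"
  by (rule ext) (simp add: ramp_source_def)

lemma smooth_ramp_source: "smooth u \<Longrightarrow> smooth g \<Longrightarrow> smooth (ramp_source u g s K k)"
  unfolding ramp_source_eq by (intro smooth_add smooth_cmult)

context translation_invariant_seminorm
begin

lemma shift_minus: "B c \<phi> \<Longrightarrow> B c (\<lambda>x. \<phi> (x - y))"
  using shift[of c \<phi> "-y"] by simp

lemma zero: "B 0 (\<lambda>_. 0)"
proof -
  have "uniform_Lip0 (\<lambda>_ _::'a. 0)" by (rule uniform_Lip0I[of 0 _ 0 0]) auto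
  from uniform[OF this] obtain C where "B C (\<lambda>_. 0)" by (metis greaterThanAtMost_iff less_numeral_extra(1) order_refl)
  from cmult[OF this, of 0] show ?thesis by simp
qed

lemma diff: "B c \<phi> \<Longrightarrow> B d \<psi> \<Longrightarrow> B (c + d) (\<lambda>x. \<phi> x - \<psi> x)"
  using add[of c \<phi> d "\<lambda>x. -1 * \<psi> x"] cmult[of d \<psi> "-1"] by simp

lemma line_mean: "B c \<phi> \<Longrightarrow> B c (line_mean l s \<phi>)"
  unfolding line_mean_eq_comb
  using add[OF cmult[OF shift[of c \<phi> "s *\<^sub>R l"], where r = "1/2"]
      cmult[OF shift[of c \<phi> "- (s *\<^sub>R l)"], where r = "1/2"]] by simp

lemma scheme_le:
  assumes "\<And>i. i < k \<Longrightarrow> B c (F i)"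
  shows "B (real k * (s\<^sup>2 / 2) * c) (scheme l s F P k)"
  using assms
proof (induction k)
  case 0
  show ?case using zero by simp
next
  case (Suc k)
  have "B (real k * (s\<^sup>2 / 2) * c + \<bar>s\<^sup>2 / 2\<bar> * c) (scheme l s F P (Suc k))"
    unfolding scheme.simps by (intro add line_mean Suc.IH cmult shift_minus Suc.prems) auto
  moreover have "real k * (s\<^sup>2 / 2) * c + \<bar>s\<^sup>2 / 2\<bar> * c = real (Suc k) * (s\<^sup>2 / 2) * c"
    by (simp add: algebra_simps)
  ultimately show ?case by metis
qed

lemma uniform_scaled:
  assumes "uniform_Lip0 (\<lambda>s x. \<Phi> s x / s)"
  shows "\<exists>C. \<forall>s\<in>{0<..1}. B (C * s) (\<Phi> s)"
proof -
  from uniform[OF assms] obtain C where C: "\<And>s. s \<in> {0<..1} \<Longrightarrow> B C (\<lambda>x. \<Phi> s x / s)" by blast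
  have "B (C * s) (\<Phi> s)" if "s \<in> {0<..1}" for s
    using cmult[OF C[OF that], of s] that by (simp add: mult.commute)
  then show ?thesis by blast
qed

lemma ramp_source_le:
  assumes L: "convolution_op L" and "smooth u" "smooth g"
    and a: "B a (L u)" and b: "B b (L g)" and T: "1 \<le> real K * (s\<^sup>2 / 2)" and "k < K"
  shows "B (a + b) (L (ramp_source u g s K k))"
proof -
  have "B (\<bar>1 / (real K * (s\<^sup>2 / 2))\<bar> * a + \<bar>- (real k / real K)\<bar> * b) (L (ramp_source u g s K k))"
    unfolding ramp_source_eq convolution_op_linear[OF L assms(2,3)] by (intro add cmult a b)
  moreover have "\<bar>1 / (real K * (s\<^sup>2 / 2))\<bar> * a \<le> 1 * a"
    using nonneg[OF a] T by (intro mult_right_mono) auto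
  moreover have "\<bar>- (real k / real K)\<bar> * b \<le> 1 * b"
    using nonneg[OF b] \<open>k < K\<close> by (intro mult_right_mono) auto
  ultimately show ?thesis by (elim mono) linarith
qed

text \<open>The expression \<open>\<phi>/\<tau> - D\<^sub>l\<^sup>2 w\<^sub>k - \<theta> D\<^sub>l\<^sup>2 \<phi>\<close>, where \<open>\<tau> = s\<^sup>2/2\<close>, is the source for which the linear interpolation
  between \<open>w\<^sub>k\<close> and \<open>w\<^sub>k\<^sub>+\<^sub>1\<close> is an exact solution at relative time \<open>\<theta>\<close>. Its distance from the shift of
  \<open>-(k/K) f\<close> is composed of the
  consistency error of the second difference, of order \<open>s\<close> per unit time and accumulated over
  time \<open>T\<close>, of \<open>u/T\<close>, of the error of the discrete elliptic operator, and of the variation of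
  \<open>D\<^sub>l\<^sup>2 w\<close> within a time step. The letters \<open>E\<close> and \<open>H\<close> in the proof denote the consistency error and the
  second derivative of the second difference.\<close>

lemma scheme_errors:
  fixes y :: "'j::finite \<Rightarrow> 'a" and l :: 'a
  assumes u: "C0_infinity u"
  shows "\<exists>C. \<forall>s\<in>{0<..1}. \<forall>K k P \<theta>. 1 \<le> real K * (s\<^sup>2 / 2) \<longrightarrow> k < K \<longrightarrow> 0 \<le> \<theta> \<longrightarrow> \<theta> \<le> 1 \<longrightarrow>
    (let T = real K * (s\<^sup>2 / 2);
         w = scheme l s (ramp_source u (discrete_op l y u s) s K) P;
         \<phi> = (\<lambda>x. w (Suc k) x - w k x)
     in B (C * (s * T + 1 / T)) (\<lambda>x. \<phi> x / (s\<^sup>2 / 2) - pd l (pd l (w k)) x - \<theta> * pd l (pd l \<phi>) x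
              + real k / real K * second_order_op l y u (x - P (Suc k))) \<and>
        B (C * (s * T)) (pd l (pd l \<phi>)))"
proof -
  define Q where "Q = discrete_op l y u"
  have smu: "smooth u" using u by (simp add: C0_infinity_iff)
  note uu = uniform_C0_const[OF u]
  have QQ: "uniform_C0 Q" unfolding Q_def by (rule uniform_C0_discrete_op[OF u])
  define E where "E = (\<lambda>s f x. diff2 l s f x - pd l (pd l f) x)"
  define H where "H = (\<lambda>s f. pd l (pd l (diff2 l s f)))"
  define D where "D = (\<lambda>f. pd l (pd l f))"
  obtain c1 where c1: "\<And>s. s \<in> {0<..1} \<Longrightarrow> B (c1 * s) (E s u)"
    using uniform_scaled[of "\<lambda>s. E s u"] uniform_Lip0_diff2_error[OF uu, of l] unfolding E_def by blast
  obtain c2 where c2: "\<And>s. s \<in> {0<..1} \<Longrightarrow> B (c2 * s) (E s (Q s))"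
    using uniform_scaled[of "\<lambda>s. E s (Q s)"] uniform_Lip0_diff2_error[OF QQ, of l] unfolding E_def by blast
  obtain c3 where c3: "\<And>s. s \<in> {0<..1} \<Longrightarrow> B c3 (H s u)"
    using uniform[OF uniform_C0_imp_Lip0[OF uniform_C0_pd[OF uniform_C0_pd[OF uniform_C0_diff2[OF uu]]]]]
    unfolding H_def by blast
  obtain c4 where c4: "\<And>s. s \<in> {0<..1} \<Longrightarrow> B c4 (H s (Q s))"
    using uniform[OF uniform_C0_imp_Lip0[OF uniform_C0_pd[OF uniform_C0_pd[OF uniform_C0_diff2[OF QQ]]]]]
    unfolding H_def by blast
  obtain c5 where c5: "\<And>s::real. s \<in> {0<..1} \<Longrightarrow> B c5 (D u)"
    using uniform[OF uniform_C0_imp_Lip0[OF uniform_C0_pd[OF uniform_C0_pd[OF uu]]]]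
    unfolding D_def by blast
  obtain c6 where c6: "\<And>s. s \<in> {0<..1} \<Longrightarrow> B c6 (D (Q s))"
    using uniform[OF uniform_C0_imp_Lip0[OF uniform_C0_pd[OF uniform_C0_pd[OF QQ]]]]
    unfolding D_def by blast
  obtain c7 where c7: "\<And>s::real. s \<in> {0<..1} \<Longrightarrow> B c7 u"
    using uniform[OF uniform_C0_imp_Lip0[OF uu]] by blast
  obtain c8 where c8: "\<And>s. s \<in> {0<..1} \<Longrightarrow> B (c8 * s) (\<lambda>x. Q s x - second_order_op l y u x)"
    using uniform_scaled[OF discrete_op_converges[OF u, of l y]] unfolding Q_def by blast
  have "(1::real) \<in> {0<..1}" by simp
  note nonnegs = this[THEN c1, THEN nonneg] this[THEN c2, THEN nonneg] this[THEN c3, THEN nonneg]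
    this[THEN c4, THEN nonneg] this[THEN c5, THEN nonneg] this[THEN c6, THEN nonneg]
    this[THEN c7, THEN nonneg] this[THEN c8, THEN nonneg]
  define C where "C = c1 + c2 + c3 + c4 + c5 + c6 + c7 + c8"
  show ?thesis
  proof (intro exI[of _ C] ballI allI impI)
    fix s :: real and K k :: nat and P :: "nat \<Rightarrow> 'a" and \<theta> :: real
    assume s: "s \<in> {0<..1}" and T: "1 \<le> real K * (s\<^sup>2 / 2)" and k: "k < K" and \<theta>: "0 \<le> \<theta>" "\<theta> \<le> 1"
    define T where "T = real K * (s\<^sup>2 / 2)"
    define F where "F = ramp_source u (Q s) s K"
    define w where "w = scheme l s F P"
    define \<phi> where "\<phi> = (\<lambda>x. w (Suc k) x - w k x)"
    have smQ: "smooth (Q s)" using uniform_C0_smooth[OF QQ s] .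
    have smF: "smooth (F i)" for i unfolding F_def by (intro smooth_ramp_source smu smQ)
    have smw: "smooth (w i)" for i unfolding w_def by (intro smooth_scheme smF)
    have opD: "convolution_op D"
      unfolding D_def by (rule convolution_op_compose[OF convolution_op_pd convolution_op_pd smooth_pd])
    have opE: "convolution_op (E s)"
      using convolution_op_diff[OF convolution_op_diff2 opD] unfolding E_def D_def .
    have opH: "convolution_op (H s)"
      using convolution_op_compose[OF opD convolution_op_diff2 smooth_diff2] unfolding H_def D_def .
    have kT: "real k * (s\<^sup>2 / 2) \<le> T"
      unfolding T_def using k by (intro mult_right_mono) auto
    have sc: "B (T * (a + b)) (L (w k))"
      if "convolution_op L" "B a (L u)" "B b (L (Q s))" for L a b
    proof -
      have "L (w k) = scheme l s (\<lambda>i. L (F i)) P k"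
        unfolding w_def by (intro scheme_convolution_op that smF)
      moreover have "B (real k * (s\<^sup>2 / 2) * (a + b)) (scheme l s (\<lambda>i. L (F i)) P k)"
        unfolding F_def using k by (intro scheme_le ramp_source_le that smu smQ T) auto
      moreover have "real k * (s\<^sup>2 / 2) * (a + b) \<le> T * (a + b)"
        using kT nonneg[OF that(2)] nonneg[OF that(3)] by (intro mult_right_mono) auto
      ultimately show ?thesis using mono by metis
    qed
    have b1: "B (T * (c1 * s + c2 * s)) (E s (w k))"
      by (intro sc opE c1 c2 s)
    have b2: "B (T * (c3 + c4)) (H s (w k))"
      by (intro sc opH c3 c4 s)
    have b3: "B (c5 + c6) (\<lambda>x. D (F k) (x - P (Suc k)))"
      unfolding F_def by (intro shift_minus ramp_source_le opD smu smQ c5[OF s] c6[OF s] T k)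
    have \<phi>: "\<phi> = (\<lambda>x. s\<^sup>2 / 2 * diff2 l s (w k) x + s\<^sup>2 / 2 * F k (x - P (Suc k)))"
      using s by (auto simp: \<phi>_def w_def line_mean_eq_diff2)
    have "D \<phi> = (\<lambda>x. s\<^sup>2 / 2 * D (diff2 l s (w k)) x + s\<^sup>2 / 2 * D (\<lambda>x. F k (x - P (Suc k))) x)"
      unfolding \<phi> by (intro convolution_op_linear opD smooth_diff2 smw smooth_shift_minus smF)
    also have "D (\<lambda>x. F k (x - P (Suc k))) = (\<lambda>x. D (F k) (x - P (Suc k)))"
      using convolution_op_shift[OF opD smF, of k "- P (Suc k)"] by simp
    finally have D\<phi>: "D \<phi> = (\<lambda>x. s\<^sup>2 / 2 * H s (w k) x + s\<^sup>2 / 2 * D (F k) (x - P (Suc k)))"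
      by (simp add: H_def D_def)
    have "s\<^sup>2 \<le> s * 1" using s unfolding power2_eq_square by (intro mult_left_mono) auto
    then have "\<bar>s\<^sup>2 / 2\<bar> * (T * (c3 + c4)) + \<bar>s\<^sup>2 / 2\<bar> * (c5 + c6) \<le> s * (T * (c3 + c4)) + s * (T * (c5 + c6))"
      using T s nonnegs unfolding T_def[symmetric]
      by (intro add_mono mult_mono mult_right_mono[of 1 T "c5 + c6", simplified]) auto
    then have bD: "B (s * (T * (c3 + c4)) + s * (T * (c5 + c6))) (D \<phi>)"
      unfolding D\<phi> by (rule mono[rotated]) (intro add cmult b2 b3)
    have "s * (T * (c3 + c4)) + s * (T * (c5 + c6)) = (c3 + c4 + c5 + c6) * (s * T)"
      by (simp add: algebra_simps)
    also have "\<dots> \<le> C * (s * T)"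
      using s T nonnegs unfolding T_def[symmetric] C_def by (intro mult_right_mono) auto
    finally have "B (C * (s * T)) (D \<phi>)" by (rule mono[OF bD])
    moreover have "B (C * (s * T + 1 / T)) (\<lambda>x. \<phi> x / (s\<^sup>2 / 2) - D (w k) x - \<theta> * D \<phi> x
              + real k / real K * second_order_op l y u (x - P (Suc k)))"
    proof -
      have m1: "B (T * (c1 * s + c2 * s) + \<bar>1 / T\<bar> * c7 + \<bar>real k / real K\<bar> * (c8 * s)
            + \<bar>\<theta>\<bar> * (s * (T * (c3 + c4)) + s * (T * (c5 + c6))))
          (\<lambda>x. E s (w k) x + (1 / T) * u (x - P (Suc k))
            - real k / real K * (Q s (x - P (Suc k)) - second_order_op l y u (x - P (Suc k)))
            - \<theta> * D \<phi> x)"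
        by (intro diff add cmult b1 bD
            shift_minus[of c7 u] shift_minus[of "c8 * s" "\<lambda>x. Q s x - second_order_op l y u x"] c7[OF s] c8 s)
      have m2: "E s (w k) x + (1 / T) * u (x - P (Suc k))
            - real k / real K * (Q s (x - P (Suc k)) - second_order_op l y u (x - P (Suc k)))
            - \<theta> * D \<phi> x = \<phi> x / (s\<^sup>2 / 2) - D (w k) x - \<theta> * D \<phi> x
              + real k / real K * second_order_op l y u (x - P (Suc k))" for x
      proof -
        have "\<phi> x / (s\<^sup>2 / 2) = diff2 l s (w k) x + F k (x - P (Suc k))"
          using s unfolding \<phi> by (simp add: field_simps)
        then show ?thesis
          by (simp add: E_def D_def F_def ramp_source_def T_def algebra_simps)
      qed
      have m3: "T * (c1 * s + c2 * s) + \<bar>1 / T\<bar> * c7 + \<bar>real k / real K\<bar> * (c8 * s)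
            + \<bar>\<theta>\<bar> * (s * (T * (c3 + c4)) + s * (T * (c5 + c6))) \<le> C * (s * T + 1 / T)"
      proof -
        have "\<bar>real k / real K\<bar> * (c8 * s) \<le> T * (c8 * s)"
          using k s T nonnegs unfolding T_def[symmetric] by (intro mult_right_mono) (auto intro: order_trans[of _ 1])
        moreover have "\<bar>\<theta>\<bar> * (s * (T * (c3 + c4)) + s * (T * (c5 + c6))) \<le> 1 * (s * (T * (c3 + c4)) + s * (T * (c5 + c6)))"
          using \<theta> s T nonnegs unfolding T_def[symmetric] by (intro mult_right_mono) auto
        moreover have "0 \<le> (c1 + c2 + c3 + c4 + c5 + c6 + c8) * (1 / T)" "0 \<le> c7 * (s * T)"
          using s T nonnegs unfolding T_def[symmetric] by auto
        moreover have "\<bar>1 / T\<bar> = 1 / T" using T unfolding T_def[symmetric] by simp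
        moreover define r where "r = 1 / T"
        ultimately show ?thesis unfolding C_def r_def[symmetric] by (simp add: algebra_simps)
      qed
      show ?thesis using mono[OF m1 m3] by (simp only: m2)
    qed
    ultimately show "let T = real K * (s\<^sup>2 / 2);
         w = scheme l s (ramp_source u (discrete_op l y u s) s K) P;
         \<phi> = (\<lambda>x. w (Suc k) x - w k x)
     in B (C * (s * T + 1 / T)) (\<lambda>x. \<phi> x / (s\<^sup>2 / 2) - pd l (pd l (w k)) x - \<theta> * pd l (pd l \<phi>) x
              + real k / real K * second_order_op l y u (x - P (Suc k))) \<and>
        B (C * (s * T)) (pd l (pd l \<phi>))"
      unfolding Let_def D_def \<phi>_def w_def F_def T_def Q_def by blast
  qed
qed

end

section \<open>Averaging over the random walk\<close>

text \<open>Resampling one coordinate preserves the uniform distribution: \<open>(\<gamma>, j) \<mapsto> (\<gamma>(i := j), \<gamma> i)\<close> is an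
  involution. This takes the place of the Markov property of the walk.\<close>

lemma sum_PiE_resample:
  fixes h :: "('i \<Rightarrow> 'j::finite) \<Rightarrow> real"
  assumes "i \<in> I"
  shows "(\<Sum>\<gamma>\<in>PiE I (\<lambda>_. UNIV). \<Sum>j\<in>UNIV. h (\<gamma>(i := j))) = real CARD('j) * (\<Sum>\<gamma>\<in>PiE I (\<lambda>_. UNIV). h \<gamma>)"
proof -
  let ?\<Omega> = "PiE I (\<lambda>_. UNIV :: 'j set)"
  have upd: "\<gamma>(i := j) \<in> ?\<Omega>" if "\<gamma> \<in> ?\<Omega>" for \<gamma> j
    using that assms by (auto simp: PiE_iff extensional_def)
  have "(\<Sum>\<gamma>\<in>?\<Omega>. \<Sum>j\<in>UNIV. h (\<gamma>(i := j))) = (\<Sum>(\<gamma>, j)\<in>?\<Omega> \<times> UNIV. h (\<gamma>(i := j)))"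
    by (rule sum.cartesian_product)
  also have "\<dots> = (\<Sum>(\<gamma>, j)\<in>?\<Omega> \<times> (UNIV :: 'j set). h \<gamma>)"
    by (rule sum.reindex_bij_witness[of _ "\<lambda>(\<gamma>, j). (\<gamma>(i := j), \<gamma> i)" "\<lambda>(\<gamma>, j). (\<gamma>(i := j), \<gamma> i)"])
      (use assms in \<open>auto simp: upd PiE_iff extensional_def\<close>)
  also have "\<dots> = (\<Sum>\<gamma>\<in>?\<Omega>. \<Sum>j\<in>(UNIV :: 'j set). h \<gamma>)"
    by (rule sum.cartesian_product[symmetric])
  finally show ?thesis by (simp add: sum_distrib_left)
qed

definition walk :: "('j \<Rightarrow> 'a::euclidean_space) \<Rightarrow> real \<Rightarrow> (nat \<Rightarrow> 'j \<times> bool) \<Rightarrow> nat \<Rightarrow> 'a" where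
  "walk y s \<gamma> k = (\<Sum>i<k. jump y s (\<gamma> i))"

definition paths :: "nat \<Rightarrow> (nat \<Rightarrow> 'j \<times> bool) set" where
  "paths K = PiE {..<K} (\<lambda>_. UNIV)"

lemma finite_paths: "finite (paths K :: (nat \<Rightarrow> 'j::finite \<times> bool) set)"
  unfolding paths_def by (intro finite_PiE) auto

lemma card_paths_pos: "0 < card (paths K :: (nat \<Rightarrow> 'j::finite \<times> bool) set)"
  using finite_paths[of K] unfolding paths_def by (simp add: card_gt_0_iff PiE_eq_empty_iff)

lemma scheme_cong:
  "(\<And>i. i \<le> k \<Longrightarrow> P i = P' i) \<Longrightarrow> scheme l s F P k = scheme l s F P' k"
  by (induction k) simp_all

lemma walk_cong: "(\<And>i. i < k \<Longrightarrow> \<gamma> i = \<gamma>' i) \<Longrightarrow> walk y s \<gamma> k = walk y s \<gamma>' k"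
  by (simp add: walk_def)

text \<open>The function \<open>w\<^sub>k\<close> depends only on the first \<open>k\<close> jumps, so averaging over the next one, which
  enters through the shift \<open>P\<^sub>k\<^sub>+\<^sub>1\<close>, applies \<open>jump_mean\<close>. The means \<open>v\<^sub>k\<close> hence satisfy
  \<open>v\<^sub>k\<^sub>+\<^sub>1 = jump_mean (line_mean v\<^sub>k) + (s\<^sup>2/2) F\<^sub>k\<close>, and the source is designed so that \<open>(k/K) u\<close> solves this
  recursion.\<close>

lemma scheme_walk_mean:
  fixes y :: "'j::finite \<Rightarrow> 'a::euclidean_space"
  assumes "0 < K" "s \<noteq> 0" "k \<le> K"
  shows "(\<Sum>\<gamma>\<in>paths K. scheme l s (ramp_source u (discrete_op l y u s) s K) (walk y s \<gamma>) k (x + walk y s \<gamma> k))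
           / real (card (paths K :: (nat \<Rightarrow> 'j \<times> bool) set)) = real k / real K * u x"
  using assms(3)
proof (induction k arbitrary: x)
  case 0
  show ?case by simp
next
  case (Suc k)
  define \<Omega> where "\<Omega> = (paths K :: (nat \<Rightarrow> 'j \<times> bool) set)"
  define n where "n = real (card \<Omega>)"
  define m where "m = real CARD('j \<times> bool)"
  define F where "F = ramp_source u (discrete_op l y u s) s K"
  define P where "P = walk y s"
  define w where "w = (\<lambda>\<gamma>. scheme l s F (P \<gamma>) k)"
  have n: "0 < n" unfolding n_def \<Omega>_def using card_paths_pos by simp
  have m: "0 < m" unfolding m_def by simp
  have IH: "(\<Sum>\<gamma>\<in>\<Omega>. w \<gamma> (x + P \<gamma> k)) = n * (real k / real K * u x)" for x
    using Suc.IH[of x] Suc.prems n unfolding \<Omega>_def[symmetric] n_def[symmetric] w_def F_def P_def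
    by (simp add: field_simps)
  \<comment> \<open>the jump number \<open>k\<close> enters only through the shift; in the source term its two occurrences cancel\<close>
  define h where "h = (\<lambda>\<gamma>. line_mean l s (w \<gamma>) (x + P \<gamma> k + jump y s (\<gamma> k)))"
  have "P (\<gamma>(k := j)) k = P \<gamma> k" "w (\<gamma>(k := j)) = w \<gamma>" for \<gamma> j
    unfolding P_def w_def by (auto intro!: walk_cong scheme_cong)
  then have h_upd: "h (\<gamma>(k := j)) = line_mean l s (w \<gamma>) (x + jump y s j + P \<gamma> k)" for \<gamma> j
    by (simp add: h_def add.commute add.left_commute)
  have "m * (\<Sum>\<gamma>\<in>\<Omega>. h \<gamma>) = (\<Sum>\<gamma>\<in>\<Omega>. \<Sum>j\<in>UNIV. h (\<gamma>(k := j)))"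
    unfolding \<Omega>_def paths_def m_def using Suc.prems by (subst sum_PiE_resample) auto
  also have "\<dots> = (\<Sum>j\<in>UNIV. \<Sum>\<gamma>\<in>\<Omega>. line_mean l s (w \<gamma>) (x + jump y s j + P \<gamma> k))"
    unfolding h_upd by (rule sum.swap)
  also have "\<dots> = (\<Sum>j\<in>UNIV. n * (real k / real K * line_mean l s u (x + jump y s j)))"
  proof (rule sum.cong)
    fix j
    let ?z = "x + jump y s j"
    have "(\<Sum>\<gamma>\<in>\<Omega>. line_mean l s (w \<gamma>) (?z + P \<gamma> k)) =
      ((\<Sum>\<gamma>\<in>\<Omega>. w \<gamma> (?z + P \<gamma> k + s *\<^sub>R l)) + (\<Sum>\<gamma>\<in>\<Omega>. w \<gamma> (?z + P \<gamma> k - s *\<^sub>R l))) / 2"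
      by (simp only: line_mean_def sum.distrib sum_divide_distrib add_divide_distrib)
    also have "(\<Sum>\<gamma>\<in>\<Omega>. w \<gamma> (?z + P \<gamma> k + s *\<^sub>R l)) = n * (real k / real K * u (?z + s *\<^sub>R l))"
      using IH[of "?z + s *\<^sub>R l"] by (simp only: ac_simps)
    also have "(\<Sum>\<gamma>\<in>\<Omega>. w \<gamma> (?z + P \<gamma> k - s *\<^sub>R l)) = n * (real k / real K * u (?z - s *\<^sub>R l))"
      using IH[of "?z - s *\<^sub>R l"] by (simp only: diff_add_eq)
    finally show "(\<Sum>\<gamma>\<in>\<Omega>. line_mean l s (w \<gamma>) (?z + P \<gamma> k)) = n * (real k / real K * line_mean l s u ?z)"
      by (simp add: line_mean_def algebra_simps add_divide_distrib)
  qed simp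
  also have "\<dots> = m * (n * (real k / real K * jump_mean y s (line_mean l s u) x))"
    using m unfolding jump_mean_def m_def[symmetric] sum_distrib_left[symmetric] by simp
  finally have h_sum: "(\<Sum>\<gamma>\<in>\<Omega>. h \<gamma>) = n * (real k / real K * jump_mean y s (line_mean l s u) x)"
    using m by (simp only: mult_cancel_left) simp
  have "scheme l s F (P \<gamma>) (Suc k) (x + P \<gamma> (Suc k)) = h \<gamma> + s\<^sup>2 / 2 * F k x" for \<gamma>
    by (simp add: h_def w_def P_def walk_def add.assoc)
  then have "(\<Sum>\<gamma>\<in>\<Omega>. scheme l s F (P \<gamma>) (Suc k) (x + P \<gamma> (Suc k))) / n
      = real k / real K * jump_mean y s (line_mean l s u) x + s\<^sup>2 / 2 * F k x"
    using n by (simp only: sum.distrib h_sum) (simp add: n_def field_simps)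
  also have "\<dots> = real (Suc k) / real K * u x"
    using assms(1,2) by (simp add: F_def ramp_source_def discrete_op_def field_simps)
  finally show ?case unfolding \<Omega>_def n_def F_def P_def .
qed

section \<open>Sums of squares and the elliptic operator\<close>

lemma quadratic_form_shift:
  fixes b :: "'d::finite \<Rightarrow> 'd \<Rightarrow> real"
  assumes "\<And>i j. b i j = b j i"
  shows "(\<Sum>i\<in>UNIV. \<Sum>j\<in>UNIV. b i j * (\<xi> i + (if i = k then t else 0)) * (\<xi> j + (if j = k then t else 0)))
    = (\<Sum>i\<in>UNIV. \<Sum>j\<in>UNIV. b i j * \<xi> i * \<xi> j) + 2 * t * (\<Sum>j\<in>UNIV. b k j * \<xi> j) + t\<^sup>2 * b k k"
proof -
  let ?e = "\<lambda>i. if i = k then t else 0 :: real"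
  have *: "(\<Sum>i\<in>UNIV. \<Sum>j\<in>UNIV. b i j * \<xi> i * ?e j) = t * (\<Sum>j\<in>UNIV. b k j * \<xi> j)" for \<xi>
    using assms[of _ k] by (simp add: if_distrib[of "\<lambda>z. _ * z"] sum_distrib_left mult_ac cong: if_cong)
  have "(\<Sum>i\<in>UNIV. \<Sum>j\<in>UNIV. b i j * (\<xi> i + ?e i) * (\<xi> j + ?e j)) =
     (\<Sum>i\<in>UNIV. \<Sum>j\<in>UNIV. b i j * \<xi> i * \<xi> j) + (\<Sum>i\<in>UNIV. \<Sum>j\<in>UNIV. b i j * \<xi> i * ?e j)
     + (\<Sum>i\<in>UNIV. \<Sum>j\<in>UNIV. b i j * ?e i * \<xi> j) + (\<Sum>i\<in>UNIV. \<Sum>j\<in>UNIV. b i j * ?e i * ?e j)"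
    by (simp add: algebra_simps sum.distrib del: if_distrib mult_zero_right)
  also note *[of \<xi>]
  also have "(\<Sum>i\<in>UNIV. \<Sum>j\<in>UNIV. b i j * ?e i * \<xi> j) = t * (\<Sum>j\<in>UNIV. b k j * \<xi> j)"
    by (subst sum.swap) (simp add: if_distrib[of "\<lambda>z. _ * z"] if_distrib[of "\<lambda>z. z * _"] sum_distrib_left mult_ac cong: if_cong)
  also have "(\<Sum>i\<in>UNIV. \<Sum>j\<in>UNIV. b i j * ?e i * ?e j) = t\<^sup>2 * b k k"
    unfolding * by (simp add: if_distrib[of "\<lambda>z. _ * z"] power2_eq_square mult_ac cong: if_cong)
  finally show ?thesis by simp
qed

text \<open>Completion of the square, one index at a time: for \<open>b\<^sub>k\<^sub>k > 0\<close> the Schur complement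
  \<open>b\<^sub>i\<^sub>j - b\<^sub>k\<^sub>i b\<^sub>k\<^sub>j / b\<^sub>k\<^sub>k\<close> is again positive semidefinite and has a vanishing \<open>k\<close>-th row; for \<open>b\<^sub>k\<^sub>k = 0\<close> that
  row vanishes already, and division by zero yields zero.\<close>

lemma psd_sum_of_squares_on:
  fixes b :: "'d::finite \<Rightarrow> 'd \<Rightarrow> real"
  assumes "finite S" "\<And>i j. b i j = b j i" "\<And>\<xi>. 0 \<le> (\<Sum>i\<in>UNIV. \<Sum>j\<in>UNIV. b i j * \<xi> i * \<xi> j)"
    and "\<And>i j. i \<notin> S \<Longrightarrow> b i j = 0"
  shows "\<exists>\<sigma>. \<forall>i j. b i j = (\<Sum>k\<in>S. \<sigma> k i * \<sigma> k j)"
  using assms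
proof (induction S arbitrary: b rule: finite_induct)
  case empty
  then show ?case by auto
next
  case (insert k S)
  note sym = insert.prems(1) and psd = insert.prems(2) and supp = insert.prems(3)
  have shifted: "0 \<le> (\<Sum>i\<in>UNIV. \<Sum>j\<in>UNIV. b i j * \<xi> i * \<xi> j) + 2 * t * (\<Sum>j\<in>UNIV. b k j * \<xi> j) + t\<^sup>2 * b k k" for \<xi> t
    using psd[of "\<lambda>i. \<xi> i + (if i = k then t else 0)"] quadratic_form_shift[of b \<xi> k t, OF sym] by simp
  define c where "c = (\<lambda>i j. b i j - b k i * b k j / b k k)"
  have row: "b k j = 0" if "b k k = 0" for j
  proof (rule ccontr)
    assume "b k j \<noteq> 0"
    define \<xi> where "\<xi> = (\<lambda>i. if i = j then 1 else 0 :: real)"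
    have "(\<Sum>j\<in>UNIV. b k j * \<xi> j) = b k j"
      by (simp add: \<xi>_def if_distrib[of "\<lambda>z. _ * z"] cong: if_cong)
    moreover define q where "q = (\<Sum>i\<in>UNIV. \<Sum>j\<in>UNIV. b i j * \<xi> i * \<xi> j)"
    ultimately have "0 \<le> q + 2 * t * b k j" for t
      using shifted[of \<xi> t] that by simp
    \<comment> \<open>an affine function of \<open>t\<close> with nonzero slope takes the value \<open>-1\<close>\<close>
    from this[of "- (q + 1) / (2 * b k j)"] \<open>b k j \<noteq> 0\<close> show False by (simp add: field_simps)
  qed
  have "\<exists>\<sigma>. \<forall>i j. c i j = (\<Sum>k\<in>S. \<sigma> k i * \<sigma> k j)"
  proof (rule insert.IH)
    show "c i j = c j i" for i j using sym by (simp add: c_def mult.commute)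
    show "c i j = 0" if "i \<notin> S" for i j
      using that supp[of i j] supp[of i k] sym[of i k] row[of j] by (cases "i = k") (auto simp: c_def)
    fix \<xi> :: "'d \<Rightarrow> real"
    define L where "L = (\<Sum>j\<in>UNIV. b k j * \<xi> j)"
    have "L * L = (\<Sum>i\<in>UNIV. \<Sum>j\<in>UNIV. b k i * b k j * \<xi> i * \<xi> j)"
      unfolding L_def sum_product by (simp add: mult_ac)
    then have "(\<Sum>i\<in>UNIV. \<Sum>j\<in>UNIV. c i j * \<xi> i * \<xi> j)
      = (\<Sum>i\<in>UNIV. \<Sum>j\<in>UNIV. b i j * \<xi> i * \<xi> j) - L * L / b k k"
      by (simp add: c_def left_diff_distrib sum_subtractf sum_divide_distrib)
    also have "\<dots> = (\<Sum>i\<in>UNIV. \<Sum>j\<in>UNIV. b i j * \<xi> i * \<xi> j) + 2 * (- L / b k k) * L + (- L / b k k)\<^sup>2 * b k k"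
      by (cases "b k k = 0") (auto simp: field_simps power2_eq_square)
    finally show "0 \<le> (\<Sum>i\<in>UNIV. \<Sum>j\<in>UNIV. c i j * \<xi> i * \<xi> j)"
      using shifted[of \<xi> "- L / b k k"] unfolding L_def by simp
  qed
  then obtain \<sigma> where \<sigma>: "\<And>i j. c i j = (\<Sum>k\<in>S. \<sigma> k i * \<sigma> k j)" by blast
  have kk: "0 \<le> b k k"
    using psd[of "\<lambda>i. if i = k then 1 else 0"] by (simp add: if_distrib[of "\<lambda>z. _ * z"] cong: if_cong)
  define \<sigma>' where "\<sigma>' = \<sigma>(k := \<lambda>i. b k i / sqrt (b k k))"
  have "b i j = (\<Sum>k\<in>insert k S. \<sigma>' k i * \<sigma>' k j)" for i j
  proof -
    have "(\<Sum>k\<in>S. \<sigma>' k i * \<sigma>' k j) = c i j"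
      unfolding \<sigma> using insert.hyps by (intro sum.cong) (auto simp: \<sigma>'_def)
    moreover have "\<sigma>' k i * \<sigma>' k j = b k i * b k j / b k k"
      using kk by (simp add: \<sigma>'_def)
    ultimately show ?thesis using insert.hyps by (simp add: c_def)
  qed
  then show ?case by blast
qed

lemma pd_vec_eq_sum:
  fixes f :: "real ^ 'd::finite \<Rightarrow> real"
  assumes "f differentiable (at x)"
  shows "pd v f x = (\<Sum>i\<in>UNIV. v $ i * pd (axis i 1) f x)"
proof -
  have l: "linear (\<lambda>v. pd v f x)"
    using has_derivative_pd[OF assms] has_derivative_linear by blast
  have "pd v f x = pd (\<Sum>i\<in>UNIV. (v $ i) *\<^sub>R axis i 1) f x"
    using basis_expansion[of v] by (simp add: scalar_mult_eq_scaleR)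
  also have "\<dots> = (\<Sum>i\<in>UNIV. v $ i * pd (axis i 1) f x)"
    by (simp add: linear_sum[OF l] linear_cmul[OF l])
  finally show ?thesis .
qed

lemma D2_dir_eq_pd:
  assumes "smooth f"
  shows "D2_dir l f x = pd l (pd l f) x"
proof -
  have "pd l f = (\<lambda>x. \<Sum>i\<in>UNIV. l $ i * pd (axis i 1) f x)"
    by (rule ext, rule pd_vec_eq_sum, rule smooth_imp_differentiable[OF assms])
  then have "pd v (pd l f) x = (\<Sum>i\<in>UNIV. l $ i * pd v (pd (axis i 1) f) x)" for v
    by (simp only: pd_sum pd_cmult smooth_cmult smooth_pd assms)
  then show ?thesis
    unfolding pd_vec_eq_sum[OF smooth_imp_differentiable[OF smooth_pd[OF assms]], of l l x]
    by (simp add: D2_dir_def D2_def sum_distrib_left mult.assoc)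
qed

text \<open>Ellipticity and the Cauchy-Schwarz inequality make \<open>a - l l\<^sup>T\<close> positive semidefinite. The vectors \<open>y\<^sub>k\<close>
  are scaled by the square root of their number to compensate for the mean in \<open>second_order_op\<close>.\<close>

lemma elliptic_decomposition:
  fixes a :: "real ^ 'd::finite ^ 'd"
  assumes sym: "\<And>i j. a $ i $ j = a $ j $ i"
    and ell: "\<And>\<xi>::real ^ 'd. (\<Sum>i\<in>UNIV. \<Sum>j\<in>UNIV. a $ i $ j * \<xi> $ i * \<xi> $ j) \<ge> (norm \<xi>)\<^sup>2"
    and l: "norm l = 1"
  obtains y :: "'d \<Rightarrow> real ^ 'd" where
    "\<And>u x. smooth u \<Longrightarrow> (\<Sum>i\<in>UNIV. \<Sum>j\<in>UNIV. a $ i $ j * D2 i j u x) = second_order_op l y u x"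
proof -
  have "0 \<le> (\<Sum>i\<in>UNIV. \<Sum>j\<in>UNIV. (a $ i $ j - l $ i * l $ j) * \<xi> i * \<xi> j)" for \<xi> :: "'d \<Rightarrow> real"
  proof -
    define z where "z = (\<chi> i. \<xi> i)"
    have "(l \<bullet> z)\<^sup>2 \<le> (norm z)\<^sup>2"
      using Cauchy_Schwarz_ineq2[of l z] l by (simp add: abs_le_square_iff[symmetric])
    moreover have "(l \<bullet> z)\<^sup>2 = (\<Sum>i\<in>UNIV. \<Sum>j\<in>UNIV. l $ i * l $ j * \<xi> i * \<xi> j)"
      unfolding power2_eq_square inner_vec_def sum_product by (simp add: z_def mult_ac)
    moreover have "(norm z)\<^sup>2 \<le> (\<Sum>i\<in>UNIV. \<Sum>j\<in>UNIV. a $ i $ j * \<xi> i * \<xi> j)"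
      using ell[of z] by (simp add: z_def)
    ultimately show ?thesis by (simp add: left_diff_distrib sum_subtractf)
  qed
  then have "\<exists>\<sigma>. \<forall>i j. a $ i $ j - l $ i * l $ j = (\<Sum>k\<in>(UNIV::'d set). \<sigma> k i * \<sigma> k j)"
    using sym by (intro psd_sum_of_squares_on[of UNIV "\<lambda>i j. a $ i $ j - l $ i * l $ j"]) (auto simp: mult.commute)
  then obtain \<sigma> :: "'d \<Rightarrow> 'd \<Rightarrow> real"
    where \<sigma>0: "\<And>i j. a $ i $ j - l $ i * l $ j = (\<Sum>k\<in>UNIV. \<sigma> k i * \<sigma> k j)" by blast
  have \<sigma>: "a $ i $ j = l $ i * l $ j + (\<Sum>k\<in>UNIV. \<sigma> k i * \<sigma> k j)" for i j
    using \<sigma>0[of i j] by linarith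
  define m where "m = real CARD('d)"
  have m: "0 < m" by (simp add: m_def)
  define y where "y = (\<lambda>k. \<chi> i. sqrt m * \<sigma> k i)"
  have "(\<Sum>i\<in>UNIV. \<Sum>j\<in>UNIV. a $ i $ j * D2 i j u x) = second_order_op l y u x" if u: "smooth u" for u x
  proof -
    have y: "y k $ i * y k $ j = m * (\<sigma> k i * \<sigma> k j)" for k i j
      using m by (simp add: y_def)
    have "(\<Sum>k\<in>UNIV. D2_dir (y k) u x) / m = (\<Sum>k\<in>UNIV. \<Sum>i\<in>UNIV. \<Sum>j\<in>UNIV. \<sigma> k i * \<sigma> k j * D2 i j u x)"
      unfolding D2_dir_def y using m by (simp add: sum_distrib_left[symmetric] mult.assoc)
    also have "\<dots> = (\<Sum>i\<in>UNIV. \<Sum>j\<in>UNIV. \<Sum>k\<in>UNIV. \<sigma> k i * \<sigma> k j * D2 i j u x)"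
      by (subst sum.swap, rule sum.cong[OF refl], rule sum.swap)
    also have "\<dots> = (\<Sum>i\<in>UNIV. \<Sum>j\<in>UNIV. a $ i $ j * D2 i j u x) - D2_dir l u x"
      unfolding \<sigma> D2_dir_def by (simp add: distrib_right sum.distrib sum_distrib_right)
    finally show ?thesis
      by (simp add: second_order_op_def D2_dir_eq_pd[OF u, symmetric] m_def)
  qed
  then show ?thesis by (rule that)
qed

section \<open>Explicit solutions of the one-dimensional heat equation\<close>

lemma C0_infinity_shifted_sum:
  assumes "finite M" "\<And>m. m \<in> M \<Longrightarrow> C0_infinity (f m)"
  shows "C0_infinity (\<lambda>x. \<Sum>m\<in>M. c m * f m (x + y m))"
  unfolding C0_infinity_iff
proof
  show "smooth (\<lambda>x. \<Sum>m\<in>M. c m * f m (x + y m))"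
    using assms by (intro smooth_shifted_sum) (auto simp: C0_infinity_iff)
  have "\<forall>m\<in>M. \<exists>R. \<forall>x. R < norm x \<longrightarrow> f m x = 0"
    using assms by (auto simp: C0_infinity_iff)
  then obtain R where R: "\<And>m x. m \<in> M \<Longrightarrow> R m < norm x \<Longrightarrow> f m x = 0" by metis
  define R' where "R' = (\<Sum>m\<in>M. \<bar>R m\<bar> + norm (y m))"
  have "f m (x + y m) = 0" if "m \<in> M" "R' < norm x" for m x
  proof (rule R[OF \<open>m \<in> M\<close>])
    have "\<bar>R m\<bar> + norm (y m) \<le> R'"
      unfolding R'_def using assms(1) that(1) by (intro member_le_sum) auto
    then show "R m < norm (x + y m)"
      using norm_diff_ineq[of x "y m"] that(2) by linarith
  qed
  then have "\<forall>x. R' < norm x \<longrightarrow> (\<Sum>m\<in>M. c m * f m (x + y m)) = 0"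
    by (auto intro!: sum.neutral)
  then show "\<exists>R. \<forall>x. R < norm x \<longrightarrow> (\<Sum>m\<in>M. c m * f m (x + y m)) = 0" by blast
qed

lemma C0_infinity_sum:
  assumes "finite M" "\<And>m. m \<in> M \<Longrightarrow> C0_infinity (f m)"
  shows "C0_infinity (\<lambda>x. \<Sum>m\<in>M. c m * f m x)"
  using C0_infinity_shifted_sum[OF assms, where y = "\<lambda>_. 0"] by simp

lemma C0_infinity_add_shifted:
  assumes "C0_infinity f" "C0_infinity g"
  shows "C0_infinity (\<lambda>x. c * f (x + y) + d * g (x + z))"
  using C0_infinity_shifted_sum[of UNIV "\<lambda>b. if b then f else g" "\<lambda>b. if b then c else d" "\<lambda>b. if b then y else z"] assms
  by (simp add: UNIV_bool add.commute)

lemma C0_infinity_pd: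
  assumes "C0_infinity f"
  shows "C0_infinity (pd v f)"
proof -
  obtain R where f: "smooth f" and R: "\<And>x. R < norm x \<Longrightarrow> f x = 0"
    using assms unfolding C0_infinity_iff by blast
  show ?thesis
    unfolding C0_infinity_iff using smooth_pd[OF f] pd_eq_0_outside_ball[of R f] R by blast
qed

lemma C0_infinity_bounded:
  assumes "C0_infinity f"
  shows "\<exists>A. \<forall>x. \<bar>f x\<bar> \<le> A"
proof -
  obtain R where f: "smooth f" and R: "\<And>x. R < norm x \<Longrightarrow> f x = 0"
    using assms unfolding C0_infinity_iff by blast
  show ?thesis
    by (rule bounded_of_continuous_bounded_support[OF smooth_imp_continuous_on[OF f] R])
qed

lemma C0_infinity_holder_le:
  fixes f :: "'a::euclidean_space \<Rightarrow> real"
  assumes "C0_infinity f" "0 < \<alpha>" "\<alpha> < 1"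
  shows "\<exists>A. holder_le \<alpha> A f"
proof -
  interpret translation_invariant_seminorm "holder_le \<alpha> :: real \<Rightarrow> ('a \<Rightarrow> real) \<Rightarrow> bool"
    using assms by (intro translation_invariant_seminorm_holder)
  obtain A where "\<forall>s\<in>{0<..1::real}. holder_le \<alpha> A f"
    using uniform[OF uniform_C0_imp_Lip0[OF uniform_C0_const[OF assms(1)]]] by blast
  then show ?thesis by (meson greaterThanAtMost_iff order_refl zero_less_one)
qed

text \<open>A bound for all quantities in \<open>C2_holder_norm\<close> that is compatible with linear combinations.\<close>

definition C2_bound :: "real \<Rightarrow> real \<Rightarrow> ('a::euclidean_space \<Rightarrow> real) \<Rightarrow> bool" where
  "C2_bound \<alpha> A f \<longleftrightarrow> smooth f \<and> (\<forall>x. \<bar>f x\<bar> \<le> A) \<and> (\<forall>b\<in>Basis. \<forall>x. \<bar>pd b f x\<bar> \<le> A) \<and>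
     (\<forall>b\<in>Basis. \<forall>c\<in>Basis. (\<forall>x. \<bar>pd b (pd c f) x\<bar> \<le> A) \<and> holder_le \<alpha> A (pd b (pd c f)))"

lemma holder_le_mono: "holder_le \<alpha> c f \<Longrightarrow> c \<le> d \<Longrightarrow> holder_le \<alpha> d f"
  unfolding holder_le_def by (meson mult_right_mono order_trans powr_ge_zero)

lemma C0_infinity_C2_bound:
  fixes f :: "'a::euclidean_space \<Rightarrow> real"
  assumes f: "C0_infinity f" and \<alpha>: "0 < \<alpha>" "\<alpha> < 1"
  shows "\<exists>A. C2_bound \<alpha> A f"
proof -
  obtain A0 where A0: "\<And>x. \<bar>f x\<bar> \<le> A0"
    using C0_infinity_bounded[OF f] by blast
  obtain A1 where A1: "\<And>b x. \<bar>pd b f x\<bar> \<le> A1 b"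
    using C0_infinity_bounded[OF C0_infinity_pd[OF f]] by metis
  obtain A2 where A2: "\<And>b c x. \<bar>pd b (pd c f) x\<bar> \<le> A2 b c"
    using C0_infinity_bounded[OF C0_infinity_pd[OF C0_infinity_pd[OF f]]] by metis
  obtain A3 where A3: "\<And>b c. holder_le \<alpha> (A3 b c) (pd b (pd c f))"
    using C0_infinity_holder_le[OF C0_infinity_pd[OF C0_infinity_pd[OF f]] \<alpha>] by metis
  have nn: "0 \<le> A0" "0 \<le> A1 b" "0 \<le> A2 b c" "0 \<le> A3 b c" for b c
    using A0[of 0] A1[of b 0] A2[of b c 0] A3[of b c] by (auto simp: holder_le_def)
  define A where "A = A0 + (\<Sum>b\<in>Basis. A1 b) + (\<Sum>b\<in>Basis. \<Sum>c\<in>Basis. A2 b c + A3 b c)"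
  have le1: "A1 b \<le> (\<Sum>b\<in>Basis. A1 b)" if "b \<in> Basis" for b
    using that nn by (intro member_le_sum) auto
  have le2: "A2 b c + A3 b c \<le> (\<Sum>b\<in>Basis. \<Sum>c\<in>Basis. A2 b c + A3 b c)" if "b \<in> Basis" "c \<in> Basis" for b c
  proof -
    have "A2 b c + A3 b c \<le> (\<Sum>c\<in>Basis. A2 b c + A3 b c)"
      using that nn by (intro member_le_sum) auto
    also have "\<dots> \<le> (\<Sum>b\<in>Basis. \<Sum>c\<in>Basis. A2 b c + A3 b c)"
      using that nn by (intro member_le_sum[of b Basis "\<lambda>b. \<Sum>c\<in>Basis. A2 b c + A3 b c"] sum_nonneg add_nonneg_nonneg) auto
    finally show ?thesis .
  qed
  have s: "0 \<le> (\<Sum>b\<in>Basis. A1 b)" "0 \<le> (\<Sum>b\<in>Basis. \<Sum>c\<in>Basis. A2 b c + A3 b c)"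
    using nn by (auto intro!: sum_nonneg add_nonneg_nonneg)
  have AA: "A0 \<le> A" "b \<in> Basis \<Longrightarrow> A1 b \<le> A" "b \<in> Basis \<Longrightarrow> c \<in> Basis \<Longrightarrow> A2 b c \<le> A"
    "b \<in> Basis \<Longrightarrow> c \<in> Basis \<Longrightarrow> A3 b c \<le> A" for b c
    using le1[of b] le2[of b c] s nn(1) nn(2)[of b] nn(3,4)[of b c] by (auto simp: A_def)
  have "C2_bound \<alpha> A f"
    unfolding C2_bound_def
    using f order_trans[OF A0 AA(1)] order_trans[OF A1 AA(2)] order_trans[OF A2 AA(3)] holder_le_mono[OF A3 AA(4)]
    by (auto simp: C0_infinity_iff)
  then show ?thesis by blast
qed

lemma abs_linear_combination_le:
  fixes c :: "'m \<Rightarrow> real"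
  assumes "\<And>m. m \<in> M \<Longrightarrow> \<bar>c m\<bar> \<le> C" "\<And>m. m \<in> M \<Longrightarrow> \<bar>z m\<bar> \<le> A m"
  shows "\<bar>\<Sum>m\<in>M. c m * z m\<bar> \<le> (\<Sum>m\<in>M. C * A m)"
proof -
  have "\<bar>c m * z m\<bar> \<le> C * A m" if "m \<in> M" for m
    using assms[OF that] unfolding abs_mult by (intro mult_mono) auto
  then show ?thesis by (intro order_trans[OF sum_abs] sum_mono)
qed

lemma C2_bound_sum:
  fixes f :: "'m \<Rightarrow> 'a::euclidean_space \<Rightarrow> real"
  assumes f: "\<And>m. m \<in> M \<Longrightarrow> C2_bound \<alpha> (A m) (f m)" and c: "\<And>m. m \<in> M \<Longrightarrow> \<bar>c m\<bar> \<le> C"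
  shows "C2_bound \<alpha> (\<Sum>m\<in>M. C * A m) (\<lambda>x. \<Sum>m\<in>M. c m * f m x)"
proof -
  have sm: "smooth (f m)" if "m \<in> M" for m using f[OF that] by (simp add: C2_bound_def)
  have pd1: "pd b (\<lambda>x. \<Sum>m\<in>M. c m * f m x) = (\<lambda>x. \<Sum>m\<in>M. c m * pd b (f m) x)" for b
    using pd_shifted_sum[of M f b c "\<lambda>_. 0"] sm by simp
  have pd2: "pd b (\<lambda>x. \<Sum>m\<in>M. c m * pd b' (f m) x) = (\<lambda>x. \<Sum>m\<in>M. c m * pd b (pd b' (f m)) x)" for b b'
    using pd_shifted_sum[of M "\<lambda>m. pd b' (f m)" b c "\<lambda>_. 0", OF smooth_pd[OF sm]] by simp
  have A: "0 \<le> A m" if "m \<in> M" for m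
    using f[OF that] abs_ge_zero order_trans unfolding C2_bound_def by blast
  show ?thesis
    unfolding C2_bound_def pd1 pd2
  proof (intro conjI ballI allI)
    show "smooth (\<lambda>x. \<Sum>m\<in>M. c m * f m x)"
      using smooth_shifted_sum[of M f c "\<lambda>_. 0"] sm by simp
    show "\<bar>\<Sum>m\<in>M. c m * f m x\<bar> \<le> (\<Sum>m\<in>M. C * A m)" for x
      using f c by (intro abs_linear_combination_le) (auto simp: C2_bound_def)
    fix b :: 'a assume b: "b \<in> Basis"
    show "\<bar>\<Sum>m\<in>M. c m * pd b (f m) x\<bar> \<le> (\<Sum>m\<in>M. C * A m)" for x
      using f c b by (intro abs_linear_combination_le) (auto simp: C2_bound_def)
    fix b' :: 'a assume b': "b' \<in> Basis"
    show "\<bar>\<Sum>m\<in>M. c m * pd b (pd b' (f m)) x\<bar> \<le> (\<Sum>m\<in>M. C * A m)" for x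
      using f c b b' by (intro abs_linear_combination_le) (auto simp: C2_bound_def)
    show "holder_le \<alpha> (\<Sum>m\<in>M. C * A m) (\<lambda>x. \<Sum>m\<in>M. c m * pd b (pd b' (f m)) x)"
      unfolding holder_le_def
    proof (intro conjI allI)
      have "0 \<le> C * A m" if "m \<in> M" for m
        using A[OF that] c[OF that] by simp
      then show "0 \<le> (\<Sum>m\<in>M. C * A m)" by (intro sum_nonneg)
      fix x x'
      have "\<bar>\<Sum>m\<in>M. c m * (pd b (pd b' (f m)) x - pd b (pd b' (f m)) x')\<bar> \<le> (\<Sum>m\<in>M. C * (A m * dist x x' powr \<alpha>))"
        using f c b b' by (intro abs_linear_combination_le) (auto simp: C2_bound_def holder_le_def)
      then show "\<bar>(\<Sum>m\<in>M. c m * pd b (pd b' (f m)) x) - (\<Sum>m\<in>M. c m * pd b (pd b' (f m)) x')\<bar>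
          \<le> (\<Sum>m\<in>M. C * A m) * dist x x' powr \<alpha>"
        by (simp add: sum_subtractf right_diff_distrib sum_distrib_right mult.assoc)
    qed
  qed
qed

lemma L2_set_le_card:
  assumes "finite S" "\<And>i. i \<in> S \<Longrightarrow> \<bar>f i\<bar> \<le> A"
  shows "L2_set f S \<le> real (card S) * A"
proof -
  have "L2_set f S \<le> (\<Sum>i\<in>S. \<bar>f i\<bar>)" by (rule L2_set_le_sum_abs)
  also have "\<dots> \<le> (\<Sum>i\<in>S. A)" using assms by (intro sum_mono)
  finally show ?thesis by simp
qed

lemma C2_holder_norm_le:
  fixes f :: "'a::euclidean_space \<Rightarrow> real"
  assumes "C2_bound \<alpha> A f"
  shows "C2_holder_norm \<alpha> f \<le> ennreal (A + real DIM('a) * A + real (DIM('a) * DIM('a)) * A) + ennreal (real (DIM('a) * DIM('a)) * A)"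
  unfolding C2_holder_norm_def
proof (intro add_mono SUP_least)
  fix x :: 'a
  show "ennreal (\<bar>f x\<bar> + L2_set (\<lambda>b. pd b f x) Basis + L2_set (\<lambda>(b, c). pd b (pd c f) x) (Basis \<times> Basis))
    \<le> ennreal (A + real DIM('a) * A + real (DIM('a) * DIM('a)) * A)"
    using assms unfolding C2_bound_def card_cartesian_product[symmetric]
    by (intro ennreal_leI add_mono L2_set_le_card) auto
next
  fix z :: "'a \<times> 'a" assume z: "z \<in> {(x, y). x \<noteq> y}"
  obtain x y where xy: "z = (x, y)" "x \<noteq> y" using z by auto
  have "L2_set (\<lambda>(b, c). pd b (pd c f) x - pd b (pd c f) y) (Basis \<times> Basis)
      \<le> real (card ((Basis :: 'a set) \<times> (Basis :: 'a set))) * (A * dist x y powr \<alpha>)"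
    using assms unfolding C2_bound_def holder_le_def by (intro L2_set_le_card) auto
  then have "L2_set (\<lambda>(b, c). pd b (pd c f) x - pd b (pd c f) y) (Basis \<times> Basis) / dist x y powr \<alpha>
      \<le> real (DIM('a) * DIM('a)) * A"
    using xy(2) by (simp add: divide_le_eq card_cartesian_product)
  then show "(case z of (x, y) \<Rightarrow> ennreal (L2_set (\<lambda>(b, c). pd b (pd c f) x - pd b (pd c f) y) (Basis \<times> Basis) / dist x y powr \<alpha>))
    \<le> ennreal (real (DIM('a) * DIM('a)) * A)"
    unfolding xy(1) by (auto intro: ennreal_leI)
qed

lemma C2_bound_imp_C2_holder:
  assumes "C2_bound \<alpha> A f"
  shows "C2_holder \<alpha> f"
  unfolding C2_holder_def
proof
  show "C_k 2 f" using assms unfolding C2_bound_def smooth_def by blast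
  show "C2_holder_norm \<alpha> f < \<infinity>"
    by (rule le_less_trans[OF C2_holder_norm_le[OF assms]]) simp
qed

lemma funpow_pd_shifted_sum:
  assumes "\<And>m. m \<in> M \<Longrightarrow> smooth (f m)"
  shows "(pd v ^^ k) (\<lambda>x. \<Sum>m\<in>M. c m * f m x) = (\<lambda>x. \<Sum>m\<in>M. c m * (pd v ^^ k) (f m) x)"
proof (induction k)
  case (Suc k)
  have "smooth ((pd v ^^ k) (f m))" if "m \<in> M" for m
    using assms[OF that] by (induction k) (auto intro: smooth_pd)
  then show ?case
    using pd_shifted_sum[of M "\<lambda>m. (pd v ^^ k) (f m)" v c "\<lambda>_. 0"] by (simp add: Suc.IH)
qed simp

lemma Bc_C0_infinity_separated:
  fixes \<psi> :: "'m \<Rightarrow> real \<Rightarrow> real"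
  assumes M: "finite M" and \<psi>: "\<And>m. m \<in> M \<Longrightarrow> C0_infinity (\<psi> m)"
    and c_meas: "\<And>m. m \<in> M \<Longrightarrow> c m \<in> borel_measurable borel"
    and c_bound: "\<And>m t. m \<in> M \<Longrightarrow> t \<in> {0<..<T} \<Longrightarrow> \<bar>c m t\<bar> \<le> C"
  shows "Bc_C0_infinity T (\<lambda>t x. \<Sum>m\<in>M. c m t * \<psi> m x)"
proof -
  have sm: "smooth (\<psi> m)" if "m \<in> M" for m using \<psi>[OF that] by (simp add: C0_infinity_iff)
  have C0k: "C0_infinity ((pd 1 ^^ k) (\<psi> m))" if "m \<in> M" for m k
    using \<psi>[OF that] by (induction k) (auto intro: C0_infinity_pd)
  then have "\<forall>m k. \<exists>A. m \<in> M \<longrightarrow> (\<forall>x. \<bar>(pd 1 ^^ k) (\<psi> m) x\<bar> \<le> A)"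
    using C0_infinity_bounded by blast
  then obtain A where A: "\<And>m k x. m \<in> M \<Longrightarrow> \<bar>(pd 1 ^^ k) (\<psi> m) x\<bar> \<le> A m k" by metis
  have "\<forall>m\<in>M. \<exists>R. \<forall>x. R < norm x \<longrightarrow> \<psi> m x = 0"
    using \<psi> by (auto simp: C0_infinity_iff)
  then obtain R where R: "\<And>m x. m \<in> M \<Longrightarrow> R m < norm x \<Longrightarrow> \<psi> m x = 0" by metis
  have deriv_k: "(deriv ^^ k) (\<lambda>x. \<Sum>m\<in>M. c m t * \<psi> m x) = (\<lambda>x. \<Sum>m\<in>M. c m t * (pd 1 ^^ k) (\<psi> m) x)" for k t
    using funpow_pd_shifted_sum[of M \<psi> k 1 "\<lambda>m. c m t"] sm by (simp add: pd_real[abs_def, symmetric])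
  show ?thesis
    unfolding Bc_C0_infinity_def
  proof (intro conjI)
    have "(\<lambda>(t, x). \<Sum>m\<in>M. c m t * \<psi> m x) \<in> borel_measurable (borel \<Otimes>\<^sub>M borel)"
      using c_meas smooth_imp_borel_measurable[OF sm] by (auto intro!: borel_measurable_sum borel_measurable_times simp: case_prod_beta)
    then show "(\<lambda>(t, x). \<Sum>m\<in>M. c m t * \<psi> m x) \<in> borel_measurable (restrict_space borel ({0<..<T} \<times> UNIV))"
      by (intro measurable_restrict_space1) (simp add: borel_prod)
    show "\<exists>B. \<forall>t\<in>{0<..<T}. \<forall>x. \<bar>\<Sum>m\<in>M. c m t * \<psi> m x\<bar> \<le> B"
      using A[of _ 0] by (intro exI[of _ "\<Sum>m\<in>M. C * A m 0"] ballI allI abs_linear_combination_le c_bound) auto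
    show "\<forall>t\<in>{0<..<T}. C0_infinity (\<lambda>x. \<Sum>m\<in>M. c m t * \<psi> m x)"
      by (intro ballI C0_infinity_sum M \<psi>)
    show "\<forall>n. (SUP t\<in>{0<..<T}. Cn_norm n (\<lambda>x. \<Sum>m\<in>M. c m t * \<psi> m x)) < \<infinity>"
    proof
      fix n
      have "(SUP t\<in>{0<..<T}. Cn_norm n (\<lambda>x. \<Sum>m\<in>M. c m t * \<psi> m x)) \<le> (\<Sum>k\<le>n. ennreal (\<Sum>m\<in>M. C * A m k))"
        unfolding Cn_norm_def deriv_k
        by (intro SUP_least sum_mono ennreal_leI abs_linear_combination_le c_bound A)
      also have "\<dots> < \<infinity>" by simp
      finally show "(SUP t\<in>{0<..<T}. Cn_norm n (\<lambda>x. \<Sum>m\<in>M. c m t * \<psi> m x)) < \<infinity>" .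
    qed
    define R' where "R' = (\<Sum>m\<in>M. \<bar>R m\<bar>)"
    have "(\<Sum>m\<in>M. c m t * \<psi> m x) = 0" if "R' < norm x" for t x
    proof (intro sum.neutral ballI)
      fix m assume m: "m \<in> M"
      have "\<bar>R m\<bar> \<le> R'" unfolding R'_def using M m by (intro member_le_sum) auto
      then show "c m t * \<psi> m x = 0" using R[OF m, of x] that by simp
    qed
    then have "{x. (\<Sum>m\<in>M. c m t * \<psi> m x) \<noteq> 0} \<subseteq> cball 0 R'" for t
      by (auto simp: not_less[symmetric])
    then have "closure {x. (\<Sum>m\<in>M. c m t * \<psi> m x) \<noteq> 0} \<subseteq> cball 0 R'" for t
      by (intro closure_minimal) auto
    also have "cball 0 R' \<subseteq> ball 0 (R' + 1)" by auto
    finally show "\<exists>b R. \<forall>t\<in>{0<..<T}. closure {x. (\<Sum>m\<in>M. c m t * \<psi> m x) \<noteq> 0} \<subseteq> ball b R" by blast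
  qed
qed

text \<open>A combination \<open>\<Sum> c\<^sub>m(t) \<phi>\<^sub>m(x)\<close> with absolutely continuous coefficients vanishing at time \<open>0\<close> solves the heat
  equation with the source that is read off from the equation.\<close>

lemma heat_solution_separated:
  fixes \<phi> :: "'m \<Rightarrow> real \<Rightarrow> real"
  assumes M: "finite M" and \<phi>: "\<And>m. m \<in> M \<Longrightarrow> C0_infinity (\<phi> m)" and \<alpha>: "0 < \<alpha>" "\<alpha> < 1"
    and c_cont: "\<And>m. m \<in> M \<Longrightarrow> continuous_on UNIV (c m)"
    and c_bound: "\<And>m t. m \<in> M \<Longrightarrow> t \<in> {0..T} \<Longrightarrow> \<bar>c m t\<bar> \<le> C"
    and c'_int: "\<And>m t. m \<in> M \<Longrightarrow> t \<in> {0..T} \<Longrightarrow> set_integrable lborel {0<..<t} (c' m)"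
    and c_eq: "\<And>m t. m \<in> M \<Longrightarrow> t \<in> {0..T} \<Longrightarrow> (LINT s:{0<..<t}|lborel. c' m s) = c m t"
  shows "heat_solution \<alpha> T (\<lambda>t x. (\<Sum>m\<in>M. c' m t * \<phi> m x) - (\<Sum>m\<in>M. c m t * deriv (deriv (\<phi> m)) x))
           (\<lambda>t x. \<Sum>m\<in>M. c m t * \<phi> m x)"
proof -
  have sm: "smooth (\<phi> m)" if "m \<in> M" for m using \<phi>[OF that] by (simp add: C0_infinity_iff)
  obtain A where A: "\<And>m. m \<in> M \<Longrightarrow> C2_bound \<alpha> (A m) (\<phi> m)"
    using C0_infinity_C2_bound[OF \<phi> \<alpha>] by metis
  have C2: "C2_bound \<alpha> (\<Sum>m\<in>M. C * A m) (\<lambda>x. \<Sum>m\<in>M. c m t * \<phi> m x)" if "t \<in> {0..T}" for t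
    using that by (intro C2_bound_sum A c_bound)
  have d2: "deriv (deriv (\<lambda>x. \<Sum>m\<in>M. c m t * \<phi> m x)) x = (\<Sum>m\<in>M. c m t * deriv (deriv (\<phi> m)) x)" for t x
    using funpow_pd_shifted_sum[of M \<phi> 2 1 "\<lambda>m. c m t"] sm by (simp add: pd_real numeral_2_eq_2)
  show ?thesis
    unfolding heat_solution_def
  proof (intro conjI ballI allI)
    show "continuous_on ({0..T} \<times> UNIV) (\<lambda>(t, x). \<Sum>m\<in>M. c m t * \<phi> m x)"
      unfolding case_prod_beta
      by (intro continuous_intros continuous_on_compose2[OF c_cont] continuous_on_compose2[OF smooth_imp_continuous_on[OF sm, of _ UNIV]]) auto
    show "C2_holder \<alpha> (\<lambda>x. \<Sum>m\<in>M. c m t * \<phi> m x)" if "t \<in> {0..T}" for t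
      using C2[OF that] by (rule C2_bound_imp_C2_holder)
    define Z where "Z = (\<Sum>m\<in>M. C * A m)"
    have "(SUP t\<in>{0..T}. C2_holder_norm \<alpha> (\<lambda>x. \<Sum>m\<in>M. c m t * \<phi> m x)) \<le>
      ennreal (Z + real DIM(real) * Z + real (DIM(real) * DIM(real)) * Z) + ennreal (real (DIM(real) * DIM(real)) * Z)"
      unfolding Z_def by (intro SUP_least C2_holder_norm_le C2)
    also have "\<dots> < \<infinity>" by simp
    finally show "(SUP t\<in>{0..T}. C2_holder_norm \<alpha> (\<lambda>x. \<Sum>m\<in>M. c m t * \<phi> m x)) < \<infinity>" .
    fix t x assume t: "t \<in> {0..T}"
    have int: "integrable lborel (\<lambda>s. indicator {0<..<t} s *\<^sub>R c' m s)" if "m \<in> M" for m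
      using c'_int[OF that t] by (simp add: set_integrable_def)
    have eq: "indicator {0<..<t} s *\<^sub>R (deriv (deriv (\<lambda>x. \<Sum>m\<in>M. c m s * \<phi> m x)) x
       + ((\<Sum>m\<in>M. c' m s * \<phi> m x) - (\<Sum>m\<in>M. c m s * deriv (deriv (\<phi> m)) x)))
       = (\<Sum>m\<in>M. (indicator {0<..<t} s *\<^sub>R c' m s) * \<phi> m x)" for s
      unfolding d2 by (simp add: sum_distrib_left mult.assoc)
    show "set_integrable lborel {0<..<t} (\<lambda>s. deriv (deriv (\<lambda>x. \<Sum>m\<in>M. c m s * \<phi> m x)) x
       + ((\<Sum>m\<in>M. c' m s * \<phi> m x) - (\<Sum>m\<in>M. c m s * deriv (deriv (\<phi> m)) x)))"
      unfolding set_integrable_def eq using int by (intro Bochner_Integration.integrable_sum integrable_mult_left)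
    have "(LINT s:{0<..<t}|lborel. deriv (deriv (\<lambda>x. \<Sum>m\<in>M. c m s * \<phi> m x)) x
       + ((\<Sum>m\<in>M. c' m s * \<phi> m x) - (\<Sum>m\<in>M. c m s * deriv (deriv (\<phi> m)) x)))
       = (\<Sum>m\<in>M. (LINT s|lborel. (indicator {0<..<t} s *\<^sub>R c' m s) * \<phi> m x))"
      unfolding set_lebesgue_integral_def eq using int
      by (intro Bochner_Integration.integral_sum integrable_mult_left)
    also have "\<dots> = (\<Sum>m\<in>M. c m t * \<phi> m x)"
      using c_eq[OF _ t] unfolding set_lebesgue_integral_def by (intro sum.cong refl) simp
    finally show "(\<Sum>m\<in>M. c m t * \<phi> m x) = (LINT s:{0<..<t}|lborel. deriv (deriv (\<lambda>x. \<Sum>m\<in>M. c m s * \<phi> m x)) x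
       + ((\<Sum>m\<in>M. c' m s * \<phi> m x) - (\<Sum>m\<in>M. c m s * deriv (deriv (\<phi> m)) x)))" by simp
  qed
qed

text \<open>If \<open>w\<^sub>0 = 0\<close>, the linear interpolation of \<open>w\<^sub>0, w\<^sub>1, ...\<close> at times \<open>0, \<tau>, 2\<tau>, ...\<close> is the sum of the increments
  \<open>w\<^sub>k\<^sub>+\<^sub>1 - w\<^sub>k\<close> weighted with these functions. The derivative is taken from the left at grid points:
  the Hoelder estimate involves the supremum over all times, so the source has to be close to
  the intended one at the grid points as well.\<close>

definition ramp :: "real \<Rightarrow> nat \<Rightarrow> real \<Rightarrow> real" where
  "ramp \<tau> k t = max 0 (min 1 (t / \<tau> - real k))"

definition ramp' :: "real \<Rightarrow> nat \<Rightarrow> real \<Rightarrow> real" where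
  "ramp' \<tau> k t = indicator {real k * \<tau><..real (Suc k) * \<tau>} t / \<tau>"

lemma ramp_integral:
  assumes "0 < \<tau>" "0 \<le> t"
  shows "set_integrable lborel {0<..<t} (ramp' \<tau> k)"
    and "(LINT s:{0<..<t}|lborel. ramp' \<tau> k s) = ramp \<tau> k t"
proof -
  let ?I = "{real k * \<tau><..real (Suc k) * \<tau>}"
  have eq: "indicator {0<..<t} s *\<^sub>R ramp' \<tau> k s = indicator ({0<..<t} \<inter> ?I) s / \<tau>" for s
    by (simp add: ramp'_def indicator_inter_arith)
  have k0: "0 \<le> real k * \<tau>" using assms by simp
  have fin: "emeasure lborel ({0<..<t} \<inter> ?I) < \<infinity>"
    by (rule le_less_trans[OF emeasure_mono[of _ "{0<..<t}"]]) (use assms in auto)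
  show "set_integrable lborel {0<..<t} (ramp' \<tau> k)"
    unfolding set_integrable_def eq using fin by (intro integrable_divide_zero integrable_real_indicator) auto
  have "(LINT s:{0<..<t}|lborel. ramp' \<tau> k s) = measure lborel ({0<..<t} \<inter> ?I) / \<tau>"
    unfolding set_lebesgue_integral_def eq by simp
  also have "\<dots> = ramp \<tau> k t"
  proof (cases "t \<le> real (Suc k) * \<tau>")
    case True
    have "{0<..<t} \<inter> ?I = {real k * \<tau><..<t}" using k0 True by auto
    then show ?thesis
      using assms True by (cases "t \<le> real k * \<tau>") (auto simp: ramp_def field_simps max_def min_def)
  next
    case False
    have "{0<..<t} \<inter> ?I = ?I" using k0 False by auto
    then show ?thesis
      using assms False by (auto simp: ramp_def field_simps max_def min_def)
  qed
  finally show "(LINT s:{0<..<t}|lborel. ramp' \<tau> k s) = ramp \<tau> k t" .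
qed

lemma C0_infinity_restrict_line:
  assumes "C0_infinity f" "norm l = 1"
  shows "C0_infinity (\<lambda>\<mu>::real. f (x + \<mu> *\<^sub>R l))"
proof -
  obtain R where f: "smooth f" and R: "\<And>x. R < norm x \<Longrightarrow> f x = 0"
    using assms(1) unfolding C0_infinity_iff by blast
  have "f (x + \<mu> *\<^sub>R l) = 0" if "R + norm x < norm \<mu>" for \<mu>
  proof (rule R)
    have "norm (\<mu> *\<^sub>R l) - norm x \<le> norm (x + \<mu> *\<^sub>R l)"
      using norm_diff_ineq[of "\<mu> *\<^sub>R l" x] by (simp add: add.commute)
    then show "R < norm (x + \<mu> *\<^sub>R l)" using that assms(2) by simp
  qed
  then show ?thesis
    unfolding C0_infinity_iff using smooth_restrict_line[OF f] by blast
qed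

definition interpolant :: "real \<Rightarrow> nat \<Rightarrow> (nat \<Rightarrow> 'a \<Rightarrow> real) \<Rightarrow> real \<Rightarrow> 'a \<Rightarrow> real" where
  "interpolant \<tau> K w t x = (\<Sum>k<K. ramp \<tau> k t * (w (Suc k) x - w k x))"

definition interpolant_source :: "'a::euclidean_space \<Rightarrow> real \<Rightarrow> nat \<Rightarrow> (nat \<Rightarrow> 'a \<Rightarrow> real) \<Rightarrow> real \<Rightarrow> 'a \<Rightarrow> real" where
  "interpolant_source l \<tau> K w t x = (\<Sum>k<K. ramp' \<tau> k t * (w (Suc k) x - w k x))
     - (\<Sum>k<K. ramp \<tau> k t * pd l (pd l (\<lambda>x. w (Suc k) x - w k x)) x)"

lemma C0_infinity_increment: "(\<And>k. C0_infinity (w k)) \<Longrightarrow> C0_infinity (\<lambda>x. w (Suc k) x - w k x)"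
  using C0_infinity_add_shifted[of "w (Suc k)" "w k" 1 0 "-1" 0] by simp

lemma ramp_bounds: "0 \<le> ramp \<tau> k t" "ramp \<tau> k t \<le> 1"
  by (auto simp: ramp_def)

lemma continuous_on_ramp: "continuous_on UNIV (ramp \<tau> k)"
  unfolding ramp_def divide_inverse by (intro continuous_intros)

lemma deriv2_restrict_line:
  assumes "smooth f"
  shows "deriv (deriv (\<lambda>\<mu>. f (x + \<mu> *\<^sub>R l))) = (\<lambda>\<mu>. pd l (pd l f) (x + \<mu> *\<^sub>R l))"
  using deriv_restrict_line[OF assms] deriv_restrict_line[OF smooth_pd[OF assms]] by simp

lemma interpolant_heat_solution:
  assumes w: "\<And>k. C0_infinity (w k)" and l: "norm l = 1" and \<alpha>: "0 < \<alpha>" "\<alpha> < 1" and \<tau>: "0 < \<tau>"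
  shows "Bc_C0_infinity T (\<lambda>t \<mu>. interpolant_source l \<tau> K w t (x + \<mu> *\<^sub>R l))"
    and "heat_solution \<alpha> T (\<lambda>t \<mu>. interpolant_source l \<tau> K w t (x + \<mu> *\<^sub>R l)) (\<lambda>t \<mu>. interpolant \<tau> K w t (x + \<mu> *\<^sub>R l))"
proof -
  define \<phi> where "\<phi> = (\<lambda>k \<mu>. w (Suc k) (x + \<mu> *\<^sub>R l) - w k (x + \<mu> *\<^sub>R l))"
  have \<phi>: "C0_infinity (\<phi> k)" for k
    unfolding \<phi>_def by (rule C0_infinity_restrict_line[OF C0_infinity_increment[of w, OF w] l])
  have \<phi>2: "deriv (deriv (\<phi> k)) = (\<lambda>\<mu>. pd l (pd l (\<lambda>x. w (Suc k) x - w k x)) (x + \<mu> *\<^sub>R l))" for k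
    using C0_infinity_increment[of w k, OF w] deriv2_restrict_line[of "\<lambda>x. w (Suc k) x - w k x" x l]
    unfolding \<phi>_def C0_infinity_iff by blast
  have src: "(\<lambda>t \<mu>. interpolant_source l \<tau> K w t (x + \<mu> *\<^sub>R l)) =
    (\<lambda>t \<mu>. (\<Sum>k<K. ramp' \<tau> k t * \<phi> k \<mu>) - (\<Sum>k<K. ramp \<tau> k t * deriv (deriv (\<phi> k)) \<mu>))"
    unfolding \<phi>2 by (simp add: interpolant_source_def \<phi>_def)
  have int: "(\<lambda>t \<mu>. interpolant \<tau> K w t (x + \<mu> *\<^sub>R l)) = (\<lambda>t \<mu>. \<Sum>k<K. ramp \<tau> k t * \<phi> k \<mu>)"
    by (simp add: interpolant_def \<phi>_def)
  show "heat_solution \<alpha> T (\<lambda>t \<mu>. interpolant_source l \<tau> K w t (x + \<mu> *\<^sub>R l)) (\<lambda>t \<mu>. interpolant \<tau> K w t (x + \<mu> *\<^sub>R l))"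
    unfolding src int
    using ramp_integral[OF \<tau>] ramp_bounds
    by (intro heat_solution_separated[where C = 1] \<phi> \<alpha> continuous_on_ramp) auto
  \<comment> \<open>the source as a single separated sum, over two copies of the index set\<close>
  define d where "d = (\<lambda>i. case i of Inl k \<Rightarrow> ramp' \<tau> k | Inr k \<Rightarrow> (\<lambda>t. - ramp \<tau> k t))"
  define \<psi> where "\<psi> = (\<lambda>i. case i of Inl k \<Rightarrow> \<phi> k | Inr k \<Rightarrow> deriv (deriv (\<phi> k)))"
  have src2: "(\<lambda>t \<mu>. interpolant_source l \<tau> K w t (x + \<mu> *\<^sub>R l)) =
    (\<lambda>t \<mu>. \<Sum>i\<in>{..<K} <+> {..<K}. d i t * \<psi> i \<mu>)"
    unfolding src by (simp add: sum.Plus d_def \<psi>_def sum_negf)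
  show "Bc_C0_infinity T (\<lambda>t \<mu>. interpolant_source l \<tau> K w t (x + \<mu> *\<^sub>R l))"
    unfolding src2
  proof (rule Bc_C0_infinity_separated[where C = "max 1 (1 / \<tau>)"])
    fix m assume "m \<in> {..<K} <+> {..<K}"
    show "C0_infinity (\<psi> m)"
      using \<phi> C0_infinity_pd[OF C0_infinity_pd[OF \<phi>], of 1 1] by (auto simp: \<psi>_def pd_real split: sum.split)
    show "d m \<in> borel_measurable borel"
      unfolding d_def ramp'_def
      using borel_measurable_continuous_onI[OF continuous_on_ramp[of \<tau>]] by (auto split: sum.split)
    show "\<bar>d m t\<bar> \<le> max 1 (1 / \<tau>)" for t
      using ramp_bounds[of \<tau> _ t] \<tau> by (auto simp: d_def ramp'_def indicator_def le_max_iff_disj split: sum.split)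
  qed simp
qed

lemma ramp_on_step:
  assumes "0 < \<tau>" "real k * \<tau> < t" "t \<le> real (Suc k) * \<tau>"
  shows "i < k \<Longrightarrow> ramp \<tau> i t = 1" "k < i \<Longrightarrow> ramp \<tau> i t = 0"
    "i \<noteq> k \<Longrightarrow> ramp' \<tau> i t = 0" "ramp' \<tau> k t = 1 / \<tau>"
proof -
  have 1: "real k < t / \<tau>" "t / \<tau> \<le> real (Suc k)" using assms by (auto simp: field_simps)
  show "i < k \<Longrightarrow> ramp \<tau> i t = 1" "k < i \<Longrightarrow> ramp \<tau> i t = 0"
    using 1 by (auto simp: ramp_def)
  have "real i * \<tau> < t \<and> t \<le> real (Suc i) * \<tau> \<longleftrightarrow> real i < t / \<tau> \<and> t / \<tau> \<le> real (Suc i)"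
    using assms(1) by (simp add: field_simps)
  then show "i \<noteq> k \<Longrightarrow> ramp' \<tau> i t = 0"
    using 1 by (auto simp: ramp'_def indicator_def)
  show "ramp' \<tau> k t = 1 / \<tau>" using assms by (simp add: ramp'_def)
qed

lemma sum_step_split:
  fixes h :: "nat \<Rightarrow> real"
  assumes "k < K" "\<And>i. k < i \<Longrightarrow> h i = 0"
  shows "(\<Sum>i<K. h i) = (\<Sum>i<k. h i) + h k"
proof -
  have "(\<Sum>i<K. h i) = (\<Sum>i<Suc k. h i)"
    using assms by (intro sum.mono_neutral_right) auto
  then show ?thesis by simp
qed

lemma interpolant_on_step:
  assumes \<tau>: "0 < \<tau>" "real k * \<tau> < t" "t \<le> real (Suc k) * \<tau>" and k: "k < K" and w0: "w 0 = (\<lambda>_. 0)"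
  shows "interpolant \<tau> K w t x = w k x + ramp \<tau> k t * (w (Suc k) x - w k x)"
proof -
  have "interpolant \<tau> K w t x = (\<Sum>i<k. ramp \<tau> i t * (w (Suc i) x - w i x)) + ramp \<tau> k t * (w (Suc k) x - w k x)"
    unfolding interpolant_def using ramp_on_step[OF \<tau>] by (intro sum_step_split k) auto
  also have "(\<Sum>i<k. ramp \<tau> i t * (w (Suc i) x - w i x)) = (\<Sum>i<k. w (Suc i) x - w i x)"
    using ramp_on_step[OF \<tau>] by (intro sum.cong) auto
  finally show ?thesis using sum_lessThan_telescope[of "\<lambda>i. w i x" k] w0 by simp
qed

lemma interpolant_source_on_step:
  fixes w :: "nat \<Rightarrow> 'a::euclidean_space \<Rightarrow> real"
  assumes \<tau>: "0 < \<tau>" "real k * \<tau> < t" "t \<le> real (Suc k) * \<tau>" and k: "k < K" and w0: "w 0 = (\<lambda>_. 0)"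
    and sm: "\<And>k. smooth (w k)"
  shows "interpolant_source l \<tau> K w t x = (w (Suc k) x - w k x) / \<tau> - pd l (pd l (w k)) x
    - ramp \<tau> k t * pd l (pd l (\<lambda>x. w (Suc k) x - w k x)) x"
proof -
  have pd: "pd l (pd l (\<lambda>x. w (Suc i) x - w i x)) = (\<lambda>x. pd l (pd l (w (Suc i))) x - pd l (pd l (w i)) x)" for i
    by (simp add: pd_diff sm smooth_pd)
  have "(\<Sum>i<K. ramp' \<tau> i t * (w (Suc i) x - w i x)) = (\<Sum>i<k. ramp' \<tau> i t * (w (Suc i) x - w i x)) + ramp' \<tau> k t * (w (Suc k) x - w k x)"
    using ramp_on_step[OF \<tau>] by (intro sum_step_split k) auto
  also have "\<dots> = (w (Suc k) x - w k x) / \<tau>"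
    using ramp_on_step[OF \<tau>] by simp
  finally have 1: "(\<Sum>i<K. ramp' \<tau> i t * (w (Suc i) x - w i x)) = (w (Suc k) x - w k x) / \<tau>" .
  let ?D = "\<lambda>i. pd l (pd l (\<lambda>x. w (Suc i) x - w i x)) x"
  have "(\<Sum>i<K. ramp \<tau> i t * ?D i) = (\<Sum>i<k. ramp \<tau> i t * ?D i) + ramp \<tau> k t * ?D k"
    using ramp_on_step[OF \<tau>] by (intro sum_step_split k) auto
  also have "(\<Sum>i<k. ramp \<tau> i t * ?D i) = (\<Sum>i<k. pd l (pd l (w (Suc i))) x - pd l (pd l (w i)) x)"
    using ramp_on_step[OF \<tau>] by (intro sum.cong) (auto simp: pd)
  also have "\<dots> = pd l (pd l (w k)) x - pd l (pd l (w 0)) x"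
    by (rule sum_lessThan_telescope)
  also have "pd l (pd l (w 0)) x = 0"
  proof -
    have z: "pd l (\<lambda>_::'a. 0::real) = (\<lambda>_. 0)" by (rule ext) (simp add: pd_def)
    show ?thesis unfolding w0 z by simp
  qed
  finally show ?thesis unfolding interpolant_source_def 1 by simp
qed

lemma slab_measurable: "{x::'a::euclidean_space. 0 \<le> x \<bullet> l \<and> x \<bullet> l < 1} \<in> sets borel"
proof -
  have "{x. 0 \<le> x \<bullet> l \<and> x \<bullet> l < 1} = {x. 0 \<le> x \<bullet> l} \<inter> {x. x \<bullet> l < 1}" by auto
  then show ?thesis
    by (auto intro!: sets.Int borel_closed borel_open closed_Collect_le open_Collect_less continuous_intros)
qed

section \<open>Integration over parallel lines\<close>

text \<open>Every line parallel to \<open>l\<close> meets the slab in a segment of unit length. Integrating the integrals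
  along lines over base points in the slab thus recovers the integral over the whole space, without
  rotating coordinates.\<close>

lemma nn_integral_slab:
  fixes G :: "'a::euclidean_space \<Rightarrow> ennreal"
  assumes G[measurable]: "G \<in> borel_measurable borel" and l: "norm l = 1"
  shows "(\<integral>\<^sup>+x. indicator {x. 0 \<le> x \<bullet> l \<and> x \<bullet> l < 1} x * (\<integral>\<^sup>+\<mu>. G (x + \<mu> *\<^sub>R l) \<partial>lborel) \<partial>lborel)
    = (\<integral>\<^sup>+x. G x \<partial>lborel)"
proof -
  let ?S = "{x::'a. 0 \<le> x \<bullet> l \<and> x \<bullet> l < 1}"
  note [measurable] = slab_measurable[of l]
  have [measurable]: "(\<lambda>(x, \<mu>). G (x + \<mu> *\<^sub>R l)) \<in> borel_measurable (borel \<Otimes>\<^sub>M borel)"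
    by measurable
  have [measurable]: "(\<lambda>(x, \<mu>). indicator ?S (x - \<mu> *\<^sub>R l) :: ennreal) \<in> borel_measurable (borel \<Otimes>\<^sub>M borel)"
    by measurable
  have "(\<integral>\<^sup>+x. indicator ?S x * (\<integral>\<^sup>+\<mu>. G (x + \<mu> *\<^sub>R l) \<partial>lborel) \<partial>lborel)
      = (\<integral>\<^sup>+x. (\<integral>\<^sup>+\<mu>. indicator ?S x * G (x + \<mu> *\<^sub>R l) \<partial>lborel) \<partial>lborel)"
    by (intro nn_integral_cong nn_integral_cmult[symmetric]) measurable
  also have "\<dots> = (\<integral>\<^sup>+\<mu>. (\<integral>\<^sup>+x. indicator ?S x * G (x + \<mu> *\<^sub>R l) \<partial>lborel) \<partial>lborel)"
    by (rule lborel_pair.Fubini'[symmetric]) measurable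
  also have "\<dots> = (\<integral>\<^sup>+\<mu>. (\<integral>\<^sup>+x. indicator ?S (x - \<mu> *\<^sub>R l) * G x \<partial>lborel) \<partial>lborel)"
  proof (rule nn_integral_cong)
    fix \<mu> :: real
    show "(\<integral>\<^sup>+x. indicator ?S x * G (x + \<mu> *\<^sub>R l) \<partial>lborel) = (\<integral>\<^sup>+x. indicator ?S (x - \<mu> *\<^sub>R l) * G x \<partial>lborel)"
      using nn_integral_lborel_shift[of "\<lambda>x. indicator ?S (x - \<mu> *\<^sub>R l) * G x" "\<mu> *\<^sub>R l"] by simp
  qed
  also have "\<dots> = (\<integral>\<^sup>+x. (\<integral>\<^sup>+\<mu>. indicator ?S (x - \<mu> *\<^sub>R l) * G x \<partial>lborel) \<partial>lborel)"
    by (rule lborel_pair.Fubini') measurable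
  also have "\<dots> = (\<integral>\<^sup>+x. G x \<partial>lborel)"
  proof (rule nn_integral_cong)
    fix x :: 'a
    have ll: "l \<bullet> l = 1" using l by (simp add: dot_square_norm)
    have "indicator ?S (x - \<mu> *\<^sub>R l) * G x = G x * indicator {x \<bullet> l - 1<..x \<bullet> l} \<mu>" for \<mu>
      by (auto simp: indicator_def inner_diff_left ll)
    then show "(\<integral>\<^sup>+\<mu>. indicator ?S (x - \<mu> *\<^sub>R l) * G x \<partial>lborel) = G x"
      by (simp add: nn_integral_cmult_indicator)
  qed
  finally show ?thesis .
qed

lemma Lp_norm_pow_strip:
  fixes h :: "real \<Rightarrow> 'a::euclidean_space \<Rightarrow> real"
  assumes h: "(\<lambda>(t, x). h t x) \<in> borel_measurable (borel \<Otimes>\<^sub>M borel)"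
  shows "Lp_norm_pow p ({0<..<T} \<times> UNIV) (\<lambda>(t, \<mu>). h t (x + \<mu> *\<^sub>R l))
      = (\<integral>\<^sup>+t. indicator {0<..<T} t * (\<integral>\<^sup>+\<mu>. ennreal (\<bar>h t (x + \<mu> *\<^sub>R l)\<bar> powr p) \<partial>lborel) \<partial>lborel)"
    and "(\<lambda>x. Lp_norm_pow p ({0<..<T} \<times> UNIV) (\<lambda>(t, \<mu>). h t (x + \<mu> *\<^sub>R l))) \<in> borel_measurable borel"
proof -
  define H where "H = (\<lambda>t x. ennreal (\<bar>h t x\<bar> powr p))"
  have H[measurable]: "(\<lambda>(t, x). H t x) \<in> borel_measurable (borel \<Otimes>\<^sub>M borel)"
    unfolding H_def using h by (auto simp: case_prod_beta)
  have H1[measurable]: "H t \<in> borel_measurable borel" for t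
    using measurable_Pair2[OF H, of t] by simp
  have [measurable]: "(\<lambda>(t, \<mu>). H t (x + \<mu> *\<^sub>R l)) \<in> borel_measurable (borel \<Otimes>\<^sub>M borel)" for x
    using measurable_compose[OF _ H, of "\<lambda>(t, \<mu>). (t, x + \<mu> *\<^sub>R l)" "borel \<Otimes>\<^sub>M borel"] by (simp add: case_prod_beta)
  have [measurable]: "(\<lambda>((x, t), \<mu>). H t (x + \<mu> *\<^sub>R l)) \<in> borel_measurable ((borel \<Otimes>\<^sub>M borel) \<Otimes>\<^sub>M borel)"
  proof -
    have "(\<lambda>z. case (snd (fst z), fst (fst z) + snd z *\<^sub>R l) of (t, x) \<Rightarrow> H t x)
        \<in> borel_measurable ((borel \<Otimes>\<^sub>M borel) \<Otimes>\<^sub>M borel)"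
      by (rule measurable_compose[OF _ H]) measurable
    then show ?thesis by (simp only: case_prod_beta case_prod_beta' fst_conv snd_conv)
  qed
  have line: "Lp_norm_pow p ({0<..<T} \<times> UNIV) (\<lambda>(t, \<mu>). h t (x + \<mu> *\<^sub>R l))
      = (\<integral>\<^sup>+t. indicator {0<..<T} t * (\<integral>\<^sup>+\<mu>. H t (x + \<mu> *\<^sub>R l) \<partial>lborel) \<partial>lborel)" for x
  proof -
    have "Lp_norm_pow p ({0<..<T} \<times> UNIV) (\<lambda>(t, \<mu>). h t (x + \<mu> *\<^sub>R l))
       = (\<integral>\<^sup>+z. (case z of (t, \<mu>) \<Rightarrow> indicator {0<..<T} t * H t (x + \<mu> *\<^sub>R l)) \<partial>(lborel \<Otimes>\<^sub>M lborel))"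
      unfolding Lp_norm_pow_def lborel_prod
      by (intro nn_integral_cong) (auto simp: H_def indicator_def)
    also have "\<dots> = (\<integral>\<^sup>+t. (\<integral>\<^sup>+\<mu>. indicator {0<..<T} t * H t (x + \<mu> *\<^sub>R l) \<partial>lborel) \<partial>lborel)"
      by (subst lborel.nn_integral_fst[symmetric]) (auto simp: case_prod_beta)
    also have "\<dots> = (\<integral>\<^sup>+t. indicator {0<..<T} t * (\<integral>\<^sup>+\<mu>. H t (x + \<mu> *\<^sub>R l) \<partial>lborel) \<partial>lborel)"
      by (intro nn_integral_cong nn_integral_cmult) measurable
    finally show ?thesis .
  qed
  show "Lp_norm_pow p ({0<..<T} \<times> UNIV) (\<lambda>(t, \<mu>). h t (x + \<mu> *\<^sub>R l))
      = (\<integral>\<^sup>+t. indicator {0<..<T} t * (\<integral>\<^sup>+\<mu>. ennreal (\<bar>h t (x + \<mu> *\<^sub>R l)\<bar> powr p) \<partial>lborel) \<partial>lborel)"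
    using line[of x] by (simp add: H_def)
  show "(\<lambda>x. Lp_norm_pow p ({0<..<T} \<times> UNIV) (\<lambda>(t, \<mu>). h t (x + \<mu> *\<^sub>R l))) \<in> borel_measurable borel"
    unfolding line by measurable
qed

lemma Lp_norm_pow_slab:
  fixes h :: "real \<Rightarrow> 'a::euclidean_space \<Rightarrow> real"
  assumes h: "(\<lambda>(t, x). h t x) \<in> borel_measurable (borel \<Otimes>\<^sub>M borel)" and l: "norm l = 1"
  shows "(\<integral>\<^sup>+x. indicator {x. 0 \<le> x \<bullet> l \<and> x \<bullet> l < 1} x *
            Lp_norm_pow p ({0<..<T} \<times> UNIV) (\<lambda>(t, \<mu>). h t (x + \<mu> *\<^sub>R l)) \<partial>lborel)
    = (\<integral>\<^sup>+t\<in>{0<..<T}. Lp_norm_pow p UNIV (h t) \<partial>lborel)"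
proof -
  let ?S = "{x::'a. 0 \<le> x \<bullet> l \<and> x \<bullet> l < 1}"
  note [measurable] = slab_measurable[of l]
  define H where "H = (\<lambda>t x. ennreal (\<bar>h t x\<bar> powr p))"
  have H[measurable]: "(\<lambda>(t, x). H t x) \<in> borel_measurable (borel \<Otimes>\<^sub>M borel)"
    unfolding H_def using h by (auto simp: case_prod_beta)
  have H1[measurable]: "H t \<in> borel_measurable borel" for t
    using measurable_Pair2[OF H, of t] by simp
  have [measurable]: "(\<lambda>(t, \<mu>). H t (x + \<mu> *\<^sub>R l)) \<in> borel_measurable (borel \<Otimes>\<^sub>M borel)" for x
    using measurable_compose[OF _ H, of "\<lambda>(t, \<mu>). (t, x + \<mu> *\<^sub>R l)" "borel \<Otimes>\<^sub>M borel"] by (simp add: case_prod_beta)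
  have [measurable]: "(\<lambda>((x, t), \<mu>). H t (x + \<mu> *\<^sub>R l)) \<in> borel_measurable ((borel \<Otimes>\<^sub>M borel) \<Otimes>\<^sub>M borel)"
  proof -
    have "(\<lambda>z. case (snd (fst z), fst (fst z) + snd z *\<^sub>R l) of (t, x) \<Rightarrow> H t x)
        \<in> borel_measurable ((borel \<Otimes>\<^sub>M borel) \<Otimes>\<^sub>M borel)"
      by (rule measurable_compose[OF _ H]) measurable
    then show ?thesis by (simp only: case_prod_beta case_prod_beta' fst_conv snd_conv)
  qed
  have line: "Lp_norm_pow p ({0<..<T} \<times> UNIV) (\<lambda>(t, \<mu>). h t (x + \<mu> *\<^sub>R l))
      = (\<integral>\<^sup>+t. indicator {0<..<T} t * (\<integral>\<^sup>+\<mu>. H t (x + \<mu> *\<^sub>R l) \<partial>lborel) \<partial>lborel)" for x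
    unfolding H_def by (rule Lp_norm_pow_strip(1)[OF h])
  have "(\<integral>\<^sup>+x. indicator ?S x * Lp_norm_pow p ({0<..<T} \<times> UNIV) (\<lambda>(t, \<mu>). h t (x + \<mu> *\<^sub>R l)) \<partial>lborel)
    = (\<integral>\<^sup>+x. (\<integral>\<^sup>+t. indicator ?S x * (indicator {0<..<T} t * (\<integral>\<^sup>+\<mu>. H t (x + \<mu> *\<^sub>R l) \<partial>lborel)) \<partial>lborel) \<partial>lborel)"
    unfolding line by (intro nn_integral_cong nn_integral_cmult[symmetric]) measurable
  also have "\<dots> = (\<integral>\<^sup>+t. (\<integral>\<^sup>+x. indicator ?S x * (indicator {0<..<T} t * (\<integral>\<^sup>+\<mu>. H t (x + \<mu> *\<^sub>R l) \<partial>lborel)) \<partial>lborel) \<partial>lborel)"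
    by (rule lborel_pair.Fubini'[symmetric]) measurable
  also have "\<dots> = (\<integral>\<^sup>+t. indicator {0<..<T} t * (\<integral>\<^sup>+x. indicator ?S x * (\<integral>\<^sup>+\<mu>. H t (x + \<mu> *\<^sub>R l) \<partial>lborel) \<partial>lborel) \<partial>lborel)"
    by (intro nn_integral_cong, subst nn_integral_cmult[symmetric]) (measurable, auto simp: mult_ac)
  also have "\<dots> = (\<integral>\<^sup>+t\<in>{0<..<T}. Lp_norm_pow p UNIV (h t) \<partial>lborel)"
    unfolding nn_integral_slab[OF H1 l] by (simp add: Lp_norm_pow_def H_def mult.commute)
  finally show ?thesis .
qed

lemma pd2_interpolant:
  assumes "\<And>k. smooth (w k)"
  shows "pd l (pd l (interpolant \<tau> K w t)) = (\<lambda>x. \<Sum>k<K. ramp \<tau> k t * pd l (pd l (\<lambda>x. w (Suc k) x - w k x)) x)"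
  using funpow_pd_shifted_sum[of "{..<K}" "\<lambda>k x. w (Suc k) x - w k x" 2 l "\<lambda>k. ramp \<tau> k t"] assms
  by (simp add: interpolant_def[abs_def] numeral_2_eq_2 smooth_diff)

lemma Lp_norm_pow_slice_measurable:
  fixes h :: "real \<Rightarrow> 'a::euclidean_space \<Rightarrow> real"
  assumes [measurable]: "(\<lambda>(t, x). h t x) \<in> borel_measurable (borel \<Otimes>\<^sub>M borel)"
  shows "(\<lambda>t. Lp_norm_pow p UNIV (h t)) \<in> borel_measurable borel"
  unfolding Lp_norm_pow_def by measurable

lemma ramp_measurable [measurable]:
  "ramp \<tau> k \<in> borel_measurable borel" "ramp' \<tau> k \<in> borel_measurable borel"
proof -
  show "ramp \<tau> k \<in> borel_measurable borel"
    by (intro borel_measurable_continuous_onI continuous_on_ramp)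
  show "ramp' \<tau> k \<in> borel_measurable borel"
    unfolding ramp'_def by measurable
qed

lemma interpolant_measurable:
  fixes w :: "nat \<Rightarrow> 'a::euclidean_space \<Rightarrow> real"
  assumes sm: "\<And>k. smooth (w k)"
  shows "(\<lambda>(t, x). pd l (pd l (interpolant \<tau> K w t)) x) \<in> borel_measurable (borel \<Otimes>\<^sub>M borel)"
    and "(\<lambda>(t, x). interpolant_source l \<tau> K w t x) \<in> borel_measurable (borel \<Otimes>\<^sub>M borel)"
proof -
  have [measurable]: "(\<lambda>x. w (Suc k) x - w k x) \<in> borel_measurable borel"
      "pd l (pd l (\<lambda>x. w (Suc k) x - w k x)) \<in> borel_measurable borel" for k
    by (intro smooth_imp_borel_measurable smooth_pd smooth_diff sm)+
  show "(\<lambda>(t, x). pd l (pd l (interpolant \<tau> K w t)) x) \<in> borel_measurable (borel \<Otimes>\<^sub>M borel)"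
    unfolding pd2_interpolant[OF sm] by measurable
  show "(\<lambda>(t, x). interpolant_source l \<tau> K w t x) \<in> borel_measurable (borel \<Otimes>\<^sub>M borel)"
    unfolding interpolant_source_def by measurable
qed

text \<open>The one-dimensional estimate holds on each line parallel to \<open>l\<close> and is integrated over these lines.\<close>

lemma interpolant_Lp_estimate:
  fixes w :: "nat \<Rightarrow> 'a::euclidean_space \<Rightarrow> real"
  assumes const: "heat_Lp_const \<alpha> p N" and \<alpha>: "0 < \<alpha>" "\<alpha> < 1"
    and w: "\<And>k. C0_infinity (w k)" and l: "norm l = 1" and \<tau>: "0 < \<tau>" and T: "0 < T"
  shows "(\<integral>\<^sup>+t\<in>{0<..<T}. Lp_norm_pow p UNIV (pd l (pd l (interpolant \<tau> K w t))) \<partial>lborel)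
     \<le> ennreal N * (\<integral>\<^sup>+t\<in>{0<..<T}. Lp_norm_pow p UNIV (interpolant_source l \<tau> K w t) \<partial>lborel)"
proof -
  let ?S = "\<lambda>x::'a. indicator {x. 0 \<le> x \<bullet> l \<and> x \<bullet> l < 1} x :: ennreal"
  have sm: "smooth (w k)" for k using w by (simp add: C0_infinity_iff)
  have smi: "smooth (interpolant \<tau> K w t)" for t
    unfolding interpolant_def by (intro smooth_sum smooth_cmult smooth_diff sm)
  define h where "h = (\<lambda>t. pd l (pd l (interpolant \<tau> K w t)))"
  define g where "g = interpolant_source l \<tau> K w"
  note h_meas = interpolant_measurable(1)[of w l \<tau> K, OF sm, folded h_def]
  note g_meas = interpolant_measurable(2)[of w l \<tau> K, OF sm, folded g_def]
  have line: "Lp_norm_pow p ({0<..<T} \<times> UNIV) (\<lambda>(t, \<mu>). h t (x + \<mu> *\<^sub>R l))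
     \<le> ennreal N * Lp_norm_pow p ({0<..<T} \<times> UNIV) (\<lambda>(t, \<mu>). g t (x + \<mu> *\<^sub>R l))" for x
    using const[unfolded heat_Lp_const_def, rule_format, OF T interpolant_heat_solution(1)[where w = w and K = K and x = x, OF w l \<alpha> \<tau>]
        interpolant_heat_solution(2)[where w = w and K = K and x = x, OF w l \<alpha> \<tau>]]
    unfolding h_def g_def deriv2_restrict_line[OF smi] .
  have "(\<integral>\<^sup>+t\<in>{0<..<T}. Lp_norm_pow p UNIV (h t) \<partial>lborel)
    = (\<integral>\<^sup>+x. ?S x * Lp_norm_pow p ({0<..<T} \<times> UNIV) (\<lambda>(t, \<mu>). h t (x + \<mu> *\<^sub>R l)) \<partial>lborel)"
    by (rule Lp_norm_pow_slab[OF h_meas l, symmetric])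
  also have "\<dots> \<le> (\<integral>\<^sup>+x. ?S x * (ennreal N * Lp_norm_pow p ({0<..<T} \<times> UNIV) (\<lambda>(t, \<mu>). g t (x + \<mu> *\<^sub>R l))) \<partial>lborel)"
    by (intro nn_integral_mono mult_left_mono line) auto
  also have "\<dots> = ennreal N * (\<integral>\<^sup>+x. ?S x * Lp_norm_pow p ({0<..<T} \<times> UNIV) (\<lambda>(t, \<mu>). g t (x + \<mu> *\<^sub>R l)) \<partial>lborel)"
    by (subst nn_integral_cmult[symmetric])
      (auto simp: mult_ac slab_measurable intro!: borel_measurable_times_ennreal Lp_norm_pow_strip(2)[OF g_meas])
  also have "(\<integral>\<^sup>+x. ?S x * Lp_norm_pow p ({0<..<T} \<times> UNIV) (\<lambda>(t, \<mu>). g t (x + \<mu> *\<^sub>R l)) \<partial>lborel)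
    = (\<integral>\<^sup>+t\<in>{0<..<T}. Lp_norm_pow p UNIV (g t) \<partial>lborel)"
    by (rule Lp_norm_pow_slab[OF g_meas l])
  finally show ?thesis unfolding h_def g_def .
qed

lemma nn_integral_steps:
  fixes F :: "real \<Rightarrow> ennreal"
  assumes \<tau>: "0 < \<tau>" and F: "F \<in> borel_measurable borel"
  shows "(\<integral>\<^sup>+t\<in>{0<..<real K * \<tau>}. F t \<partial>lborel) = (\<Sum>k<K. \<integral>\<^sup>+t\<in>{real k * \<tau><..real (Suc k) * \<tau>}. F t \<partial>lborel)"
proof -
  have ind: "indicator {0<..real K * \<tau>} t = (\<Sum>k<K. indicator {real k * \<tau><..real (Suc k) * \<tau>} t :: ennreal)" for t
  proof (induction K)
    case (Suc K)
    have "0 \<le> real K * \<tau>" "real K * \<tau> \<le> real (Suc K) * \<tau>" using \<tau> by auto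
    then have "indicator {0<..real (Suc K) * \<tau>} t
        = (indicator {0<..real K * \<tau>} t + indicator {real K * \<tau><..real (Suc K) * \<tau>} t :: ennreal)"
      by (auto simp: indicator_def)
    then show ?case using Suc.IH by simp
  qed (auto simp: indicator_def)
  have "(\<integral>\<^sup>+t\<in>{0<..<real K * \<tau>}. F t \<partial>lborel) = (\<integral>\<^sup>+t\<in>{0<..real K * \<tau>}. F t \<partial>lborel)"
    by (intro nn_integral_cong_AE eventually_mono[OF AE_lborel_singleton[of "real K * \<tau>"]]) (auto simp: indicator_def)
  also have "\<dots> = (\<Sum>k<K. \<integral>\<^sup>+t\<in>{real k * \<tau><..real (Suc k) * \<tau>}. F t \<partial>lborel)"
    unfolding ind sum_distrib_left using F by (intro nn_integral_sum) auto
  finally show ?thesis .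
qed

section \<open>The scheme along random paths\<close>

definition walk_scheme ::
  "'a::euclidean_space \<Rightarrow> ('j::finite \<Rightarrow> 'a) \<Rightarrow> ('a \<Rightarrow> real) \<Rightarrow> real \<Rightarrow> nat \<Rightarrow> (nat \<Rightarrow> 'j \<times> bool) \<Rightarrow> nat \<Rightarrow> 'a \<Rightarrow> real" where
  "walk_scheme l y u s K \<gamma> = scheme l s (ramp_source u (discrete_op l y u s) s K) (walk y s \<gamma>)"

lemma C0_infinity_discrete_op:
  assumes "C0_infinity u" "s \<in> {0<..1}"
  shows "C0_infinity (discrete_op l y u s)"
  using uniform_C0_discrete_op[OF assms(1), of l y] assms(2)
  unfolding uniform_C0_def C0_infinity_iff by blast

lemma C0_infinity_second_order_op:
  fixes y :: "'j::finite \<Rightarrow> 'a::euclidean_space"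
  assumes "C0_infinity u"
  shows "C0_infinity (second_order_op l y u)"
proof -
  have "C0_infinity (\<lambda>x. \<Sum>j\<in>UNIV. 1 * pd (y j) (pd (y j) u) x)"
    by (intro C0_infinity_sum C0_infinity_pd assms) simp
  from C0_infinity_add_shifted[OF C0_infinity_pd[OF C0_infinity_pd[OF assms]] this, of 1 l l 0 "1 / real CARD('j)" 0]
  show ?thesis by (simp add: second_order_op_def[abs_def])
qed

lemma C0_infinity_scheme:
  assumes "\<And>k. C0_infinity (F k)"
  shows "C0_infinity (scheme l s F P k)"
proof (induction k)
  case 0
  show ?case using C0_infinity_sum[of "{}"] by simp
next
  case (Suc k)
  have "C0_infinity (line_mean l s (scheme l s F P k))"
    unfolding line_mean_eq_comb by (intro C0_infinity_add_shifted Suc.IH)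
  from C0_infinity_add_shifted[OF this assms, of 1 0 "s\<^sup>2 / 2" k "- P (Suc k)"]
  show ?case by simp
qed

lemma C0_infinity_walk_scheme:
  assumes "C0_infinity u" "s \<in> {0<..1}"
  shows "C0_infinity (walk_scheme l y u s K \<gamma> k)"
proof -
  have "C0_infinity (ramp_source u (discrete_op l y u s) s K k)" for k
    unfolding ramp_source_eq
    using C0_infinity_add_shifted[OF assms(1) C0_infinity_discrete_op[OF assms], of _ 0 _ l y 0] by (simp only: add_0_right)
  then show ?thesis unfolding walk_scheme_def by (rule C0_infinity_scheme)
qed

lemma walk_scheme_0: "walk_scheme l y u s K \<gamma> 0 = (\<lambda>_. 0)"
  by (simp add: walk_scheme_def)

lemma pd2_walk_scheme_mean:
  fixes y :: "'j::finite \<Rightarrow> 'a::euclidean_space"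
  assumes u: "C0_infinity u" and s: "s \<in> {0<..1}" and K: "0 < K" "k \<le> K"
  shows "(\<Sum>\<gamma>\<in>paths K. 1 / real (card (paths K :: (nat \<Rightarrow> 'j \<times> bool) set)) *
           pd l (pd l (walk_scheme l y u s K \<gamma> k)) (x + walk y s \<gamma> k))
    = real k / real K * pd l (pd l u) x"
proof -
  let ?\<Omega> = "paths K :: (nat \<Rightarrow> 'j \<times> bool) set"
  have smu: "smooth u" using u by (simp add: C0_infinity_iff)
  have smw: "smooth (walk_scheme l y u s K \<gamma> k)" for \<gamma> :: "nat \<Rightarrow> 'j \<times> bool"
    using C0_infinity_walk_scheme[OF u s, of l y K \<gamma> k] by (simp add: C0_infinity_iff)
  have "(\<Sum>\<gamma>\<in>?\<Omega>. 1 / real (card ?\<Omega>) * walk_scheme l y u s K \<gamma> k (x + walk y s \<gamma> k)) = real k / real K * u x" for x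
    using scheme_walk_mean[of K s k l u y x] K s
    by (simp add: walk_scheme_def sum_divide_distrib)
  then have eq: "(\<lambda>x. \<Sum>\<gamma>\<in>?\<Omega>. 1 / real (card ?\<Omega>) * walk_scheme l y u s K \<gamma> k (x + walk y s \<gamma> k)) = (\<lambda>x. real k / real K * u x)"
    by (rule ext)
  let ?c = "\<lambda>_. 1 / real (card ?\<Omega>)" and ?z = "\<lambda>\<gamma>. walk y s \<gamma> k"
  have "pd l (pd l (\<lambda>x. \<Sum>\<gamma>\<in>?\<Omega>. 1 / real (card ?\<Omega>) * walk_scheme l y u s K \<gamma> k (x + walk y s \<gamma> k))) x
      = (\<Sum>\<gamma>\<in>?\<Omega>. 1 / real (card ?\<Omega>) * pd l (pd l (walk_scheme l y u s K \<gamma> k)) (x + walk y s \<gamma> k))"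
    unfolding pd_shifted_sum[of ?\<Omega> "\<lambda>\<gamma>. walk_scheme l y u s K \<gamma> k" l ?c ?z, OF smw]
      pd_shifted_sum[of ?\<Omega> "\<lambda>\<gamma>. pd l (walk_scheme l y u s K \<gamma> k)" l ?c ?z, OF smooth_pd[OF smw]] ..
  also have "pd l (pd l (\<lambda>x. \<Sum>\<gamma>\<in>?\<Omega>. 1 / real (card ?\<Omega>) * walk_scheme l y u s K \<gamma> k (x + walk y s \<gamma> k))) x
      = real k / real K * pd l (pd l u) x"
    unfolding eq by (simp only: pd_cmult smu smooth_pd)
  finally show ?thesis by simp
qed

text \<open>With these choices the final time is \<open>T = n\<close> and \<open>s T = 1/n\<close>, so that the error \<open>s T + 1/T\<close> is \<open>2/n\<close>.\<close>

definition space_step :: "nat \<Rightarrow> real" where "space_step n = 1 / (real n)\<^sup>2"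

definition time_step :: "nat \<Rightarrow> real" where "time_step n = (space_step n)\<^sup>2 / 2"

definition num_steps :: "nat \<Rightarrow> nat" where "num_steps n = 2 * n ^ 5"

abbreviation grid_scheme where
  "grid_scheme l y u n \<equiv> walk_scheme l y u (space_step n) (num_steps n)"

lemma space_step_in: "1 \<le> n \<Longrightarrow> space_step n \<in> {0<..1}"
  by (simp add: space_step_def)

lemma time_step_pos: "1 \<le> n \<Longrightarrow> 0 < time_step n"
  by (simp add: time_step_def space_step_def)

lemma num_steps_pos: "1 \<le> n \<Longrightarrow> 0 < num_steps n"
  by (simp add: num_steps_def)

lemma num_steps_time_step: "1 \<le> n \<Longrightarrow> real (num_steps n) * time_step n = real n"
  by (simp add: num_steps_def time_step_def space_step_def power2_eq_square eval_nat_numeral field_simps)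

lemma (in translation_invariant_seminorm) walk_scheme_step_errors:
  fixes y :: "'j::finite \<Rightarrow> 'a" and l :: 'a
  assumes u: "C0_infinity u"
  obtains C where "0 \<le> C"
    and "\<And>n \<gamma> k t. 1 \<le> n \<Longrightarrow> k < num_steps n \<Longrightarrow> real k * time_step n < t \<Longrightarrow> t \<le> real (Suc k) * time_step n \<Longrightarrow>
      B (C / real n) (\<lambda>x. interpolant_source l (time_step n) (num_steps n) (grid_scheme l y u n \<gamma>) t x
         + real k / real (num_steps n) * second_order_op l y u (x - walk y (space_step n) \<gamma> (Suc k)))"
    and "\<And>n \<gamma> k t. 1 \<le> n \<Longrightarrow> k < num_steps n \<Longrightarrow> real k * time_step n < t \<Longrightarrow> t \<le> real (Suc k) * time_step n \<Longrightarrow>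
      B (C / real n) (\<lambda>x. pd l (pd l (grid_scheme l y u n \<gamma> k)) x
         - pd l (pd l (interpolant (time_step n) (num_steps n) (grid_scheme l y u n \<gamma>) t)) x)"
proof -
  obtain C where C: "\<forall>s\<in>{0<..1}. \<forall>K k P \<theta>. 1 \<le> real K * (s\<^sup>2 / 2) \<longrightarrow> k < K \<longrightarrow> 0 \<le> \<theta> \<longrightarrow> \<theta> \<le> 1 \<longrightarrow>
    (let T = real K * (s\<^sup>2 / 2);
         w = scheme l s (ramp_source u (discrete_op l y u s) s K) P;
         \<phi> = (\<lambda>x. w (Suc k) x - w k x)
     in B (C * (s * T + 1 / T)) (\<lambda>x. \<phi> x / (s\<^sup>2 / 2) - pd l (pd l (w k)) x - \<theta> * pd l (pd l \<phi>) x
              + real k / real K * second_order_op l y u (x - P (Suc k))) \<and>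
        B (C * (s * T)) (pd l (pd l \<phi>)))"
    using scheme_errors[OF u, of l y] by blast
  have errors: "B (2 * \<bar>C\<bar> / real n) (\<lambda>x. interpolant_source l (time_step n) (num_steps n) (grid_scheme l y u n \<gamma>) t x
         + real k / real (num_steps n) * second_order_op l y u (x - walk y (space_step n) \<gamma> (Suc k)))"
    "B (2 * \<bar>C\<bar> / real n) (\<lambda>x. pd l (pd l (grid_scheme l y u n \<gamma> k)) x
         - pd l (pd l (interpolant (time_step n) (num_steps n) (grid_scheme l y u n \<gamma>) t)) x)"
    if n: "1 \<le> n" and k: "k < num_steps n" and t: "real k * time_step n < t" "t \<le> real (Suc k) * time_step n"
    for n k t and \<gamma> :: "nat \<Rightarrow> 'j \<times> bool"
  proof -
    define s where "s = space_step n"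
    define \<tau> where "\<tau> = time_step n"
    define K where "K = num_steps n"
    note s01 = space_step_in[OF n, folded s_def] and \<tau>0 = time_step_pos[OF n, folded \<tau>_def]
      and T = num_steps_time_step[OF n, folded K_def \<tau>_def] and k = k[folded K_def] and t = t[folded \<tau>_def]
    have \<tau>: "\<tau> = s\<^sup>2 / 2" by (simp add: \<tau>_def s_def time_step_def)
    have n0: "0 < real n" using n by simp
    define w where "w = walk_scheme l y u s K \<gamma>"
    define \<phi> where "\<phi> = (\<lambda>x. w (Suc k) x - w k x)"
    have smw: "smooth (w i)" for i
      using C0_infinity_walk_scheme[OF u s01, of l y K \<gamma> i] by (simp add: w_def C0_infinity_iff)
    have w0: "w 0 = (\<lambda>_. 0)" by (simp add: w_def walk_scheme_0)
    have err: "B (C * (s * real n + 1 / real n)) (\<lambda>x. \<phi> x / \<tau> - pd l (pd l (w k)) x - ramp \<tau> k t * pd l (pd l \<phi>) x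
              + real k / real K * second_order_op l y u (x - walk y s \<gamma> (Suc k)))"
      "B (C * (s * real n)) (pd l (pd l \<phi>))"
      using C[rule_format, OF s01, of K k "ramp \<tau> k t" "walk y s \<gamma>"] k T n ramp_bounds[of \<tau> k t]
      unfolding Let_def walk_scheme_def[symmetric] w_def[symmetric] \<phi>_def \<tau>[symmetric] T by auto
    have sn: "s * real n = 1 / real n" using n0 by (simp add: s_def space_step_def power2_eq_square)
    have "C / real n \<le> \<bar>C\<bar> / real n" using n0 by (intro divide_right_mono) auto
    then have le: "C * (s * real n + 1 / real n) \<le> 2 * \<bar>C\<bar> / real n" "C * (s * real n) \<le> 2 * \<bar>C\<bar> / real n"
      using n0 unfolding sn by (auto simp: field_simps)
    have "interpolant_source l \<tau> K w t x = \<phi> x / \<tau> - pd l (pd l (w k)) x - ramp \<tau> k t * pd l (pd l \<phi>) x" for x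
      unfolding \<phi>_def by (rule interpolant_source_on_step[of \<tau> k t K w, OF \<tau>0 t k w0 smw])
    then show "B (2 * \<bar>C\<bar> / real n) (\<lambda>x. interpolant_source l (time_step n) (num_steps n) (grid_scheme l y u n \<gamma>) t x
         + real k / real (num_steps n) * second_order_op l y u (x - walk y (space_step n) \<gamma> (Suc k)))"
      unfolding s_def[symmetric] \<tau>_def[symmetric] K_def[symmetric]
      using mono[OF err(1) le(1)] unfolding w_def by simp
    have "interpolant \<tau> K w t = (\<lambda>x. w k x + ramp \<tau> k t * \<phi> x)"
      unfolding \<phi>_def by (rule ext) (rule interpolant_on_step[of \<tau> k t K w, OF \<tau>0 t k w0])
    then have "pd l (pd l (interpolant \<tau> K w t)) = (\<lambda>x. pd l (pd l (w k)) x + ramp \<tau> k t * pd l (pd l \<phi>) x)"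
      unfolding \<phi>_def by (simp add: pd_add pd_cmult smooth_pd smooth_cmult smooth_diff smw)
    then have eq: "(\<lambda>x. pd l (pd l (w k)) x - pd l (pd l (interpolant \<tau> K w t)) x) = (\<lambda>x. (- ramp \<tau> k t) * pd l (pd l \<phi>) x)"
      by auto
    have "\<bar>- ramp \<tau> k t\<bar> * (C * (s * real n)) \<le> 1 * (C * (s * real n))"
      using ramp_bounds[of \<tau> k t] nonneg[OF err(2)] by (intro mult_right_mono) auto
    then have "\<bar>- ramp \<tau> k t\<bar> * (C * (s * real n)) \<le> 2 * \<bar>C\<bar> / real n" using le(2) by linarith
    from mono[OF cmult[OF err(2)] this]
    show "B (2 * \<bar>C\<bar> / real n) (\<lambda>x. pd l (pd l (grid_scheme l y u n \<gamma> k)) x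
         - pd l (pd l (interpolant (time_step n) (num_steps n) (grid_scheme l y u n \<gamma>) t)) x)"
      unfolding s_def[symmetric] \<tau>_def[symmetric] K_def[symmetric] w_def[symmetric] eq .
  qed
  show thesis
    by (rule that[of "2 * \<bar>C\<bar>"]) (simp, (rule errors; assumption)+)
qed

lemma exists_step:
  fixes t \<tau> :: real
  assumes "0 < t" "t \<le> real K * \<tau>"
  shows "\<exists>k<K. real k * \<tau> < t \<and> t \<le> real (Suc k) * \<tau>"
  using assms(2)
proof (induction K)
  case (Suc K)
  then show ?case by (cases "t \<le> real K * \<tau>") (auto intro: less_SucI)
qed (use assms(1) in simp)

section \<open>The Hoelder estimate\<close>

lemma holder_le_restrict_line:
  assumes "holder_le \<alpha> c f" "norm l = 1"
  shows "holder_le \<alpha> c (\<lambda>\<mu>::real. f (x + \<mu> *\<^sub>R l))"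
proof -
  have "dist (x + \<mu> *\<^sub>R l) (x + \<nu> *\<^sub>R l) = dist \<mu> \<nu>" for \<mu> \<nu>
    using assms(2) by (simp add: dist_norm scaleR_diff_left[symmetric])
  then show ?thesis using assms(1) unfolding holder_le_def by metis
qed

lemma holder_le_limit:
  fixes f :: "'a::metric_space \<Rightarrow> real"
  assumes "\<And>n. 1 \<le> n \<Longrightarrow> holder_le \<alpha> (c + d / real n) f" "0 \<le> c"
  shows "holder_le \<alpha> c f"
  unfolding holder_le_def
proof (intro conjI allI)
  fix x y :: 'a
  have "(\<lambda>n. (c + d / real n) * dist x y powr \<alpha>) \<longlonglongrightarrow> (c + 0) * dist x y powr \<alpha>"
    by (intro tendsto_intros lim_const_over_n)
  moreover have "\<forall>n\<ge>1. \<bar>f x - f y\<bar> \<le> (c + d / real n) * dist x y powr \<alpha>"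
    using assms(1) by (simp add: holder_le_def)
  ultimately show "\<bar>f x - f y\<bar> \<le> c * dist x y powr \<alpha>"
    using LIMSEQ_le_const[of _ "c * dist x y powr \<alpha>" "\<bar>f x - f y\<bar>"] by auto
qed (rule assms(2))

lemma holder_le_mean:
  fixes g :: "'i \<Rightarrow> 'a::metric_space \<Rightarrow> real"
  assumes "finite \<Omega>" "\<Omega> \<noteq> {}" "\<And>i. i \<in> \<Omega> \<Longrightarrow> holder_le \<alpha> c (g i)"
  shows "holder_le \<alpha> c (\<lambda>x. \<Sum>i\<in>\<Omega>. 1 / real (card \<Omega>) * g i x)"
  unfolding holder_le_def
proof (intro conjI allI)
  have n: "0 < real (card \<Omega>)" using assms(1,2) by (simp add: card_gt_0_iff)
  show "0 \<le> c" using assms(2,3) by (auto simp: holder_le_def)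
  fix x y :: 'a
  have "\<bar>\<Sum>i\<in>\<Omega>. 1 / real (card \<Omega>) * (g i x - g i y)\<bar> \<le> (\<Sum>i\<in>\<Omega>. 1 / real (card \<Omega>) * (c * dist x y powr \<alpha>))"
    using assms(3) n by (intro abs_linear_combination_le) (auto simp: holder_le_def)
  then show "\<bar>(\<Sum>i\<in>\<Omega>. 1 / real (card \<Omega>) * g i x) - (\<Sum>i\<in>\<Omega>. 1 / real (card \<Omega>) * g i y)\<bar> \<le> c * dist x y powr \<alpha>"
    using n by (simp add: sum_subtractf[symmetric] diff_divide_distrib)
qed

text \<open>At the final time \<open>T\<close> the interpolant equals \<open>w\<^sub>K\<close>, whose mean over the paths, after a shift by the
  position of the walk, is \<open>u\<close>. For each
  path the one-dimensional estimate bounds \<open>D\<^sub>l\<^sup>2 w\<^sub>K\<close> on lines by the seminorm of the source, which is at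
  most \<open>H + C/n\<close>, because its main part is a shift of \<open>-(k/K) f\<close> with \<open>k/K \<le> 1\<close>.\<close>

lemma holder_estimate_along_line:
  fixes y :: "'j::finite \<Rightarrow> 'a::euclidean_space"
  assumes const: "heat_holder_const \<alpha> N" and \<alpha>: "0 < \<alpha>" "\<alpha> < 1"
    and u: "C0_infinity u" and l: "norm l = 1"
    and f: "holder_le \<alpha> H (second_order_op l y u)"
  shows "holder_le \<alpha> (max 0 N * H) (\<lambda>\<mu>::real. pd l (pd l u) (x + \<mu> *\<^sub>R l))"
proof -
  interpret translation_invariant_seminorm "holder_le \<alpha> :: real \<Rightarrow> ('a \<Rightarrow> real) \<Rightarrow> bool"
    using \<alpha> by (rule translation_invariant_seminorm_holder)
  obtain C where C0: "0 \<le> C" and C: "\<And>n \<gamma> k t. 1 \<le> n \<Longrightarrow> k < num_steps n \<Longrightarrow> real k * time_step n < t \<Longrightarrow> t \<le> real (Suc k) * time_step n \<Longrightarrow>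
      holder_le \<alpha> (C / real n) (\<lambda>x. interpolant_source l (time_step n) (num_steps n) (grid_scheme l y u n \<gamma>) t x
         + real k / real (num_steps n) * second_order_op l y u (x - walk y (space_step n) \<gamma> (Suc k)))"
    by (rule walk_scheme_step_errors[OF u, of l y]) (rule that)
  have H: "0 \<le> H" using f by (simp add: holder_le_def)
  have approx: "holder_le \<alpha> (max 0 N * H + max 0 N * C / real n) (\<lambda>\<mu>::real. pd l (pd l u) (x + \<mu> *\<^sub>R l))" if n: "1 \<le> n" for n
  proof -
    define s where "s = space_step n"
    define \<tau> where "\<tau> = time_step n"
    define K where "K = num_steps n"
    have n0: "0 < real n" using n by simp
    note s01 = space_step_in[OF n, folded s_def] and \<tau> = time_step_pos[OF n, folded \<tau>_def]
      and K = num_steps_pos[OF n, folded K_def]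
    note C = C[OF n, folded s_def \<tau>_def K_def]
    have T: "0 < real K * \<tau>" using \<tau> K by simp
    let ?\<Omega> = "paths K :: (nat \<Rightarrow> 'j \<times> bool) set"
    have path: "holder_le \<alpha> (max 0 N * (C / real n + H)) (\<lambda>\<mu>::real. pd l (pd l (walk_scheme l y u s K \<gamma> K)) (x + \<mu> *\<^sub>R l))" for \<gamma> x
    proof -
      define w where "w = walk_scheme l y u s K \<gamma>"
      have w: "C0_infinity (w k)" for k unfolding w_def by (rule C0_infinity_walk_scheme[OF u s01])
      have w0: "w 0 = (\<lambda>_. 0)" by (simp add: w_def walk_scheme_0)
      have src: "holder_seminorm \<alpha> (\<lambda>\<mu>::real. interpolant_source l \<tau> K w t (x + \<mu> *\<^sub>R l)) \<le> ennreal (C / real n + H)"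
        if t: "t \<in> {0<..<real K * \<tau>}" for t
      proof -
        obtain k where k: "k < K" "real k * \<tau> < t" "t \<le> real (Suc k) * \<tau>"
          using exists_step[of t K \<tau>] t by auto
        have "holder_le \<alpha> (C / real n + \<bar>real k / real K\<bar> * H)
          (\<lambda>x. (interpolant_source l \<tau> K w t x + real k / real K * second_order_op l y u (x - walk y s \<gamma> (Suc k)))
             - real k / real K * second_order_op l y u (x - walk y s \<gamma> (Suc k)))"
          unfolding w_def by (intro diff cmult shift_minus f C k)
        moreover have "\<bar>real k / real K\<bar> * H \<le> 1 * H"
          using H k(1) by (intro mult_right_mono) auto
        ultimately have "holder_le \<alpha> (C / real n + H) (interpolant_source l \<tau> K w t)"
          by (auto intro: holder_le_mono)
        from holder_le_restrict_line[OF this l] show ?thesis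
          using C0 n0 H by (subst holder_seminorm_le_iff) auto
      qed
      have "holder_seminorm \<alpha> (deriv (deriv (\<lambda>\<mu>. interpolant \<tau> K w (real K * \<tau>) (x + \<mu> *\<^sub>R l))))
          \<le> (SUP t\<in>{0..real K * \<tau>}. holder_seminorm \<alpha> (deriv (deriv (\<lambda>\<mu>. interpolant \<tau> K w t (x + \<mu> *\<^sub>R l)))))"
        using T by (intro SUP_upper) auto
      also have "\<dots> \<le> ennreal N * (SUP t\<in>{0<..<real K * \<tau>}. holder_seminorm \<alpha> (\<lambda>\<mu>. interpolant_source l \<tau> K w t (x + \<mu> *\<^sub>R l)))"
        using const[unfolded heat_holder_const_def, rule_format, OF T
            interpolant_heat_solution(1)[where w = w and K = K and x = x, OF w l \<alpha> \<tau>]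
            interpolant_heat_solution(2)[where w = w and K = K and x = x, OF w l \<alpha> \<tau>]] .
      also have "\<dots> \<le> ennreal N * ennreal (C / real n + H)"
        by (intro mult_left_mono SUP_least src) auto
      also have "\<dots> = ennreal (max 0 N * (C / real n + H))"
        using C0 n0 H by (simp add: ennreal_mult ennreal_max_0)
      also have "interpolant \<tau> K w (real K * \<tau>) = w K"
      proof
        fix x
        obtain k where k: "K = Suc k" using K by (cases K) auto
        have "interpolant \<tau> K w (real K * \<tau>) x = w k x + ramp \<tau> k (real K * \<tau>) * (w (Suc k) x - w k x)"
          using \<tau> by (intro interpolant_on_step w0) (auto simp: k)
        moreover have "ramp \<tau> k (real K * \<tau>) = 1" using \<tau> by (simp add: ramp_def k)
        ultimately show "interpolant \<tau> K w (real K * \<tau>) x = w K x" by (simp add: k)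
      qed
      also have "deriv (deriv (\<lambda>\<mu>. w K (x + \<mu> *\<^sub>R l))) = (\<lambda>\<mu>. pd l (pd l (w K)) (x + \<mu> *\<^sub>R l))"
        using w[of K] by (intro deriv2_restrict_line) (simp add: C0_infinity_iff)
      finally show ?thesis
        using C0 n0 H by (subst (asm) holder_seminorm_le_iff) (auto simp: w_def)
    qed
    have "holder_le \<alpha> (max 0 N * (C / real n + H))
        (\<lambda>\<mu>::real. \<Sum>\<gamma>\<in>?\<Omega>. 1 / real (card ?\<Omega>) * pd l (pd l (walk_scheme l y u s K \<gamma> K)) (x + walk y s \<gamma> K + \<mu> *\<^sub>R l))"
      using finite_paths card_paths_pos[of K] path by (intro holder_le_mean) (auto simp: card_gt_0_iff)
    moreover have "(\<Sum>\<gamma>\<in>?\<Omega>. 1 / real (card ?\<Omega>) * pd l (pd l (walk_scheme l y u s K \<gamma> K)) (x + walk y s \<gamma> K + \<mu> *\<^sub>R l))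
        = pd l (pd l u) (x + \<mu> *\<^sub>R l)" for \<mu>
      using pd2_walk_scheme_mean[OF u s01 K order_refl, of l y "x + \<mu> *\<^sub>R l"] K by (simp add: ac_simps)
    ultimately show ?thesis by (simp add: algebra_simps)
  qed
  show ?thesis
    by (rule holder_le_limit[OF approx]) (simp_all add: H)
qed

section \<open>The estimate in Lebesgue spaces\<close>

lemma Lp_norm_pow_mean_le:
  fixes g :: "'i \<Rightarrow> 'a::euclidean_space \<Rightarrow> real"
  assumes "finite \<Omega>" "\<Omega> \<noteq> {}" "1 \<le> p" and g[measurable]: "\<And>i. g i \<in> borel_measurable borel"
  shows "Lp_norm_pow p UNIV (\<lambda>x. \<Sum>i\<in>\<Omega>. 1 / real (card \<Omega>) * g i x)
    \<le> (\<Sum>i\<in>\<Omega>. ennreal (1 / real (card \<Omega>)) * Lp_norm_pow p UNIV (g i))"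
proof -
  have n: "0 < real (card \<Omega>)" using assms(1,2) by (simp add: card_gt_0_iff)
  have jensen: "\<bar>\<Sum>i\<in>\<Omega>. 1 / real (card \<Omega>) * g i x\<bar> powr p \<le> (\<Sum>i\<in>\<Omega>. 1 / real (card \<Omega>) * \<bar>g i x\<bar> powr p)" for x
    using convex_on_sum[OF assms(1,2) convex_on_abs_powr[OF assms(3)], of "\<lambda>_. 1 / real (card \<Omega>)" "\<lambda>i. g i x"] n by simp
  have "Lp_norm_pow p UNIV (\<lambda>x. \<Sum>i\<in>\<Omega>. 1 / real (card \<Omega>) * g i x)
    \<le> (\<integral>\<^sup>+x. (\<Sum>i\<in>\<Omega>. ennreal (1 / real (card \<Omega>)) * ennreal (\<bar>g i x\<bar> powr p)) \<partial>lborel)"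
    unfolding Lp_norm_pow_def
  proof (intro nn_integral_mono)
    fix x
    have "(\<Sum>i\<in>\<Omega>. ennreal (1 / real (card \<Omega>)) * ennreal (\<bar>g i x\<bar> powr p)) = ennreal (\<Sum>i\<in>\<Omega>. 1 / real (card \<Omega>) * \<bar>g i x\<bar> powr p)"
      by (subst sum_ennreal[symmetric], simp, intro sum.cong refl, rule ennreal_mult[symmetric]) auto
    then show "ennreal (\<bar>\<Sum>i\<in>\<Omega>. 1 / real (card \<Omega>) * g i x\<bar> powr p) * indicator UNIV x
        \<le> (\<Sum>i\<in>\<Omega>. ennreal (1 / real (card \<Omega>)) * ennreal (\<bar>g i x\<bar> powr p))"
      using ennreal_leI[OF jensen[of x]] by simp
  qed
  also have "\<dots> = (\<Sum>i\<in>\<Omega>. ennreal (1 / real (card \<Omega>)) * Lp_norm_pow p UNIV (g i))"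
    by (subst nn_integral_sum) (auto simp: Lp_norm_pow_def nn_integral_cmult)
  finally show ?thesis .
qed

lemma C0_infinity_Lp_finite:
  fixes f :: "'a::euclidean_space \<Rightarrow> real"
  assumes "C0_infinity f" "1 < p"
  shows "Lp_norm_pow p UNIV f < \<infinity>"
proof -
  interpret translation_invariant_seminorm "Lp_le p :: real \<Rightarrow> ('a \<Rightarrow> real) \<Rightarrow> bool"
    using assms(2) by (rule translation_invariant_seminorm_Lp)
  obtain C where "\<forall>s\<in>{0<..1::real}. Lp_le p C f"
    using uniform[OF uniform_C0_imp_Lip0[OF uniform_C0_const[OF assms(1)]]] by blast
  then have "Lp_le p C f" by (meson greaterThanAtMost_iff order_refl zero_less_one)
  then have "Lp_norm_pow p UNIV f \<le> ennreal ((C + 1) powr p)" by (simp add: Lp_le_def)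
  also have "\<dots> < \<infinity>" by simp
  finally show ?thesis .
qed

text \<open>The half of the terms with \<open>k \<ge> m\<close> are at least \<open>(1/2) powr p\<close>. This mean
  will be divided out of both sides of the \<open>L\<^sub>p\<close> estimate, so it has to stay away from \<open>0\<close> as \<open>m\<close> grows.\<close>

lemma ramp_power_mean_lower_bound:
  assumes "0 < m" "0 \<le> p"
  shows "1 / 2 * (1 / 2) powr p \<le> (\<Sum>k<2 * m. (real k / real (2 * m)) powr p) / real (2 * m)"
proof -
  have "real m * (1 / 2) powr p = (\<Sum>k\<in>{m..<2 * m}. (1 / 2) powr p)" by simp
  also have "\<dots> \<le> (\<Sum>k\<in>{m..<2 * m}. (real k / real (2 * m)) powr p)"
    using assms by (intro sum_mono powr_mono2) (auto simp: field_simps)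
  also have "\<dots> \<le> (\<Sum>k<2 * m. (real k / real (2 * m)) powr p)"
    by (intro sum_mono2) auto
  finally have "real m * (1 / 2) powr p / real (2 * m) \<le> (\<Sum>k<2 * m. (real k / real (2 * m)) powr p) / real (2 * m)"
    by (intro divide_right_mono) auto
  then show ?thesis using assms by (simp add: field_simps)
qed

text \<open>The space-time estimate for the interpolant turned into one for the grid functions \<open>w\<^sub>k\<close>, given
  bounds \<open>c k\<close> for the source on the time steps and a comparison of \<open>D\<^sub>l\<^sup>2 w\<^sub>k\<close> with the interpolant.\<close>

lemma path_Lp_sum_le:
  fixes w :: "nat \<Rightarrow> 'a::euclidean_space \<Rightarrow> real"
  assumes const: "heat_Lp_const \<alpha> p N" and \<alpha>: "0 < \<alpha>" "\<alpha> < 1"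
    and w: "\<And>k. C0_infinity (w k)" and l: "norm l = 1" and \<tau>: "0 < \<tau>" and K: "0 < K"
    and c: "\<And>k. 0 \<le> c k" and e: "0 \<le> e"
    and src: "\<And>k t. k < K \<Longrightarrow> real k * \<tau> < t \<Longrightarrow> t \<le> real (Suc k) * \<tau> \<Longrightarrow>
       Lp_norm_pow p UNIV (interpolant_source l \<tau> K w t) \<le> ennreal (c k)"
    and grid: "\<And>k t. k < K \<Longrightarrow> real k * \<tau> < t \<Longrightarrow> t \<le> real (Suc k) * \<tau> \<Longrightarrow>
       Lp_norm_pow p UNIV (pd l (pd l (w k))) \<le>
         ennreal A * Lp_norm_pow p UNIV (pd l (pd l (interpolant \<tau> K w t))) + ennreal e"
  shows "(\<Sum>k<K. ennreal \<tau> * Lp_norm_pow p UNIV (pd l (pd l (w k))))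
    \<le> ennreal A * (ennreal N * ennreal (\<Sum>k<K. \<tau> * c k)) + ennreal (real K * \<tau> * e)"
proof -
  have sm: "smooth (w k)" for k using w by (simp add: C0_infinity_iff)
  define X where "X = (\<lambda>t. Lp_norm_pow p UNIV (pd l (pd l (interpolant \<tau> K w t))))"
  define Y where "Y = (\<lambda>t. Lp_norm_pow p UNIV (interpolant_source l \<tau> K w t))"
  have X[measurable]: "X \<in> borel_measurable borel"
    unfolding X_def by (rule Lp_norm_pow_slice_measurable[OF interpolant_measurable(1)[OF sm]])
  have Y[measurable]: "Y \<in> borel_measurable borel"
    unfolding Y_def by (rule Lp_norm_pow_slice_measurable[OF interpolant_measurable(2)[OF sm]])
  have T: "0 < real K * \<tau>" using \<tau> K by simp
  have step_const: "(\<integral>\<^sup>+t\<in>{real k * \<tau><..real (Suc k) * \<tau>}. a \<partial>lborel) = ennreal \<tau> * a" for k and a :: ennreal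
  proof -
    have "emeasure lborel {real k * \<tau><..real (Suc k) * \<tau>} = ennreal \<tau>"
      using \<tau> by (subst emeasure_lborel_Ioc) (auto simp: algebra_simps)
    then show ?thesis by (simp add: nn_integral_cmult_indicator mult.commute)
  qed
  have "(\<integral>\<^sup>+t\<in>{0<..<real K * \<tau>}. Y t \<partial>lborel) = (\<Sum>k<K. \<integral>\<^sup>+t\<in>{real k * \<tau><..real (Suc k) * \<tau>}. Y t \<partial>lborel)"
    by (rule nn_integral_steps[OF \<tau> Y])
  also have "\<dots> \<le> (\<Sum>k<K. \<integral>\<^sup>+t\<in>{real k * \<tau><..real (Suc k) * \<tau>}. ennreal (c k) \<partial>lborel)"
    using src by (intro sum_mono nn_integral_mono) (auto simp: Y_def indicator_def)
  also have "\<dots> = (\<Sum>k<K. ennreal (\<tau> * c k))"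
    unfolding step_const using \<tau> c by (simp add: ennreal_mult)
  also have "\<dots> = ennreal (\<Sum>k<K. \<tau> * c k)"
    using \<tau> c by (intro sum_ennreal) auto
  finally have Y_le: "(\<integral>\<^sup>+t\<in>{0<..<real K * \<tau>}. Y t \<partial>lborel) \<le> ennreal (\<Sum>k<K. \<tau> * c k)" .
  have "(\<integral>\<^sup>+t\<in>{0<..<real K * \<tau>}. X t \<partial>lborel) \<le> ennreal N * (\<integral>\<^sup>+t\<in>{0<..<real K * \<tau>}. Y t \<partial>lborel)"
    unfolding X_def Y_def by (rule interpolant_Lp_estimate[OF const \<alpha> w l \<tau> T])
  also have "\<dots> \<le> ennreal N * ennreal (\<Sum>k<K. \<tau> * c k)"
    using Y_le by (intro mult_left_mono) auto
  finally have X_le: "(\<integral>\<^sup>+t\<in>{0<..<real K * \<tau>}. X t \<partial>lborel) \<le> ennreal N * ennreal (\<Sum>k<K. \<tau> * c k)" .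
  have "(\<Sum>k<K. ennreal \<tau> * Lp_norm_pow p UNIV (pd l (pd l (w k))))
    = (\<Sum>k<K. \<integral>\<^sup>+t\<in>{real k * \<tau><..real (Suc k) * \<tau>}. Lp_norm_pow p UNIV (pd l (pd l (w k))) \<partial>lborel)"
    unfolding step_const ..
  also have "\<dots> \<le> (\<Sum>k<K. \<integral>\<^sup>+t\<in>{real k * \<tau><..real (Suc k) * \<tau>}. ennreal A * X t + ennreal e \<partial>lborel)"
    using grid by (intro sum_mono nn_integral_mono) (auto simp: X_def indicator_def)
  also have "\<dots> = (\<integral>\<^sup>+t\<in>{0<..<real K * \<tau>}. ennreal A * X t + ennreal e \<partial>lborel)"
    by (rule nn_integral_steps[OF \<tau>, symmetric]) measurable
  also have "\<dots> = (\<integral>\<^sup>+t. ennreal A * (X t * indicator {0<..<real K * \<tau>} t) + ennreal e * indicator {0<..<real K * \<tau>} t \<partial>lborel)"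
    by (intro nn_integral_cong) (auto simp: indicator_def)
  also have "\<dots> = ennreal A * (\<integral>\<^sup>+t\<in>{0<..<real K * \<tau>}. X t \<partial>lborel) + ennreal e * ennreal (real K * \<tau>)"
    using T by (subst nn_integral_add) (auto simp: nn_integral_cmult nn_integral_cmult_indicator)
  also have "\<dots> \<le> ennreal A * (ennreal N * ennreal (\<Sum>k<K. \<tau> * c k)) + ennreal (real K * \<tau> * e)"
    using T e X_le by (intro add_mono mult_left_mono) (auto simp: ennreal_mult[symmetric] mult.commute)
  finally show ?thesis .
qed

text \<open>Both main terms carry the factor \<open>(k/K)\<^sup>p\<close>: on the left by Jensen's inequality, since \<open>(k/K) D\<^sub>l\<^sup>2 u\<close> is the
  mean of shifts of \<open>D\<^sub>l\<^sup>2 w\<^sub>k\<close>, and on the right because the source is \<open>-(k/K) f\<close> up to a shift and a small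
  error. Summing over \<open>k\<close> and dividing by the common factor \<open>Z\<close> leaves the elliptic estimate. The
  parameter \<open>q\<close> separates the main terms from the errors as in \<open>abs_add_powr_le\<close>; it is used twice,
  for the source and for the interpolation in time.\<close>

lemma Lp_estimate_with_error:
  fixes y :: "'j::finite \<Rightarrow> 'a::euclidean_space"
  assumes const: "heat_Lp_const \<alpha> p N" and \<alpha>: "0 < \<alpha>" "\<alpha> < 1" and p: "1 < p"
    and u: "C0_infinity u" and l: "norm l = 1" and q: "0 < q" "q < 1"
    and U: "Lp_norm_pow p UNIV (pd l (pd l u)) = ennreal U" "0 \<le> U"
    and V: "Lp_norm_pow p UNIV (second_order_op l y u) = ennreal V" "0 \<le> V"
  shows "\<exists>C\<ge>0. \<forall>n\<ge>1. U \<le> (1 - q) powr (1 - p) * max 0 N * (1 - q) powr (1 - p) * V + C * (1 / real n) powr p"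
proof -
  interpret translation_invariant_seminorm "Lp_le p :: real \<Rightarrow> ('a \<Rightarrow> real) \<Rightarrow> bool"
    using p by (rule translation_invariant_seminorm_Lp)
  obtain C where C0: "0 \<le> C" and C1: "\<And>n \<gamma> k t. 1 \<le> n \<Longrightarrow> k < num_steps n \<Longrightarrow> real k * time_step n < t \<Longrightarrow> t \<le> real (Suc k) * time_step n \<Longrightarrow>
      Lp_le p (C / real n) (\<lambda>x. interpolant_source l (time_step n) (num_steps n) (grid_scheme l y u n \<gamma>) t x
         + real k / real (num_steps n) * second_order_op l y u (x - walk y (space_step n) \<gamma> (Suc k)))"
    and C2: "\<And>n \<gamma> k t. 1 \<le> n \<Longrightarrow> k < num_steps n \<Longrightarrow> real k * time_step n < t \<Longrightarrow> t \<le> real (Suc k) * time_step n \<Longrightarrow>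
      Lp_le p (C / real n) (\<lambda>x. pd l (pd l (grid_scheme l y u n \<gamma> k)) x
         - pd l (pd l (interpolant (time_step n) (num_steps n) (grid_scheme l y u n \<gamma>) t)) x)"
    by (rule walk_scheme_step_errors[OF u, of l y]) (rule that)
  define A where "A = (1 - q) powr (1 - p)"
  define b where "b = q powr (1 - p)"
  define N' where "N' = max 0 N"
  define z where "z = 1 / 2 * (1 / 2 :: real) powr p"
  define D where "D = (A * N' + 1) * b * (C + 1) powr p / z"
  have pos: "0 < A" "0 < b" "0 \<le> N'" "0 < z" using q by (auto simp: A_def b_def N'_def z_def)
  have f: "C0_infinity (second_order_op l y u)" by (rule C0_infinity_second_order_op[OF u])
  have f_meas[measurable]: "second_order_op l y u \<in> borel_measurable borel"
    using f by (auto simp: C0_infinity_iff intro: smooth_imp_borel_measurable)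
  have "U \<le> A * N' * A * V + D * (1 / real n) powr p" if n: "1 \<le> n" for n
  proof -
    define s where "s = space_step n"
    define \<tau> where "\<tau> = time_step n"
    define K where "K = num_steps n"
    define E where "E = ((C + 1) / real n) powr p"
    have n0: "0 < real n" using n by simp
    note s01 = space_step_in[OF n, folded s_def] and \<tau> = time_step_pos[OF n, folded \<tau>_def]
      and K = num_steps_pos[OF n, folded K_def] and T = num_steps_time_step[OF n, folded K_def \<tau>_def]
    note C1 = C1[OF n, folded s_def \<tau>_def K_def] and C2 = C2[OF n, folded s_def \<tau>_def K_def]
    have E: "0 \<le> E" by (simp add: E_def)
    have Lp_E: "Lp_norm_pow p UNIV \<psi> \<le> ennreal E" if "Lp_le p (C / real n) \<psi>" for \<psi> :: "'a \<Rightarrow> real"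
    proof -
      have "C / real n < (C + 1) / real n" using n0 by (simp add: divide_strict_right_mono)
      with that show ?thesis unfolding Lp_le_def E_def by blast
    qed
    let ?\<Omega> = "paths K :: (nat \<Rightarrow> 'j \<times> bool) set"
    let ?W = "walk_scheme l y u s K"
    have W: "C0_infinity (?W \<gamma> k)" for \<gamma> k by (rule C0_infinity_walk_scheme[OF u s01])
    have DW: "C0_infinity (pd l (pd l (?W \<gamma> k)))" for \<gamma> k by (intro C0_infinity_pd W)
    have DW_meas[measurable]: "pd l (pd l (?W \<gamma> k)) \<in> borel_measurable borel" for \<gamma> k
      using DW[of \<gamma> k] by (auto simp: C0_infinity_iff intro: smooth_imp_borel_measurable)
    define U' where "U' = (\<lambda>\<gamma> k. enn2real (Lp_norm_pow p UNIV (pd l (pd l (?W \<gamma> k)))))"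
    have U': "Lp_norm_pow p UNIV (pd l (pd l (?W \<gamma> k))) = ennreal (U' \<gamma> k)" "0 \<le> U' \<gamma> k" for \<gamma> k
      using C0_infinity_Lp_finite[OF DW p, of \<gamma> k] by (auto simp: U'_def less_top)
    define c where "c = (\<lambda>k. A * ((real k / real K) powr p * V) + b * E)"
    have c: "0 \<le> c k" for k using pos V(2) E by (simp add: c_def)
    define Z where "Z = (\<Sum>k<K. (real k / real K) powr p) / real K"
    have "z \<le> Z"
      using ramp_power_mean_lower_bound[of "n ^ 5" p] n p by (simp add: z_def Z_def K_def num_steps_def)
    then have Z: "0 < Z" using pos by linarith
    have sum_c: "(\<Sum>k<K. \<tau> * c k) = real n * (A * Z * V + b * E)"
    proof -
      have "(\<Sum>k<K. \<tau> * c k) = \<tau> * (A * (\<Sum>k<K. (real k / real K) powr p) * V + real K * (b * E))"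
        by (simp add: c_def sum.distrib sum_distrib_left[symmetric] sum_distrib_right[symmetric] mult.assoc)
      also have "(\<Sum>k<K. (real k / real K) powr p) = real K * Z" using K by (simp add: Z_def)
      finally show ?thesis unfolding T[symmetric] by (simp add: algebra_simps)
    qed
    have path: "(\<Sum>k<K. \<tau> * U' \<gamma> k) \<le> A * (N' * (real n * (A * Z * V + b * E))) + real n * (b * E)" for \<gamma>
    proof -
      have src: "Lp_norm_pow p UNIV (interpolant_source l \<tau> K (?W \<gamma>) t) \<le> ennreal (c k)"
        if k: "k < K" and t: "real k * \<tau> < t" "t \<le> real (Suc k) * \<tau>" for k t
      proof -
        let ?\<phi> = "\<lambda>x. - (real k / real K) * second_order_op l y u (x - walk y s \<gamma> (Suc k))"
        let ?\<psi> = "\<lambda>x. interpolant_source l \<tau> K (?W \<gamma>) t x + real k / real K * second_order_op l y u (x - walk y s \<gamma> (Suc k))"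
        have err: "Lp_le p (C / real n) ?\<psi>" by (rule C1[OF k t])
        have "Lp_norm_pow p UNIV (\<lambda>x. ?\<phi> x + ?\<psi> x) \<le> ennreal A * Lp_norm_pow p UNIV ?\<phi> + ennreal b * Lp_norm_pow p UNIV ?\<psi>"
          unfolding A_def b_def using p q err by (intro Lp_norm_pow_add_le) (auto simp: Lp_le_def)
        also have "\<dots> \<le> ennreal A * ennreal ((real k / real K) powr p * V) + ennreal b * ennreal E"
        proof (intro add_mono mult_left_mono Lp_E err)
          have "Lp_norm_pow p UNIV ?\<phi> = ennreal (\<bar>- (real k / real K)\<bar> powr p) * Lp_norm_pow p UNIV (\<lambda>x. second_order_op l y u (x + - walk y s \<gamma> (Suc k)))"
            by (subst Lp_norm_pow_cmult) auto
          also have "\<dots> = ennreal ((real k / real K) powr p * V)"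
            unfolding Lp_norm_pow_shift[OF f_meas] V(1) by (simp add: ennreal_mult V(2))
          finally show "Lp_norm_pow p UNIV ?\<phi> \<le> ennreal ((real k / real K) powr p * V)" by simp
        qed auto
        also have "\<dots> = ennreal (c k)"
          using pos E V(2) by (simp add: c_def ennreal_mult ennreal_plus)
        finally show ?thesis by simp
      qed
      have grid: "Lp_norm_pow p UNIV (pd l (pd l (?W \<gamma> k))) \<le>
           ennreal A * Lp_norm_pow p UNIV (pd l (pd l (interpolant \<tau> K (?W \<gamma>) t))) + ennreal (b * E)"
        if k: "k < K" and t: "real k * \<tau> < t" "t \<le> real (Suc k) * \<tau>" for k t
      proof -
        let ?\<phi> = "pd l (pd l (interpolant \<tau> K (?W \<gamma>) t))"
        let ?\<psi> = "\<lambda>x. pd l (pd l (?W \<gamma> k)) x - pd l (pd l (interpolant \<tau> K (?W \<gamma>) t)) x"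
        have smW: "smooth (?W \<gamma> k)" for k using W[of \<gamma> k] by (simp add: C0_infinity_iff)
        have "smooth ?\<phi>"
          unfolding interpolant_def[abs_def] by (intro smooth_pd smooth_sum smooth_cmult smooth_diff smW)
        then have \<phi>: "?\<phi> \<in> borel_measurable borel" by (rule smooth_imp_borel_measurable)
        have err: "Lp_le p (C / real n) ?\<psi>" by (rule C2[OF k t])
        have "Lp_norm_pow p UNIV (\<lambda>x. ?\<phi> x + ?\<psi> x) \<le> ennreal A * Lp_norm_pow p UNIV ?\<phi> + ennreal b * Lp_norm_pow p UNIV ?\<psi>"
          unfolding A_def b_def using p q err \<phi> by (intro Lp_norm_pow_add_le) (auto simp: Lp_le_def)
        also have "\<dots> \<le> ennreal A * Lp_norm_pow p UNIV ?\<phi> + ennreal b * ennreal E"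
          by (intro add_mono mult_left_mono Lp_E err) auto
        finally show ?thesis using pos E by (simp add: ennreal_mult)
      qed
      have "ennreal (\<Sum>k<K. \<tau> * U' \<gamma> k) = (\<Sum>k<K. ennreal \<tau> * Lp_norm_pow p UNIV (pd l (pd l (?W \<gamma> k))))"
        using \<tau> U'(2) by (subst sum_ennreal[symmetric]) (auto simp: U'(1) ennreal_mult)
      also have "\<dots> \<le> ennreal A * (ennreal N * ennreal (\<Sum>k<K. \<tau> * c k)) + ennreal (real K * \<tau> * (b * E))"
        using pos E by (intro path_Lp_sum_le[OF const \<alpha> W l \<tau> K c _ src grid]) auto
      also have "\<dots> = ennreal (A * (N' * (real n * (A * Z * V + b * E))) + real n * (b * E))"
        unfolding sum_c T ennreal_max_0[of N, symmetric] N'_def[symmetric]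
        using pos E Z V(2) n0 by (simp add: ennreal_mult ennreal_plus)
      finally show ?thesis
        using pos E Z V(2) n0 by (subst (asm) ennreal_le_iff) auto
    qed
    have mean: "(real k / real K) powr p * U \<le> (\<Sum>\<gamma>\<in>?\<Omega>. 1 / real (card ?\<Omega>) * U' \<gamma> k)" if "k < K" for k
    proof -
      have "ennreal ((real k / real K) powr p * U) = Lp_norm_pow p UNIV (\<lambda>x. real k / real K * pd l (pd l u) x)"
        using C0_infinity_pd[OF C0_infinity_pd[OF u], of l l] U(2)
        by (subst Lp_norm_pow_cmult) (auto simp: U(1) ennreal_mult C0_infinity_iff intro: smooth_imp_borel_measurable)
      also have "(\<lambda>x. real k / real K * pd l (pd l u) x) =
        (\<lambda>x. \<Sum>\<gamma>\<in>?\<Omega>. 1 / real (card ?\<Omega>) * pd l (pd l (?W \<gamma> k)) (x + walk y s \<gamma> k))"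
        using pd2_walk_scheme_mean[OF u s01 K, of k l y] that by auto
      also have "Lp_norm_pow p UNIV \<dots> \<le> (\<Sum>\<gamma>\<in>?\<Omega>. ennreal (1 / real (card ?\<Omega>)) *
          Lp_norm_pow p UNIV (\<lambda>x. pd l (pd l (?W \<gamma> k)) (x + walk y s \<gamma> k)))"
        using finite_paths card_paths_pos[of K] p by (intro Lp_norm_pow_mean_le) (auto simp: card_gt_0_iff)
      also have "\<dots> = ennreal (\<Sum>\<gamma>\<in>?\<Omega>. 1 / real (card ?\<Omega>) * U' \<gamma> k)"
        using U'(2) unfolding Lp_norm_pow_shift[OF DW_meas] U'(1)
        by (subst sum_ennreal[symmetric]) (auto simp: ennreal_mult[symmetric])
      finally show ?thesis
        using U'(2) by (subst (asm) ennreal_le_iff) (auto intro!: sum_nonneg)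
    qed
    have card: "0 < real (card ?\<Omega>)" using card_paths_pos[of K] by simp
    have "real n * (Z * U) = (\<Sum>k<K. \<tau> * ((real k / real K) powr p * U))"
      using K unfolding T[symmetric] by (simp add: Z_def sum_distrib_left[symmetric] sum_distrib_right[symmetric])
    also have "\<dots> \<le> (\<Sum>k<K. \<tau> * (\<Sum>\<gamma>\<in>?\<Omega>. 1 / real (card ?\<Omega>) * U' \<gamma> k))"
      using mean \<tau> by (intro sum_mono mult_left_mono) auto
    also have "\<dots> = (\<Sum>\<gamma>\<in>?\<Omega>. 1 / real (card ?\<Omega>) * (\<Sum>k<K. \<tau> * U' \<gamma> k))"
      unfolding sum_distrib_left by (subst sum.swap) (simp add: mult_ac)
    also have "\<dots> \<le> (\<Sum>\<gamma>\<in>?\<Omega>. 1 / real (card ?\<Omega>) * (A * (N' * (real n * (A * Z * V + b * E))) + real n * (b * E)))"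
      using path card by (intro sum_mono mult_left_mono) auto
    also have "\<dots> = real n * (A * N' * (A * Z * V + b * E) + b * E)"
      using card by (simp add: algebra_simps)
    finally have "Z * U \<le> A * N' * (A * Z * V + b * E) + b * E"
      using n0 by simp
    then have "Z * U \<le> Z * (A * N' * A * V) + (A * N' + 1) * b * E"
      by (simp add: algebra_simps)
    then have "U \<le> A * N' * A * V + (A * N' + 1) * b * E / Z"
      using Z by (simp add: field_simps)
    also have "(A * N' + 1) * b * E / Z \<le> (A * N' + 1) * b * E / z"
      using \<open>z \<le> Z\<close> pos E by (intro divide_left_mono mult_pos_pos mult_nonneg_nonneg) auto
    also have "\<dots> = D * (1 / real n) powr p"
      using C0 n0 by (simp add: D_def E_def powr_divide)
    finally show ?thesis by simp
  qed
  moreover have "0 \<le> D" using pos by (simp add: D_def)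
  ultimately show ?thesis unfolding A_def N'_def by blast
qed

lemma Lp_estimate_second_derivative:
  fixes y :: "'j::finite \<Rightarrow> 'a::euclidean_space"
  assumes const: "heat_Lp_const \<alpha> p N" and \<alpha>: "0 < \<alpha>" "\<alpha> < 1" and p: "1 < p"
    and u: "C0_infinity u" and l: "norm l = 1"
  shows "Lp_norm_pow p UNIV (pd l (pd l u)) \<le> ennreal N * Lp_norm_pow p UNIV (second_order_op l y u)"
proof -
  define U where "U = enn2real (Lp_norm_pow p UNIV (pd l (pd l u)))"
  define V where "V = enn2real (Lp_norm_pow p UNIV (second_order_op l y u))"
  have U: "Lp_norm_pow p UNIV (pd l (pd l u)) = ennreal U" "0 \<le> U"
    using C0_infinity_Lp_finite[OF C0_infinity_pd[OF C0_infinity_pd[OF u]] p, of l l] by (auto simp: U_def less_top)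
  have V: "Lp_norm_pow p UNIV (second_order_op l y u) = ennreal V" "0 \<le> V"
    using C0_infinity_Lp_finite[OF C0_infinity_second_order_op[OF u] p, of l y] by (auto simp: V_def less_top)
  have approx: "U \<le> (1 - q) powr (1 - p) * max 0 N * (1 - q) powr (1 - p) * V" if q: "0 < q" "q < 1" for q
  proof -
    obtain C where C: "\<And>n. 1 \<le> n \<Longrightarrow> U \<le> (1 - q) powr (1 - p) * max 0 N * (1 - q) powr (1 - p) * V + C * (1 / real n) powr p"
      using Lp_estimate_with_error[OF const \<alpha> p u l q U V] by blast
    have "(\<lambda>n. (1 / real n) powr p) \<longlonglongrightarrow> 0 powr p"
      using p by (intro tendsto_powr2 lim_const_over_n tendsto_const) auto
    then have "(\<lambda>n. (1 - q) powr (1 - p) * max 0 N * (1 - q) powr (1 - p) * V + C * (1 / real n) powr p)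
        \<longlonglongrightarrow> (1 - q) powr (1 - p) * max 0 N * (1 - q) powr (1 - p) * V + C * 0 powr p"
      by (rule tendsto_add[OF tendsto_const tendsto_mult[OF tendsto_const]])
    from LIMSEQ_le_const[OF this] C show ?thesis by auto
  qed
  have "((\<lambda>q. (1 - q) powr (1 - p) * max 0 N * (1 - q) powr (1 - p) * V) \<longlongrightarrow>
      (1 - 0) powr (1 - p) * max 0 N * (1 - 0) powr (1 - p) * V) (at_right 0)"
    by (intro tendsto_intros) auto
  then have "U \<le> (1 - 0) powr (1 - p) * max 0 N * (1 - 0) powr (1 - p) * V"
  proof (rule tendsto_lowerbound)
    show "\<forall>\<^sub>F q in at_right 0. U \<le> (1 - q) powr (1 - p) * max 0 N * (1 - q) powr (1 - p) * V"
      using approx by (auto simp: eventually_at_right[of 0 1] intro!: exI[of _ 1])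
  qed simp
  then have "ennreal U \<le> ennreal (max 0 N * V)" by (intro ennreal_leI) simp
  also have "\<dots> = ennreal N * ennreal V"
    using V(2) by (simp add: ennreal_mult ennreal_max_0)
  finally show ?thesis unfolding U V .
qed

lemma D2_cmult:
  assumes "smooth u"
  shows "D2 i j (\<lambda>x. c * u x) = (\<lambda>x. c * D2 i j u x)"
  unfolding D2_def by (simp add: pd_cmult assms smooth_pd)

text \<open>The definition of \<open>N'\<close> is normalised to directional seminorms at most \<open>1\<close>, so it is applied to \<open>u\<close>
  divided by \<open>H + 1/n\<close>; the summand \<open>1/n\<close> keeps the divisor positive when \<open>H = 0\<close>.\<close>

lemma holder_estimate_D2:
  fixes u :: "real ^ 'd::finite \<Rightarrow> real"
  assumes const: "directional_holder_const TYPE('d) \<alpha> N" and \<alpha>: "0 < \<alpha>" "\<alpha> < 1"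
    and u: "C0_infinity u" and H: "0 \<le> H"
    and dir: "\<And>l x. norm l = 1 \<Longrightarrow> holder_le \<alpha> H (\<lambda>\<mu>::real. D2_dir l u (x + \<mu> *\<^sub>R l))"
  shows "holder_le \<alpha> (max 0 N * H) (D2 i j u)"
proof -
  have smu: "smooth u" using u by (simp add: C0_infinity_iff)
  have "holder_le \<alpha> (max 0 N * H + max 0 N / real n) (D2 i j u)" if n: "1 \<le> n" for n
  proof -
    define r where "r = H + 1 / real n"
    have r: "0 < r" "H \<le> r" using H n by (auto simp: r_def add_nonneg_pos)
    define v where "v = (\<lambda>x. 1 / r * u x)"
    have v: "C0_infinity v"
      using C0_infinity_sum[of "{()}" "\<lambda>_. u" "\<lambda>_. 1 / r"] u by (simp add: v_def)
    obtain A where "C2_bound \<alpha> A v" using C0_infinity_C2_bound[OF v \<alpha>] by blast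
    then have C2: "C2_holder \<alpha> v" by (rule C2_bound_imp_C2_holder)
    have D2v: "D2 i j v = (\<lambda>x. 1 / r * D2 i j u x)" for i j
      unfolding v_def by (rule D2_cmult[OF smu])
    have le1: "holder_seminorm \<alpha> (\<lambda>\<mu>::real. D2_dir l v (x + \<mu> *\<^sub>R l)) \<le> 1" if l: "norm l = 1" for l x
    proof -
      have D2_dir_v: "D2_dir l v = (\<lambda>x. 1 / r * D2_dir l u x)"
        by (rule ext) (simp add: D2_dir_def D2v sum_distrib_left sum_divide_distrib)
      have "holder_le \<alpha> 1 (\<lambda>\<mu>::real. D2_dir l v (x + \<mu> *\<^sub>R l))"
        unfolding holder_le_def
      proof (intro conjI allI)
        fix \<mu> \<nu> :: real
        have "\<bar>D2_dir l u (x + \<mu> *\<^sub>R l) - D2_dir l u (x + \<nu> *\<^sub>R l)\<bar> \<le> H * dist \<mu> \<nu> powr \<alpha>"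
          using dir[OF l, of x] by (simp add: holder_le_def)
        also have "\<dots> \<le> r * dist \<mu> \<nu> powr \<alpha>" using r by (intro mult_right_mono) auto
        finally show "\<bar>D2_dir l v (x + \<mu> *\<^sub>R l) - D2_dir l v (x + \<nu> *\<^sub>R l)\<bar> \<le> 1 * dist \<mu> \<nu> powr \<alpha>"
          unfolding D2_dir_v using r(1) by (simp add: diff_divide_distrib[symmetric] abs_divide pos_divide_le_eq mult.commute)
      qed simp
      then show ?thesis using holder_seminorm_le_iff[of 1 \<alpha> "\<lambda>\<mu>::real. D2_dir l v (x + \<mu> *\<^sub>R l)"] by simp
    qed
    have "holder_seminorm \<alpha> (D2 i j v) \<le> ennreal N"
      using const C2 le1 unfolding directional_holder_const_def by blast
    then have "holder_le \<alpha> (max 0 N) (D2 i j v)"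
      by (subst holder_seminorm_le_iff[symmetric]) (auto simp: ennreal_max_0)
    moreover have "holder_le \<alpha> (\<bar>r\<bar> * max 0 N) (\<lambda>x. r * D2 i j v x)"
      using translation_invariant_seminorm.cmult[OF translation_invariant_seminorm_holder[OF \<alpha>],
          of "max 0 N" "D2 i j v" r] calculation by blast
    moreover have "(\<lambda>x. r * D2 i j v x) = D2 i j u" using r(1) by (simp add: D2v)
    ultimately show ?thesis using r(1) by (simp add: r_def algebra_simps)
  qed
  note approx = this
  show ?thesis by (rule holder_le_limit[OF approx]) (simp_all add: H)
qed

theorem corollary3p5:
  fixes \<alpha> p N0 Np N' :: real
    and a :: "real ^ 'd ^ 'd"
    and u f :: "real ^ 'd \<Rightarrow> real"
  assumes "0 < \<alpha>" "\<alpha> < 1" and "1 < p"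
    and "heat_holder_const \<alpha> N0"
    and "heat_Lp_const \<alpha> p Np"
    and "directional_holder_const TYPE('d) \<alpha> N'"
    and "\<And>i j. a $ i $ j = a $ j $ i"
    and "\<And>\<xi>::real ^ 'd. (\<Sum>i\<in>UNIV. \<Sum>j\<in>UNIV. a $ i $ j * \<xi> $ i * \<xi> $ j) \<ge> (norm \<xi>)\<^sup>2"
    and "C0_infinity u"
    and "f = (\<lambda>x. \<Sum>i\<in>UNIV. \<Sum>j\<in>UNIV. a $ i $ j * D2 i j u x)"
  shows "(\<forall>i j. holder_seminorm \<alpha> (D2 i j u) \<le> ennreal N' * ennreal N0 * holder_seminorm \<alpha> f) \<and>
         (\<forall>l. norm l = 1 \<longrightarrow>
            Lp_norm_pow p UNIV (D2_dir l u) \<le> ennreal Np * Lp_norm_pow p UNIV f)"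
proof (intro conjI allI impI)
  note \<alpha> = assms(1,2) and u = assms(9)
  have smu: "smooth u" using u by (simp add: C0_infinity_iff)
  have dir: "\<exists>y :: 'd \<Rightarrow> real ^ 'd. f = second_order_op l y u" if l: "norm l = 1" for l
  proof -
    obtain y :: "'d \<Rightarrow> real ^ 'd" where
      "\<And>u x. smooth u \<Longrightarrow> (\<Sum>i\<in>UNIV. \<Sum>j\<in>UNIV. a $ i $ j * D2 i j u x) = second_order_op l y u x"
      using elliptic_decomposition[OF assms(7,8) l] by blast
    then show ?thesis using smu assms(10) by auto
  qed
  have D2_dir: "D2_dir l u = pd l (pd l u)" for l
    by (rule ext) (rule D2_dir_eq_pd[OF smu])
  show "Lp_norm_pow p UNIV (D2_dir l u) \<le> ennreal Np * Lp_norm_pow p UNIV f" if l: "norm l = 1" for l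
  proof -
    obtain y :: "'d \<Rightarrow> real ^ 'd" where f: "f = second_order_op l y u" using dir[OF l] by blast
    show ?thesis
      unfolding D2_dir f by (rule Lp_estimate_second_derivative[OF assms(5) \<alpha> assms(3) u l])
  qed
  define H where "H = enn2real (holder_seminorm \<alpha> f)"
  have H: "holder_seminorm \<alpha> f = ennreal H" "0 \<le> H"
  proof -
    obtain l0 :: "real ^ 'd" where "norm l0 = 1"
      using vector_choose_size[of 1] by auto
    then obtain y :: "'d \<Rightarrow> real ^ 'd" where "f = second_order_op l0 y u" using dir by blast
    then have "C0_infinity f" using C0_infinity_second_order_op[OF u] by simp
    then obtain A where "holder_le \<alpha> A f" using C0_infinity_holder_le[OF _ \<alpha>] by blast
    then have "holder_seminorm \<alpha> f \<le> ennreal A"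
      by (subst holder_seminorm_le_iff) (auto simp: holder_le_def)
    then have "holder_seminorm \<alpha> f < top" by (rule le_less_trans) simp
    then show "holder_seminorm \<alpha> f = ennreal H" "0 \<le> H" by (auto simp: H_def)
  qed
  have fH: "holder_le \<alpha> H f"
    using holder_seminorm_le_iff[OF H(2), of \<alpha> f] H(1) by simp
  have line: "holder_le \<alpha> (max 0 N0 * H) (\<lambda>\<mu>::real. D2_dir l u (x + \<mu> *\<^sub>R l))" if l: "norm l = 1" for l x
  proof -
    obtain y :: "'d \<Rightarrow> real ^ 'd" where f: "f = second_order_op l y u" using dir[OF l] by blast
    show ?thesis
      unfolding D2_dir by (rule holder_estimate_along_line[OF assms(4) \<alpha> u l fH[unfolded f]])
  qed
  fix i j
  have "holder_le \<alpha> (max 0 N' * (max 0 N0 * H)) (D2 i j u)"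
    using H(2) by (intro holder_estimate_D2[OF assms(6) \<alpha> u _ line]) auto
  then have "holder_seminorm \<alpha> (D2 i j u) \<le> ennreal (max 0 N' * (max 0 N0 * H))"
    using H(2) by (subst holder_seminorm_le_iff) auto
  also have "\<dots> = ennreal N' * ennreal N0 * holder_seminorm \<alpha> f"
    using H by (simp add: ennreal_mult ennreal_max_0 mult.assoc)
  finally show "holder_seminorm \<alpha> (D2 i j u) \<le> ennreal N' * ennreal N0 * holder_seminorm \<alpha> f" .
qed

end
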